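(* Consider a partial differential equation of the form $$z_{2t}=A(z,z_1,z_2)\,z_3+B(z,z_1,z_2),\qquad A^2+B^2\neq 0. \qquad (E)$$ Then (E) describes pseudospherical surfaces ($\delta=1$) or spherical surfaces ($\delta=-1$), with corresponding functions $f_{ij}=f_{ij}(z,z_1,\dots,z_k)$ such that $f_{11}=\eta$ is constant, $f_{21}$ and $f_{31}$ are linear non-homogeneous functions of $z$ and $z_2$ with constant coefficients, $(f_{31,z_2})^2-\delta (f_{21,z_2})^2\neq0$ and $\eta=0$, if and only if (up to linear coordinate transformations $x\mapsto ax,\ t\mapsto bt,\ z\mapsto cz+c_0$, $abc\neq0$) it can be written in one of the following two forms (with upper and lower signs chosen consistently in each form): **(I)** $$z_{2t}=D_x\psi$$ with $\delta=\pm1$ and associated 1-forms $$\omega_1=-\phi'\,dt,\qquad \omega_2=z_2\,dx+(\psi\pm r\phi)\,dt,\qquad \omega_3=\pm r z_2\,dx+(\pm r\psi+\delta\phi)\,dt,$$ where $r\in\mathbb{R}$ and $\psi=\psi(z,z_1,z_2)$, $\phi=\phi(z_1)$ are real differentiable functions such that $\psi$ is not constant and $\phi''=-(r^2-\delta)\phi$, $\phi\neq0$, i.e. $$\phi=\begin{cases} a\cos\big(\sqrt{r^2-\delta}\,z_1\big)+b\sin\big(\sqrt{r^2-\delta}\,z_1\big), & r^2-\delta>0,\\ a\cosh\big(\sqrt{-r^2+\delta}\,z_1\big)+b\sinh\big(\sqrt{-r^2+\delta}\,z_1\big), & r^2-\delta<0,\end{cases}$$ with $a,b\in\mathbb{R}$,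 $a^2+b^2\neq0$; **(II)** $$z_{2t}=-D_x^2(2\gamma z_1\varphi')-D_x\big((z_2+m)\varphi\big)+2\delta r^2z_1\varphi'$$ with $\delta=\pm1$ and associated 1-forms $$\omega_1=-2r z_1\varphi'\,dt,$$ $$\omega_2=\Big(\frac\mu\gamma(z_2+m)\mp r\frac{\sqrt{\gamma+\delta\mu^2}}{\gamma}\Big)dx+\Big[-\mu D_x(2z_1\varphi')+\Big(-\frac\mu\gamma(z_2+m)\pm r\frac{\sqrt{\gamma+\delta\mu^2}}{\gamma}\Big)\varphi\Big]dt,$$ $$\omega_3=\Big(\pm\frac{\sqrt{\gamma+\delta\mu^2}}{\gamma}(z_2+m)-\delta r\frac\mu\gamma\Big)dx+\Big[\mp\sqrt{\gamma+\delta\mu^2}\,D_x(2z_1\varphi')+\Big(\mp\frac{\sqrt{\gamma+\delta\mu^2}}{\gamma}(z_2+m)+\delta r\frac\mu\gamma\Big)\varphi\Big]dt,$$ where $m,r,\gamma,\mu\in\mathbb{R}$ and $\varphi=\varphi(2mz+z_1^2)$ is a differentiable function (of one variable, evaluated at $2mz+z_1^2$) such that $\gamma\neq0$, $\gamma+\delta\mu^2\geq0$ and $\varphi'\neq0$.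
   Context: Notation: $z=z(x,t)$ is a real function; $z_i=\partial_x^i z$ ($z_0=z$), $z_{2t}=\partial_t z_2$. $D_x$, $D_t$ are the total derivatives with respect to $x$ and $t$; on a function $F(z,z_1,\dots,z_m)$, $D_xF=\sum_i z_{i+1}F_{,z_i}$. A subscript $,z$ or $,z_i$ denotes a partial derivative; $\phi'$, $\varphi'$ are derivatives of the one-variable functions $\phi$, $\varphi$. All functions are differentiable as many times as needed. Inequalities "$\neq0$" for functions are understood generically (on a nonempty open set). Definition. Let $\delta\in\{1,-1\}$. A differential equation $\mathcal{E}$ for $z(x,t)$ describes pseudospherical surfaces (pss) if $\delta=1$, or spherical surfaces (ss) if $\delta=-1$, with corresponding functions $f_{ij}$ ($1\le i\le3$, $1\le j\le2$), if $\mathcal{E}$ is equivalent to (i.e. $z$ solves $\mathcal{E}$ if and only if the following hold) the structure equations $$d\omega_1=\omega_3\wedge\omega_2,\quad d\omega_2=\omega_1\wedge\omega_3,\quad d\omega_3=\delta\,\omega_1\wedge\omega_2$$ of a surface with Gaussian curvature $K=-\delta$, where $\omega_i=f_{i1}dx+f_{i2}dt$ (the associated 1-forms), and $\omega_1\wedge\omega_2\neq0$, i.e. $f_{11}f_{22}-f_{12}f_{21}\neq0$. Here $f_{ij}$ are functions of $z$ and finitely many of its $x$-derivatives. Convention on transformations. The class of equations considered and the conditions on the $f_{i1}$ are invariant under linear coordinate transformations $x\mapsto ax$, $t\mapsto bt$, $z\mapsto cz+c_0$ with $a,b,c,c_0\in\mathbb{R}$, $abc\neq0$ (acting on $A$,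 $B$ and the 1-forms accordingly). The classification is given only up to such transformations. (The constants $a,b$ in form (I) are unrelated to those of the transformations.) *)

theory Defs
  imports "HOL-Analysis.Analysis"
begin

section \<open>Functions of finitely many real variables\<close>

text \<open>
  A point of \<^typ>\<open>nat \<Rightarrow> real\<close> is a jet \<open>(z, z\<^sub>1, z\<^sub>2, \<dots>)\<close>, the component at \<open>i\<close> being the value
  of \<open>z\<^sub>i\<close>. Differential functions live on open sets of jets (for the product topology, so
  an open set restricts only finitely many components near each of its points) and are
  required to depend on finitely many components.
\<close>

type_synonym jet = "nat \<Rightarrow> real"

definition pd :: "nat \<Rightarrow> (jet \<Rightarrow> real) \<Rightarrow> jet \<Rightarrow> real" where
  "pd i F v = deriv (\<lambda>s. F (v(i := s))) (v i)"

primrec Ck_on :: "nat \<Rightarrow> jet set \<Rightarrow> (jet \<Rightarrow> real) \<Rightarrow> bool" where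
  "Ck_on 0 V F \<longleftrightarrow> continuous_on V F"
| "Ck_on (Suc n) V F \<longleftrightarrow>
     continuous_on V F \<and>
     (\<forall>i. (\<forall>v\<in>V. (\<lambda>s. F (v(i := s))) differentiable (at (v i))) \<and> Ck_on n V (pd i F))"

definition smooth_on :: "jet set \<Rightarrow> (jet \<Rightarrow> real) \<Rightarrow> bool" where
  "smooth_on V F \<longleftrightarrow> (\<forall>n. Ck_on n V F)"

definition depends_upto :: "nat \<Rightarrow> jet set \<Rightarrow> (jet \<Rightarrow> real) \<Rightarrow> bool" where
  "depends_upto k V F \<longleftrightarrow> (\<forall>v\<in>V. \<forall>w\<in>V. (\<forall>i\<le>k. v i = w i) \<longrightarrow> F v = F w)"

text \<open>
  Ordinary functions of one, two or three real variables are viewed as functions of the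
  first components; their smoothness is that of \<^const>\<open>smooth_on\<close>.
\<close>

definition lift1 :: "(real \<Rightarrow> real) \<Rightarrow> jet \<Rightarrow> real" where
  "lift1 g v = g (v 0)"

definition lift2 :: "(real \<Rightarrow> real \<Rightarrow> real) \<Rightarrow> jet \<Rightarrow> real" where
  "lift2 g v = g (v 0) (v 1)"

definition lift3 :: "(real \<Rightarrow> real \<Rightarrow> real \<Rightarrow> real) \<Rightarrow> jet \<Rightarrow> real" where
  "lift3 g v = g (v 0) (v 1) (v 2)"

section \<open>Total derivatives\<close>

text \<open>
  For a function depending on finitely many components on an open set the index sets below
  are finite. In \<open>Dt F v p\<close> the argument \<open>p\<close> lists the values of \<open>\<partial>\<^sub>t z\<^sub>i\<close>.
\<close>

definition Dx :: "(jet \<Rightarrow> real) \<Rightarrow> jet \<Rightarrow> real" where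
  "Dx F v = (\<Sum>i | pd i F v \<noteq> 0. v (Suc i) * pd i F v)"

definition Dt :: "(jet \<Rightarrow> real) \<Rightarrow> jet \<Rightarrow> jet \<Rightarrow> real" where
  "Dt F v p = (\<Sum>i | pd i F v \<noteq> 0. p i * pd i F v)"

definition jet_of :: "(real \<Rightarrow> real \<Rightarrow> real) \<Rightarrow> real \<Rightarrow> real \<Rightarrow> jet" where
  "jet_of z x t = (\<lambda>i. (deriv ^^ i) (\<lambda>s. z s t) x)"

definition tjet_of :: "(real \<Rightarrow> real \<Rightarrow> real) \<Rightarrow> real \<Rightarrow> real \<Rightarrow> jet" where
  "tjet_of z x t = (\<lambda>i. deriv (\<lambda>s. jet_of z x s i) t)"

section \<open>Equations describing (pseudo)spherical surfaces\<close>

text \<open>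
  The 1-forms are \<open>\<omega>\<^sub>i = f i 1 dx + f i 2 dt\<close>; \<open>wedge f i j\<close> and \<open>dform f i\<close> are the
  coefficients of \<open>dx \<and> dt\<close> in \<open>\<omega>\<^sub>i \<and> \<omega>\<^sub>j\<close> and in \<open>d\<omega>\<^sub>i\<close>.
\<close>

definition wedge :: "(nat \<Rightarrow> nat \<Rightarrow> jet \<Rightarrow> real) \<Rightarrow> nat \<Rightarrow> nat \<Rightarrow> jet \<Rightarrow> real" where
  "wedge f i j v = f i 1 v * f j 2 v - f i 2 v * f j 1 v"

definition dform :: "(nat \<Rightarrow> nat \<Rightarrow> jet \<Rightarrow> real) \<Rightarrow> nat \<Rightarrow> jet \<Rightarrow> jet \<Rightarrow> real" where
  "dform f i v p = Dx (f i 2) v - Dt (f i 1) v p"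

definition structure_eqs ::
  "real \<Rightarrow> (nat \<Rightarrow> nat \<Rightarrow> jet \<Rightarrow> real) \<Rightarrow> jet \<Rightarrow> jet \<Rightarrow> bool" where
  "structure_eqs \<delta> f v p \<longleftrightarrow>
     dform f 1 v p = wedge f 3 2 v \<and>
     dform f 2 v p = wedge f 1 3 v \<and>
     dform f 3 v p = \<delta> * wedge f 1 2 v"

definition nondegenerate :: "jet set \<Rightarrow> (nat \<Rightarrow> nat \<Rightarrow> jet \<Rightarrow> real) \<Rightarrow> bool" where
  "nondegenerate V f \<longleftrightarrow> (\<forall>v\<in>V. wedge f 1 2 v \<noteq> 0)"

text \<open>
  The equation is \<open>z\<^sub>2\<^sub>t = A(z,z\<^sub>1,z\<^sub>2) z\<^sub>3 + B(z,z\<^sub>1,z\<^sub>2)\<close>. Differential equations are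
  relations between the derivatives of \<open>z\<close> at a point, and their equivalence is required
  at each point: any smooth function satisfies the one at \<open>(x,t)\<close> iff it satisfies the
  other at \<open>(x,t)\<close>. In particular both have the same solutions.
\<close>

definition evolution_eq ::
  "(real \<Rightarrow> real \<Rightarrow> real \<Rightarrow> real) \<Rightarrow> (real \<Rightarrow> real \<Rightarrow> real \<Rightarrow> real) \<Rightarrow> jet \<Rightarrow> jet \<Rightarrow> bool" where
  "evolution_eq A B v p \<longleftrightarrow> p 2 = A (v 0) (v 1) (v 2) * v 3 + B (v 0) (v 1) (v 2)"

definition describes_surfaces ::
  "real \<Rightarrow> jet set \<Rightarrow> (real \<Rightarrow> real \<Rightarrow> real \<Rightarrow> real) \<Rightarrow> (real \<Rightarrow> real \<Rightarrow> real \<Rightarrow> real)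
   \<Rightarrow> (nat \<Rightarrow> nat \<Rightarrow> jet \<Rightarrow> real) \<Rightarrow> bool" where
  "describes_surfaces \<delta> V A B f \<longleftrightarrow>
     (\<exists>k. \<forall>i\<in>{1,2,3}. \<forall>j\<in>{1,2}. depends_upto k V (f i j) \<and> smooth_on V (f i j)) \<and>
     nondegenerate V f \<and>
     (\<forall>W z. open W \<longrightarrow> smooth_on {w. (w 0, w 1) \<in> W} (lift2 z) \<longrightarrow>
        (\<forall>(x, t)\<in>W. jet_of z x t \<in> V \<longrightarrow>
           (evolution_eq A B (jet_of z x t) (tjet_of z x t) \<longleftrightarrow>
            structure_eqs \<delta> f (jet_of z x t) (tjet_of z x t))))"

definition admissible_forms ::
  "real \<Rightarrow> real \<Rightarrow> jet set \<Rightarrow> (nat \<Rightarrow> nat \<Rightarrow> jet \<Rightarrow> real) \<Rightarrow> bool" where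
  "admissible_forms \<eta> \<delta> V f \<longleftrightarrow>
     (\<forall>v\<in>V. f 1 1 v = \<eta>) \<and>
     (\<forall>p\<in>{2,3}. \<exists>\<alpha> \<beta> \<kappa>. \<forall>v\<in>V. f p 1 v = \<alpha> * v 0 + \<beta> * v 2 + \<kappa>) \<and>
     (\<forall>v\<in>V. (pd 2 (f 3 1) v)\<^sup>2 - \<delta> * (pd 2 (f 2 1) v)\<^sup>2 \<noteq> 0)"

section \<open>The two forms\<close>

text \<open>
  \<open>\<epsilon> = 1\<close> and \<open>\<epsilon> = -1\<close> stand for the upper and the lower signs. In the first form the
  explicit formula for \<open>\<phi>\<close> covers only \<open>r\<^sup>2 \<noteq> \<delta>\<close>, which is therefore part of the form.
\<close>

definition form_I ::
  "real \<Rightarrow> jet set \<Rightarrow> (real \<Rightarrow> real \<Rightarrow> real \<Rightarrow> real) \<Rightarrow> (real \<Rightarrow> real \<Rightarrow> real \<Rightarrow> real)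
   \<Rightarrow> (nat \<Rightarrow> nat \<Rightarrow> jet \<Rightarrow> real) \<Rightarrow> bool" where
  "form_I \<delta> V A B f \<longleftrightarrow>
     (\<exists>\<epsilon> r \<psi> \<phi>. \<epsilon> \<in> {1, -1} \<and> r\<^sup>2 \<noteq> \<delta> \<and>
        smooth_on V (lift3 \<psi>) \<and> \<not> lift3 \<psi> constant_on V \<and>
        (\<forall>s. deriv (deriv \<phi>) s = - (r\<^sup>2 - \<delta>) * \<phi> s) \<and>
        (\<exists>a b. a\<^sup>2 + b\<^sup>2 \<noteq> 0 \<and>
           \<phi> = (\<lambda>s. if r\<^sup>2 - \<delta> > 0
                     then a * cos (sqrt (r\<^sup>2 - \<delta>) * s) + b * sin (sqrt (r\<^sup>2 - \<delta>) * s)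
                     else a * cosh (sqrt (- r\<^sup>2 + \<delta>) * s) + b * sinh (sqrt (- r\<^sup>2 + \<delta>) * s))) \<and>
        (\<forall>v\<in>V.
           lift3 A v * v 3 + lift3 B v = Dx (lift3 \<psi>) v \<and>
           f 1 1 v = 0 \<and>
           f 1 2 v = - deriv \<phi> (v 1) \<and>
           f 2 1 v = v 2 \<and>
           f 2 2 v = lift3 \<psi> v + \<epsilon> * r * \<phi> (v 1) \<and>
           f 3 1 v = \<epsilon> * r * v 2 \<and>
           f 3 2 v = \<epsilon> * r * lift3 \<psi> v + \<delta> * \<phi> (v 1)))"

definition form_II ::
  "real \<Rightarrow> jet set \<Rightarrow> (real \<Rightarrow> real \<Rightarrow> real \<Rightarrow> real) \<Rightarrow> (real \<Rightarrow> real \<Rightarrow> real \<Rightarrow> real)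
   \<Rightarrow> (nat \<Rightarrow> nat \<Rightarrow> jet \<Rightarrow> real) \<Rightarrow> bool" where
  "form_II \<delta> V A B f \<longleftrightarrow>
     (\<exists>\<epsilon> m r \<gamma> \<mu> \<phi> I.
        let arg = (\<lambda>v. 2 * m * v 0 + (v 1)\<^sup>2);
            \<Phi> = (\<lambda>v. \<phi> (arg v));
            \<Phi>' = (\<lambda>v. deriv \<phi> (arg v));
            q = sqrt (\<gamma> + \<delta> * \<mu>\<^sup>2)
        in \<epsilon> \<in> {1, -1} \<and> \<gamma> \<noteq> 0 \<and> \<gamma> + \<delta> * \<mu>\<^sup>2 \<ge> 0 \<and>
           open I \<and> arg ` V \<subseteq> I \<and> smooth_on {w. w 0 \<in> I} (lift1 \<phi>) \<and>
           (\<forall>v\<in>V.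
              \<Phi>' v \<noteq> 0 \<and>
              lift3 A v * v 3 + lift3 B v =
                - Dx (Dx (\<lambda>u. 2 * \<gamma> * u 1 * \<Phi>' u)) v - Dx (\<lambda>u. (u 2 + m) * \<Phi> u) v
                + 2 * \<delta> * r\<^sup>2 * v 1 * \<Phi>' v \<and>
              f 1 1 v = 0 \<and>
              f 1 2 v = - 2 * r * v 1 * \<Phi>' v \<and>
              f 2 1 v = \<mu> / \<gamma> * (v 2 + m) - \<epsilon> * r * q / \<gamma> \<and>
              f 2 2 v = - \<mu> * Dx (\<lambda>u. 2 * u 1 * \<Phi>' u) v
                        + (- \<mu> / \<gamma> * (v 2 + m) + \<epsilon> * r * q / \<gamma>) * \<Phi> v \<and>
              f 3 1 v = \<epsilon> * q / \<gamma> * (v 2 + m) - \<delta> * r * \<mu> / \<gamma> \<and>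
              f 3 2 v = - \<epsilon> * q * Dx (\<lambda>u. 2 * u 1 * \<Phi>' u) v
                        + (- \<epsilon> * q / \<gamma> * (v 2 + m) + \<delta> * r * \<mu> / \<gamma>) * \<Phi> v))"

section \<open>Linear coordinate transformations\<close>

text \<open>
  Under \<open>X = a x, T = b t, Z = c z + c0\<close> one has \<open>Z\<^sub>i = c z\<^sub>i / a^i\<close> for \<open>i > 0\<close> and
  \<open>Z\<^sub>2\<^sub>T = c z\<^sub>2\<^sub>t / (a\<^sup>2 b)\<close>, whence the new coefficients \<open>(a/b) A\<close> and \<open>(c/(a\<^sup>2 b)) B\<close>;
  \<open>dx = dX / a\<close> and \<open>dt = dT / b\<close> give the new coefficients of the 1-forms.
  The map \<open>tr_jet (1/a) (1/c) (-c0/c)\<close> is the inverse of \<open>tr_jet a c c0\<close>.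
\<close>

definition tr_jet :: "real \<Rightarrow> real \<Rightarrow> real \<Rightarrow> jet \<Rightarrow> jet" where
  "tr_jet a c c0 v = (\<lambda>i. c * v i / a ^ i + (if i = 0 then c0 else 0))"

definition tr_A ::
  "real \<Rightarrow> real \<Rightarrow> real \<Rightarrow> real \<Rightarrow> (real \<Rightarrow> real \<Rightarrow> real \<Rightarrow> real) \<Rightarrow> real \<Rightarrow> real \<Rightarrow> real \<Rightarrow> real" where
  "tr_A a b c c0 A Z Z1 Z2 = a / b * A ((Z - c0) / c) (a * Z1 / c) (a\<^sup>2 * Z2 / c)"

definition tr_B ::
  "real \<Rightarrow> real \<Rightarrow> real \<Rightarrow> real \<Rightarrow> (real \<Rightarrow> real \<Rightarrow> real \<Rightarrow> real) \<Rightarrow> real \<Rightarrow> real \<Rightarrow> real \<Rightarrow> real" where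
  "tr_B a b c c0 B Z Z1 Z2 = c / (a\<^sup>2 * b) * B ((Z - c0) / c) (a * Z1 / c) (a\<^sup>2 * Z2 / c)"

definition tr_f ::
  "real \<Rightarrow> real \<Rightarrow> real \<Rightarrow> real \<Rightarrow> (nat \<Rightarrow> nat \<Rightarrow> jet \<Rightarrow> real) \<Rightarrow> nat \<Rightarrow> nat \<Rightarrow> jet \<Rightarrow> real" where
  "tr_f a b c c0 f i j w =
     f i j (tr_jet (1 / a) (1 / c) (- c0 / c) w) / (if j = 1 then a else b)"

definition form_I_or_II ::
  "real \<Rightarrow> jet set \<Rightarrow> (real \<Rightarrow> real \<Rightarrow> real \<Rightarrow> real) \<Rightarrow> (real \<Rightarrow> real \<Rightarrow> real \<Rightarrow> real)
   \<Rightarrow> (nat \<Rightarrow> nat \<Rightarrow> jet \<Rightarrow> real) \<Rightarrow> bool" where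
  "form_I_or_II \<delta> V A B f \<longleftrightarrow>
     (\<exists>a b c c0. a * b * c \<noteq> 0 \<and>
        (let V' = tr_jet a c c0 ` V; A' = tr_A a b c c0 A; B' = tr_B a b c c0 B;
             f' = tr_f a b c c0 f
         in form_I \<delta> V' A' B' f' \<or> form_II \<delta> V' A' B' f'))"

section \<open>Generic validity\<close>

definition generically :: "jet set \<Rightarrow> (jet set \<Rightarrow> bool) \<Rightarrow> bool" where
  "generically \<Omega> P \<longleftrightarrow> (\<exists>V\<subseteq>\<Omega>. open V \<and> V \<noteq> {} \<and> P V)"

end

(*
  The evolution equation involves only z_2t, so the coefficients of z in f_21 and f_31 vanish, and
  comparing the highest derivatives in the structure equations shows that f_12, f_22 and f_32 are
  functions of z, z_1, z_2. With f_21 = beta z_2 + kappa, f_31 = beta' z_2 + kappa' and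
  D = beta'^2 - delta beta^2, the combinations g = beta' f_22 - beta f_32 and
  h = beta' f_32 - delta beta f_22 decouple the system: f_12 and g depend on z, z_1 only, g satisfies
  z_1 g_z = m g_z1 and g_z1 = -D f_12, and D_x h is the evolution equation up to a multiple of f_12.
  If W = beta' kappa - beta kappa' vanishes, then equality of the mixed derivatives of f_12 forces
  m = 0 and g_z = 0, so that g solves a linear oscillator equation in z_1 and h is the flux psi of
  form (I). If W is nonzero, then g is constant along the curves 2 m z + z_1^2 = const, which gives
  phi, and h is determined by g and f_12; this is form (II). Conversely, the structure equations of
  both forms are direct computations; form (II) with r = 0 is degenerate, but it is then a
  conservation law and carries the 1-forms of form (I).
*)

theory Submission
  imports Defs
begin

section \<open>Smooth functions of jets\<close>

text \<open>The hypothesis speaks of functions z(x,t), the argument of identities between functions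
  of jets. Once every truncated jet is realised by a polynomial, the z_i and the values of their
  t-derivatives are independent variables and coefficients can be compared: most steps move one
  coordinate that occurs visibly on one side only. A vanishing partial derivative gives independence
  of that coordinate only along connected slices, so the classification is carried out on boxes,
  chosen such that z_1 has no zero there; this permits division by z_1 and fixes a branch of the
  square root.

  As f_11 = 0, nondegeneracy says that f_12 and f_21 have no zeros. If W = m = 0, then kappa = 0, so
  beta must be nonzero; scaling z by beta turns it into 1, which is the normalisation of form (I).
  The constants of form (II) are read off from its 1-forms: gamma = 1/D, mu = beta/D, r = -W/D,
  while m is defined by D m = beta' kappa' - delta beta kappa.\<close>

lemma continuous_on_jet_coord: "continuous_on V (\<lambda>w :: jet. w i)"
  by (rule continuous_on_subset[OF continuous_on_product_coordinates]) simp

lemma continuous_on_jet_update: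
  fixes v :: jet
  assumes "continuous_on S g"
  shows "continuous_on S (\<lambda>x. v(i := g x))"
proof (rule continuous_on_coordinatewise_then_product)
  show "continuous_on S (\<lambda>x. (v(i := g x)) j)" for j
    using assms by (cases "j = i") auto
qed

text \<open>Coordinate lines are continuous curves for the product topology, so a short piece of
  each line through v stays in V. Hence \<open>pd\<close> at v is determined by the values on V; the
  congruence rules for derivatives rest on this.\<close>

lemma open_jet_update:
  fixes V :: "jet set"
  assumes "open V" "v \<in> V"
  shows "\<forall>\<^sub>F s in nhds (v i). v(i := s) \<in> V"
proof -
  have "continuous_on UNIV (\<lambda>s. v(i := s))"
    by (intro continuous_on_jet_update continuous_intros)
  then have "open ((\<lambda>s. v(i := s)) -` V)"
    using assms(1) by (simp add: continuous_on_open_vimage)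
  then show ?thesis
    using assms(2) eventually_nhds_in_open[of "(\<lambda>s. v(i := s)) -` V" "v i"] by simp
qed

lemma pd_cong_open:
  assumes "open V" "v \<in> V" "\<And>w. w \<in> V \<Longrightarrow> F w = G w"
  shows "pd i F v = pd i G v"
  unfolding pd_def
proof (rule deriv_cong_ev[OF _ refl])
  show "\<forall>\<^sub>F s in nhds (v i). F (v(i := s)) = G (v(i := s))"
    by (rule eventually_mono[OF open_jet_update[OF assms(1,2)]]) (rule assms(3))
qed

lemma pdiff_cong_open:
  fixes V :: "jet set"
  assumes "open V" "v \<in> V" "\<And>w. w \<in> V \<Longrightarrow> F w = G w"
    "((\<lambda>s. F (v(i := s))) has_field_derivative D) (at (v i))"
  shows "((\<lambda>s. G (v(i := s))) has_field_derivative D) (at (v i))"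
proof -
  have "\<forall>\<^sub>F s in nhds (v i). F (v(i := s)) = G (v(i := s))"
    by (rule eventually_mono[OF open_jet_update[OF assms(1,2)]]) (rule assms(3))
  from DERIV_cong_ev[OF refl this refl] assms(4) show ?thesis by blast
qed

lemma pd_eqI: "((\<lambda>s. F (v(i := s))) has_field_derivative D) (at (v i)) \<Longrightarrow> pd i F v = D"
  by (simp add: pd_def DERIV_imp_deriv)

lemma has_pd:
  "(\<lambda>s. F (v(i := s))) differentiable (at (v i)) \<Longrightarrow>
   ((\<lambda>s. F (v(i := s))) has_field_derivative pd i F v) (at (v i))"
  by (simp add: pd_def DERIV_deriv_iff_real_differentiable)

section \<open>Calculus of the classes C^k on open sets of jets\<close>

lemma Ck_on_Suc_D: "Ck_on (Suc n) V F \<Longrightarrow> Ck_on n V F"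
  by (induction n arbitrary: F) auto

lemma Ck_on_SucI:
  assumes "open V" "continuous_on V F"
    "\<And>i v. v \<in> V \<Longrightarrow> ((\<lambda>s. F (v(i := s))) has_field_derivative F' i v) (at (v i))"
    "\<And>i. Ck_on n V (pd i F)"
  shows "Ck_on (Suc n) V F"
  using assms by (auto simp: real_differentiable_def)

lemma Ck_on_cong:
  assumes "open V" "\<And>v. v \<in> V \<Longrightarrow> F v = G v" "Ck_on n V F"
  shows "Ck_on n V G"
  using assms(2,3)
proof (induction n arbitrary: F G)
  case 0 then show ?case using continuous_on_eq by force
next
  case (Suc n)
  show ?case
  proof (rule Ck_on_SucI[OF assms(1)])
    show "continuous_on V G" using Suc.prems continuous_on_eq by force
    show "((\<lambda>s. G (v(i := s))) has_field_derivative pd i F v) (at (v i))" if "v \<in> V" for i v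
      by (rule pdiff_cong_open[OF assms(1) that, of F]) (use Suc.prems that has_pd in auto)
    show "Ck_on n V (pd i G)" for i
      by (rule Suc.IH[of "pd i F"]) (use Suc.prems pd_cong_open[OF assms(1), of _ F G] in auto)
  qed
qed

text \<open>\<open>Ck_on\<close> is phrased with \<open>pd\<close>, a \<open>deriv\<close> that by
  itself says nothing about existence. Exhibiting candidates \<open>F'\<close> gives
  differentiability and identifies \<open>pd\<close> with them on V; this is the induction step of
  the rules below.\<close>

lemma Ck_on_Suc_intro:
  assumes "open V" "continuous_on V F"
    "\<And>i v. v \<in> V \<Longrightarrow> ((\<lambda>s. F (v(i := s))) has_field_derivative F' i v) (at (v i))"
    "\<And>i. Ck_on n V (F' i)"
  shows "Ck_on (Suc n) V F"
proof (rule Ck_on_SucI[OF assms(1-3)])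
  show "Ck_on n V (pd i F)" for i
    by (rule Ck_on_cong[OF assms(1) pd_eqI[OF assms(3), symmetric] assms(4)])
qed auto

lemma Ck_on_has_pd:
  "Ck_on (Suc n) V F \<Longrightarrow> v \<in> V \<Longrightarrow>
   ((\<lambda>s. F (v(i := s))) has_field_derivative pd i F v) (at (v i))"
  by (auto intro: has_pd)

lemma Ck_on_const: "Ck_on n V (\<lambda>_. c)"
proof (induction n arbitrary: c)
  case (Suc n)
  have "pd i (\<lambda>_. c) = (\<lambda>_. 0)" for i by (auto simp: pd_def)
  then show ?case using Suc by simp
qed simp

lemma Ck_on_coord: "Ck_on n V (\<lambda>v. v j)"
proof (cases n)
  case 0 then show ?thesis by (simp add: continuous_on_jet_coord)
next
  case (Suc k)
  have eq: "pd i (\<lambda>v. v j) = (\<lambda>_. if i = j then 1 else 0)" for i by (auto simp: pd_def)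
  show ?thesis unfolding Suc
    by (auto simp: eq continuous_on_jet_coord intro!: Ck_on_const)
qed

lemma Ck_on_add:
  assumes "open V" "Ck_on n V F" "Ck_on n V G"
  shows "Ck_on n V (\<lambda>v. F v + G v)"
  using assms(2,3)
proof (induction n arbitrary: F G)
  case 0 then show ?case by (auto intro: continuous_intros)
next
  case (Suc n)
  show ?case
  proof (rule Ck_on_Suc_intro[OF assms(1), where F' = "\<lambda>i v. pd i F v + pd i G v"])
    show "((\<lambda>s. F (v(i := s)) + G (v(i := s))) has_field_derivative pd i F v + pd i G v) (at (v i))"
      if "v \<in> V" for i v
      using Suc.prems[THEN Ck_on_has_pd, OF that] by (rule DERIV_add)
  qed (use Suc in \<open>auto intro!: continuous_on_add\<close>)
qed

lemma Ck_on_mult: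
  assumes "open V" "Ck_on n V F" "Ck_on n V G"
  shows "Ck_on n V (\<lambda>v. F v * G v)"
  using assms(2,3)
proof (induction n arbitrary: F G)
  case 0 then show ?case by (auto intro: continuous_intros)
next
  case (Suc n)
  have C: "Ck_on n V (\<lambda>v. pd i F v * G v + pd i G v * F v)" for i
    using Suc.prems Ck_on_Suc_D[OF Suc.prems(1)] Ck_on_Suc_D[OF Suc.prems(2)]
    by (intro Ck_on_add[OF assms(1)] Suc.IH) simp_all
  have D: "((\<lambda>s. F (v(i := s)) * G (v(i := s))) has_field_derivative pd i F v * G v + pd i G v * F v) (at (v i))"
    if "v \<in> V" for i v
    using DERIV_mult[OF Suc.prems[THEN Ck_on_has_pd, OF that, of i]] unfolding fun_upd_triv .
  have K: "continuous_on V (\<lambda>v. F v * G v)" using Suc.prems by (auto intro!: continuous_on_mult)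
  show ?case by (rule Ck_on_Suc_intro[OF assms(1) K D C])
qed

text \<open>The derivative of g(F) is g'(F) times that of F, so one order lower g' takes the place
  of g: the induction leaves g arbitrary, whereas F stays the same.\<close>

lemma Ck_on_compose1:
  assumes V: "open V" and "open I" "Ck_on n {w. w 0 \<in> I} (lift1 g)" "Ck_on n V F" "F ` V \<subseteq> I"
  shows "Ck_on n V (\<lambda>v. g (F v))"
  using assms(3-5)
proof (induction n arbitrary: g)
  case 0
  then have "continuous_on {w. w 0 \<in> I} (lift1 g)" and F: "continuous_on V F" by auto
  \<comment> \<open>\<open>lift1 g\<close> reads component 0 of a jet, so the number F v is fed to
    it as a constant jet.\<close>
  moreover have "continuous_on V (\<lambda>v. (\<lambda>_. F v) :: jet)"
    using F by (intro continuous_on_coordinatewise_then_product) auto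
  ultimately have "continuous_on V (lift1 g \<circ> (\<lambda>v. (\<lambda>_. F v) :: jet))"
    using 0(3) by (intro continuous_on_compose) (auto intro: continuous_on_subset)
  then show ?case by (simp add: o_def lift1_def)
next
  case (Suc n)
  have g': "(g has_field_derivative deriv g s) (at s)" if "s \<in> I" for s
    using Ck_on_has_pd[OF Suc.prems(1), of "\<lambda>_. s" 0] that by (simp add: lift1_def pd_def)
  have dg: "pd 0 (lift1 g) = lift1 (deriv g)" by (auto simp: pd_def lift1_def)
  have F: "Ck_on n V F" using Ck_on_Suc_D[OF Suc.prems(2)] .
  have gc: "continuous_on I g" using g' by (meson DERIV_isCont continuous_at_imp_continuous_on)
  have "Ck_on n {w. w 0 \<in> I} (pd 0 (lift1 g))" using Suc.prems by simp
  then have "Ck_on n V (\<lambda>v. deriv g (F v))"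
    unfolding dg by (rule Suc.IH[OF _ F Suc.prems(3)])
  moreover have "Ck_on n V (pd i F)" for i using Suc.prems by simp
  ultimately have C: "Ck_on n V (\<lambda>v. deriv g (F v) * pd i F v)" for i
    by (rule Ck_on_mult[OF V])
  have D: "((\<lambda>s. g (F (v(i := s)))) has_field_derivative deriv g (F v) * pd i F v) (at (v i))"
    if "v \<in> V" for i v
  proof (rule DERIV_chain2[OF _ Ck_on_has_pd[OF Suc.prems(2) that]])
    show "(g has_field_derivative deriv g (F v)) (at (F (v(i := v i))))"
      unfolding fun_upd_triv using that Suc.prems(3) by (intro g') auto
  qed
  have K: "continuous_on V (\<lambda>v. g (F v))"
    using continuous_on_compose2[OF gc, of V F] Suc.prems by auto
  show ?case by (rule Ck_on_Suc_intro[OF V K D C])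
qed

lemma smooth_on_continuous: "smooth_on V F \<Longrightarrow> continuous_on V F"
  unfolding smooth_on_def by (metis Ck_on.simps(1))

lemma smooth_on_has_pd:
  "smooth_on V F \<Longrightarrow> v \<in> V \<Longrightarrow>
   ((\<lambda>s. F (v(i := s))) has_field_derivative pd i F v) (at (v i))"
  unfolding smooth_on_def by (rule Ck_on_has_pd) auto

lemma smooth_on_pd: "smooth_on V F \<Longrightarrow> smooth_on V (pd i F)"
  unfolding smooth_on_def by (metis Ck_on.simps(2))

lemma smooth_on_cong:
  "open V \<Longrightarrow> smooth_on V F \<Longrightarrow> (\<And>v. v \<in> V \<Longrightarrow> G v = F v) \<Longrightarrow> smooth_on V G"
  unfolding smooth_on_def by (intro allI, rule Ck_on_cong) auto

lemma smooth_on_subset: "smooth_on V F \<Longrightarrow> U \<subseteq> V \<Longrightarrow> smooth_on U F"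
proof -
  have "Ck_on n V F \<Longrightarrow> U \<subseteq> V \<Longrightarrow> Ck_on n U F" for n
  proof (induction n arbitrary: F)
    case 0 then show ?case using continuous_on_subset[of V F U] by simp
  next
    case (Suc n)
    have "continuous_on U F" using Suc.prems continuous_on_subset[of V F U] by simp
    then show ?case using Suc.prems Suc.IH by (simp add: subset_iff)
  qed
  then show "smooth_on V F \<Longrightarrow> U \<subseteq> V \<Longrightarrow> smooth_on U F" by (auto simp: smooth_on_def)
qed

lemma smooth_on_const: "smooth_on V (\<lambda>_. c)"
  by (simp add: smooth_on_def Ck_on_const)

lemma smooth_on_coord: "smooth_on V (\<lambda>v. v i)"
  by (simp add: smooth_on_def Ck_on_coord)

lemma smooth_on_add:
  "open V \<Longrightarrow> smooth_on V F \<Longrightarrow> smooth_on V G \<Longrightarrow> smooth_on V (\<lambda>v. F v + G v)"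
  unfolding smooth_on_def by (intro allI Ck_on_add) auto

lemma smooth_on_mult:
  "open V \<Longrightarrow> smooth_on V F \<Longrightarrow> smooth_on V G \<Longrightarrow> smooth_on V (\<lambda>v. F v * G v)"
  unfolding smooth_on_def by (intro allI Ck_on_mult) auto

lemma smooth_on_cmult: "open V \<Longrightarrow> smooth_on V F \<Longrightarrow> smooth_on V (\<lambda>v. c * F v)"
  by (rule smooth_on_mult[OF _ smooth_on_const])

lemma smooth_on_minus: "open V \<Longrightarrow> smooth_on V F \<Longrightarrow> smooth_on V (\<lambda>v. - F v)"
  by (rule smooth_on_cmult[of V F "- 1", unfolded mult_minus1])

lemma smooth_on_diff:
  "open V \<Longrightarrow> smooth_on V F \<Longrightarrow> smooth_on V G \<Longrightarrow> smooth_on V (\<lambda>v. F v - G v)"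
  unfolding diff_conv_add_uminus by (intro smooth_on_add smooth_on_minus)

lemma smooth_on_divide_const: "open V \<Longrightarrow> smooth_on V F \<Longrightarrow> smooth_on V (\<lambda>v. F v / c)"
  unfolding divide_inverse by (rule smooth_on_mult[OF _ _ smooth_on_const])

lemma smooth_on_power:
  assumes "open V" "smooth_on V F"
  shows "smooth_on V (\<lambda>v. F v ^ n)"
proof (induction n)
  case 0
  show ?case unfolding power_0 by (rule smooth_on_const)
next
  case (Suc n)
  show ?case unfolding power_Suc by (rule smooth_on_mult[OF assms Suc])
qed

lemma smooth_on_sum:
  assumes "open V" "finite S" "\<And>i. i \<in> S \<Longrightarrow> smooth_on V (F i)"
  shows "smooth_on V (\<lambda>v. \<Sum>i\<in>S. F i v)"
  using assms(2,3)
proof (induction S)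
  case empty
  show ?case unfolding sum.empty by (rule smooth_on_const)
next
  case (insert x S)
  have "smooth_on V (\<lambda>v. F x v + (\<Sum>i\<in>S. F i v))"
    by (rule smooth_on_add[OF assms(1)]) (use insert in auto)
  then show ?case using insert.hyps by simp
qed

lemma smooth_on_compose1:
  assumes "open V" "open I" "smooth_on {w. w 0 \<in> I} (lift1 g)" "smooth_on V F" "F ` V \<subseteq> I"
  shows "smooth_on V (\<lambda>v. g (F v))"
  unfolding smooth_on_def
  by (rule allI, rule Ck_on_compose1[OF assms(1,2) _ _ assms(5)]) (use assms(3,4) in \<open>simp_all add: smooth_on_def\<close>)

lemma open_coord_vimage: "open I \<Longrightarrow> open {w :: jet. w i \<in> I}"
  using open_vimage[OF _ continuous_on_jet_coord[of UNIV i], of I] by (simp add: vimage_def)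

section \<open>Smoothness in one real variable\<close>

lemma smooth_lift1_deriv:
  assumes "smooth_on {w. w 0 \<in> I} (lift1 g)"
  shows "smooth_on {w. w 0 \<in> I} (lift1 (deriv g))"
proof -
  have "pd 0 (lift1 g) = lift1 (deriv g)" by (auto simp: pd_def lift1_def)
  with smooth_on_pd[OF assms, of 0] show ?thesis by simp
qed

lemma smooth_lift1_has_deriv:
  assumes "smooth_on {w. w 0 \<in> I} (lift1 g)" "s \<in> I"
  shows "(g has_field_derivative deriv g s) (at s)"
  using smooth_on_has_pd[OF assms(1), of "\<lambda>_. s" 0] assms(2) by (simp add: lift1_def pd_def)

lemma Ck_on_lift1_Suc:
  assumes "open I" "\<And>s. s \<in> I \<Longrightarrow> (g has_field_derivative g' s) (at s)"
    "Ck_on n {w. w 0 \<in> I} (lift1 g')"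
  shows "Ck_on (Suc n) {w. w 0 \<in> I} (lift1 g)"
proof (rule Ck_on_Suc_intro[where F' = "\<lambda>i v. if i = 0 then lift1 g' v else 0"])
  have "continuous_on I g" using assms(2) by (meson DERIV_isCont continuous_at_imp_continuous_on)
  then show "continuous_on {w. w 0 \<in> I} (lift1 g)"
    unfolding lift1_def by (rule continuous_on_compose2[OF _ continuous_on_jet_coord]) auto
  show "Ck_on n {w. w 0 \<in> I} (\<lambda>v. if i = 0 then lift1 g' v else 0)" for i
    using assms(3) Ck_on_const[of n _ 0] by (cases "i = 0") simp_all
qed (use assms(2) in \<open>auto simp: lift1_def open_coord_vimage assms(1)\<close>)

text \<open>The family c s^p is closed under differentiation, so the induction closes when c and p
  are arbitrary. The exponent 1/2 later gives the square root that solves for z_1.\<close>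

lemma smooth_lift1_powr: "smooth_on {w. w 0 \<in> {0<..}} (lift1 (\<lambda>s. c * s powr p))"
proof -
  have "Ck_on n {w. w 0 \<in> {0<..}} (lift1 (\<lambda>s. c * s powr p))" for n
  proof (induction n arbitrary: c p)
    case 0
    show ?case
      by (auto simp: lift1_def intro!: continuous_intros continuous_on_jet_coord)
  next
    case (Suc n)
    have "((\<lambda>s. c * s powr p) has_field_derivative (c * p) * s powr (p - 1)) (at s)" if "s \<in> {0<..}" for s
      using that by (auto intro!: derivative_eq_intros)
    then show ?case by (rule Ck_on_lift1_Suc[OF _ _ Suc, rotated]) auto
  qed
  then show ?thesis by (simp add: smooth_on_def)
qed

text \<open>The derivative of each of the two functions is a multiple of the other, so their
  smoothness is proved by one joint induction.\<close>

lemma smooth_lift1_oscillator: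
  assumes "\<And>s. (u has_field_derivative w s) (at s)"
    "\<And>s. (w has_field_derivative - k * u s) (at s)"
  shows "smooth_on UNIV (lift1 u)" "smooth_on UNIV (lift1 w)"
proof -
  have *: "Ck_on n {w. w 0 \<in> UNIV} (lift1 u) \<and> Ck_on n {w. w 0 \<in> UNIV} (lift1 w)" for n
  proof (induction n)
    case 0
    have "continuous_on UNIV u"
      using assms(1) by (meson DERIV_isCont continuous_at_imp_continuous_on)
    moreover have "continuous_on UNIV w"
      using assms(2) by (meson DERIV_isCont continuous_at_imp_continuous_on)
    ultimately show ?case
      using continuous_on_compose2[of UNIV u UNIV "\<lambda>w. w 0"] continuous_on_compose2[of UNIV w UNIV "\<lambda>w. w 0"]
      by (simp add: lift1_def[abs_def])
  next
    case (Suc n)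
    then have "Ck_on n {w. w 0 \<in> UNIV} (lift1 u)" "Ck_on n {w. w 0 \<in> UNIV} (lift1 w)" by auto
    moreover have "Ck_on n {w. w 0 \<in> UNIV} (lift1 (\<lambda>s. - k * u s))"
      using Ck_on_mult[OF _ Ck_on_const[of n UNIV "- k"], of "lift1 u"] calculation(1)
      by (simp add: lift1_def[abs_def])
    ultimately show ?case
      using Ck_on_lift1_Suc[OF open_UNIV assms(1), of n] Ck_on_lift1_Suc[OF open_UNIV assms(2), of n] by blast
  qed
  show "smooth_on UNIV (lift1 u)" "smooth_on UNIV (lift1 w)" using * by (auto simp: smooth_on_def)
qed

lemma smooth_lift1_slice:
  assumes "open J" "smooth_on V F" "\<And>y. y \<in> J \<Longrightarrow> c(j := y) \<in> V"
  shows "smooth_on {w. w 0 \<in> J} (lift1 (\<lambda>y. F (c(j := y))))"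
proof -
  have "Ck_on n V F \<Longrightarrow> Ck_on n {w. w 0 \<in> J} (lift1 (\<lambda>y. F (c(j := y))))" for n
  proof (induction n arbitrary: F)
    case 0
    have "continuous_on {w :: jet. w 0 \<in> J} (\<lambda>w. c(j := w 0))"
      by (rule continuous_on_jet_update[OF continuous_on_jet_coord])
    then show ?case
      using 0 assms(3) unfolding lift1_def by (auto intro!: continuous_on_compose2[of V F])
  next
    case (Suc n)
    show ?case
    proof (rule Ck_on_lift1_Suc[OF assms(1), where g' = "\<lambda>y. pd j F (c(j := y))"])
      show "((\<lambda>y. F (c(j := y))) has_field_derivative pd j F (c(j := s))) (at s)" if "s \<in> J" for s
        using Ck_on_has_pd[OF Suc.prems assms(3)[OF that], of j] unfolding fun_upd_upd fun_upd_same .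
      show "Ck_on n {w. w 0 \<in> J} (lift1 (\<lambda>y. pd j F (c(j := y))))"
        by (rule Suc.IH) (use Suc.prems in simp)
    qed
  qed
  then show ?thesis using assms(2) by (auto simp: smooth_on_def)
qed

text \<open>Each coordinate is rescaled and shifted on its own, so the chain rule involves a single
  variable. The inverse of a linear coordinate transformation acts on jets in this way.\<close>

lemma smooth_on_diagonal:
  assumes "open U" "smooth_on V F" "\<And>v. v \<in> U \<Longrightarrow> (\<lambda>i. a i * v i + b i) \<in> V"
  shows "smooth_on U (\<lambda>v. F (\<lambda>i. a i * v i + b i))"
proof -
  have "Ck_on n V F \<Longrightarrow> Ck_on n U (\<lambda>v. F (\<lambda>i. a i * v i + b i))" for n
  proof (induction n arbitrary: F)
    have cont: "continuous_on V F \<Longrightarrow> continuous_on U (\<lambda>v. F (\<lambda>i. a i * v i + b i))" for F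
    proof -
      have "continuous_on U (\<lambda>v. (\<lambda>i. a i * v i + b i))"
        by (intro continuous_on_coordinatewise_then_product)
           (intro continuous_intros continuous_on_jet_coord)
      then show "continuous_on V F \<Longrightarrow> continuous_on U (\<lambda>v. F (\<lambda>i. a i * v i + b i))"
        using assms(3) by (auto intro!: continuous_on_compose2[of V F])
    qed
    { case 0 then show ?case using cont by simp }
    case (Suc n)
    show ?case
    proof (rule Ck_on_Suc_intro[OF assms(1)])
      let ?T = "\<lambda>v i. a i * v i + b i"
      fix i
      show "((\<lambda>s. F (?T (v(i := s)))) has_field_derivative a i * pd i F (?T v)) (at (v i))"
        if "v \<in> U" for v
      proof -
        have "?T (v(i := s)) = (?T v)(i := a i * s + b i)" for s by auto
        moreover have "((\<lambda>s. F ((?T v)(i := s))) has_field_derivative pd i F (?T v)) (at (a i * v i + b i))"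
          using Ck_on_has_pd[OF Suc.prems assms(3)[OF that], of i] .
        then have "((\<lambda>s. F ((?T v)(i := a i * s + b i))) has_field_derivative pd i F (?T v) * a i) (at (v i))"
          by (rule DERIV_chain2) (auto intro!: derivative_eq_intros)
        ultimately show ?thesis by (simp only: mult.commute)
      qed
      have "Ck_on n U (\<lambda>v. pd i F (?T v))" by (rule Suc.IH) (use Suc.prems in auto)
      then show "Ck_on n U (\<lambda>v. a i * pd i F (?T v))"
        by (rule Ck_on_mult[OF assms(1) Ck_on_const])
    qed (use cont Suc.prems in auto)
  qed
  then show ?thesis using assms(2) by (auto simp: smooth_on_def)
qed

section \<open>Total derivatives\<close>

text \<open>The index set in \<open>Dx\<close> varies with the function and the point; passing to a
  fixed finite set containing it makes the sums comparable.\<close>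

lemma Dx_eq_sum:
  assumes "finite S" "\<And>i. i \<notin> S \<Longrightarrow> pd i F v = 0"
  shows "Dx F v = (\<Sum>i\<in>S. v (Suc i) * pd i F v)"
  unfolding Dx_def by (rule sum.mono_neutral_left) (use assms in auto)

lemma Dt_eq_sum:
  assumes "finite S" "\<And>i. i \<notin> S \<Longrightarrow> pd i F v = 0"
  shows "Dt F v p = (\<Sum>i\<in>S. p i * pd i F v)"
  unfolding Dt_def by (rule sum.mono_neutral_left) (use assms in auto)

lemma Dx_cong_open:
  assumes "open V" "v \<in> V" "\<And>w. w \<in> V \<Longrightarrow> F w = G w"
  shows "Dx F v = Dx G v"
  unfolding Dx_def using pd_cong_open[OF assms] by simp

lemma Dt_cong_open:
  assumes "open V" "v \<in> V" "\<And>w. w \<in> V \<Longrightarrow> F w = G w"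
  shows "Dt F v p = Dt G v p"
  unfolding Dt_def using pd_cong_open[OF assms] by simp

lemma depends_upto_eq:
  assumes "depends_upto k V F" "v \<in> V" "w \<in> V" "\<And>i. i \<le> k \<Longrightarrow> v i = w i"
  shows "F v = F w"
  by (rule assms(1)[unfolded depends_upto_def, rule_format, OF assms(2,3)]) (rule assms(4))

lemma depends_uptoI:
  assumes "\<And>v w. v \<in> V \<Longrightarrow> w \<in> V \<Longrightarrow> (\<And>i. i \<le> k \<Longrightarrow> v i = w i) \<Longrightarrow> F v = F w"
  shows "depends_upto k V F"
  unfolding depends_upto_def by (intro ballI impI, rule assms) simp_all

lemma depends_upto_mono: "depends_upto k V F \<Longrightarrow> k \<le> l \<Longrightarrow> depends_upto l V F"
  by (rule depends_uptoI, erule depends_upto_eq) simp_all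

lemma depends_upto_subset: "depends_upto k V F \<Longrightarrow> U \<subseteq> V \<Longrightarrow> depends_upto k U F"
  by (rule depends_uptoI, erule depends_upto_eq) auto

lemma pd_eq_0_beyond:
  assumes "open V" "depends_upto k V F" "v \<in> V" "k < i"
  shows "pd i F v = 0"
proof -
  have "deriv (\<lambda>s. F (v(i := s))) (v i) = deriv (\<lambda>s. F v) (v i)"
  proof (rule deriv_cong_ev[OF _ refl])
    show "\<forall>\<^sub>F s in nhds (v i). F (v(i := s)) = F v"
      by (rule eventually_mono[OF open_jet_update[OF assms(1,3)]])
         (rule depends_upto_eq[OF assms(2)], use assms in auto)
  qed
  then show ?thesis by (simp add: pd_def)
qed

lemma depends_upto_pd:
  assumes "open V" "depends_upto k V F"
  shows "depends_upto k V (pd i F)"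
proof (cases "i \<le> k")
  case True
  show ?thesis
  proof (rule depends_uptoI)
    fix v w assume vw: "v \<in> V" "w \<in> V" "\<And>i. i \<le> k \<Longrightarrow> v i = w i"
    then have vi: "v i = w i" using True by auto
    show "pd i F v = pd i F w" unfolding pd_def
    proof (rule deriv_cong_ev[OF _ vi])
      have "\<forall>\<^sub>F s in nhds (v i). w(i := s) \<in> V" using open_jet_update[OF assms(1) vw(2), of i] vi by simp
      from eventually_conj[OF open_jet_update[OF assms(1) vw(1), of i] this]
      show "\<forall>\<^sub>F s in nhds (v i). F (v(i := s)) = F (w(i := s))"
        by (rule eventually_mono) (rule depends_upto_eq[OF assms(2)], use vw(3) in auto)
    qed
  qed
next
  case False
  then show ?thesis by (intro depends_uptoI) (simp add: pd_eq_0_beyond[OF assms])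
qed

lemma Dx_depends:
  assumes "open V" "depends_upto k V F" "v \<in> V"
  shows "Dx F v = (\<Sum>i\<le>k. v (Suc i) * pd i F v)"
  by (rule Dx_eq_sum) (use pd_eq_0_beyond[OF assms] in auto)

lemma depends_upto_Dx:
  assumes "open V" "depends_upto k V F"
  shows "depends_upto (Suc k) V (Dx F)"
proof (rule depends_uptoI)
  fix v w assume vw: "v \<in> V" "w \<in> V" "\<And>i. i \<le> Suc k \<Longrightarrow> v i = w i"
  have "pd i F v = pd i F w" for i
    by (rule depends_upto_eq[OF depends_upto_pd[OF assms] vw(1,2)]) (use vw(3) in auto)
  then show "Dx F v = Dx F w"
    using vw(3) by (simp add: Dx_depends[OF assms vw(1)] Dx_depends[OF assms vw(2)])
qed

lemma smooth_on_Dx: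
  assumes "open V" "smooth_on V F" "depends_upto k V F"
  shows "smooth_on V (Dx F)"
proof (rule smooth_on_cong[OF assms(1) _ Dx_depends[OF assms(1,3)]])
  show "smooth_on V (\<lambda>v. \<Sum>i\<le>k. v (Suc i) * pd i F v)"
    by (rule smooth_on_sum[OF assms(1)])
       (use assms in \<open>auto intro: smooth_on_mult smooth_on_coord smooth_on_pd\<close>)
qed

lemma Dx_linear:
  assumes "open V" "v \<in> V" "smooth_on V F" "smooth_on V G" "depends_upto k V F" "depends_upto k V G"
  shows "Dx (\<lambda>u. a * F u + b * G u) v = a * Dx F v + b * Dx G v"
proof -
  have pd: "pd i (\<lambda>u. a * F u + b * G u) v = a * pd i F v + b * pd i G v" for i
    using smooth_on_has_pd[OF assms(3,2), of i] smooth_on_has_pd[OF assms(4,2), of i]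
    by (intro pd_eqI DERIV_add DERIV_cmult)
  have "depends_upto k V (\<lambda>u. a * F u + b * G u)"
  proof (rule depends_uptoI)
    fix v w assume vw: "v \<in> V" "w \<in> V" "\<And>i. i \<le> k \<Longrightarrow> v i = w i"
    have "F v = F w" "G v = G w"
      by (rule depends_upto_eq[OF assms(5) vw] depends_upto_eq[OF assms(6) vw], assumption)+
    then show "a * F v + b * G v = a * F w + b * G w" by simp
  qed
  then show ?thesis
    unfolding Dx_depends[OF assms(1) \<open>depends_upto k V (\<lambda>u. a * F u + b * G u)\<close> assms(2)]
      Dx_depends[OF assms(1,5,2)] Dx_depends[OF assms(1,6,2)] pd
    by (simp add: sum.distrib sum_distrib_left algebra_simps)
qed

lemma Dx_cmult:
  assumes "open V" "v \<in> V" "smooth_on V F" "depends_upto k V F"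
  shows "Dx (\<lambda>u. a * F u) v = a * Dx F v"
  using Dx_linear[OF assms(1-3) assms(3) assms(4) assms(4), of a 0] by simp

section \<open>Boxes of jets\<close>

text \<open>The coordinates below N range over intervals and all others are free. Coordinate slices
  are therefore connected, and the coordinates from N on can be set to 0 without leaving the
  box.\<close>

definition jet_box :: "nat \<Rightarrow> jet \<Rightarrow> real \<Rightarrow> jet set" where
  "jet_box N c e = {v. \<forall>i<N. \<bar>v i - c i\<bar> < e}"

lemma open_jet_box: "open (jet_box N c e)"
proof -
  have "jet_box N c e = (\<Inter>i<N. {v. v i \<in> {s. \<bar>s - c i\<bar> < e}})" by (auto simp: jet_box_def)
  moreover have "open {s. \<bar>s - c i\<bar> < e}" for i
    by (intro open_Collect_less continuous_intros)
  ultimately show ?thesis by (simp only:) (intro open_INT ballI open_coord_vimage finite_lessThan)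
qed

lemma jet_box_update: "v \<in> jet_box N c e \<Longrightarrow> (i < N \<Longrightarrow> \<bar>s - c i\<bar> < e) \<Longrightarrow> v(i := s) \<in> jet_box N c e"
  by (auto simp: jet_box_def)

lemma centre_in_jet_box: "e > 0 \<Longrightarrow> c \<in> jet_box N c e"
  by (simp add: jet_box_def)

lemma open_contains_jet_box:
  fixes V :: "jet set"
  assumes "open V" "c \<in> V" "0 < r0"
  obtains N e where "e > 0" "M \<le> N" "e \<le> r0" "jet_box N c e \<subseteq> V"
proof -
  have "openin (product_topology (\<lambda>i. euclidean) UNIV) V" using assms(1) unfolding open_fun_def .
  from product_topology_open_contains_basis[OF this assms(2)] obtain X where
    X: "c \<in> (\<Pi>\<^sub>E i\<in>UNIV. X i)" "\<And>i. open (X i)" "finite {i. X i \<noteq> UNIV}" "(\<Pi>\<^sub>E i\<in>UNIV. X i) \<subseteq> V"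
    by auto
  have "\<exists>e>0. ball (c i) e \<subseteq> X i" for i
    using X(1,2) open_contains_ball_eq[OF X(2)[of i]] by (auto simp: PiE_iff)
  then obtain r where r: "\<And>i. r i > 0" "\<And>i. ball (c i) (r i) \<subseteq> X i" by metis
  define S where "S = {i. X i \<noteq> UNIV}"
  define e1 where "e1 = Min (insert 1 (r ` S))"
  define e where "e = min r0 e1"
  have "e1 > 0" unfolding e1_def using X(3) r(1) S_def by auto
  then have "e > 0" using assms(3) by (simp add: e_def)
  have er: "e \<le> r i" if "i \<in> S" for i
  proof -
    have "e1 \<le> r i" unfolding e1_def using X(3) that S_def by (intro Min_le) auto
    then show ?thesis by (auto simp: e_def)
  qed
  define N where "N = Suc (Max (insert M S))"
  have N: "M \<le> N" "\<And>i. i \<in> S \<Longrightarrow> i < N"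
    using X(3) unfolding N_def S_def by (auto simp: le_SucI less_Suc_eq_le)
  have "jet_box N c e \<subseteq> V"
  proof
    fix v assume v: "v \<in> jet_box N c e"
    have "v i \<in> X i" for i
    proof (cases "i \<in> S")
      case True
      then have "\<bar>v i - c i\<bar> < e" using v N(2) unfolding jet_box_def by simp
      then have "v i \<in> ball (c i) (r i)"
        using er[OF True] by (simp add: dist_real_def abs_minus_commute)
      then show ?thesis using r(2) by blast
    next
      case False
      then show ?thesis unfolding S_def by simp
    qed
    then have "v \<in> (\<Pi>\<^sub>E i\<in>UNIV. X i)" by (intro PiE_I) simp_all
    then show "v \<in> V" by (rule subsetD[OF X(4)])
  qed
  moreover have "e \<le> r0" by (simp add: e_def)
  ultimately show ?thesis using that \<open>e > 0\<close> N(1) by blast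
qed

text \<open>The values s allowed for one coordinate contain a nonempty open set, which is infinite.
  This is the device for comparing coefficients: two different values of a coordinate, all others
  unchanged.\<close>

lemma open_jet_avoid:
  fixes V :: "jet set"
  assumes "open V" "v \<in> V" "finite S"
  obtains s where "s \<notin> S" "v(i := s) \<in> V"
proof -
  obtain A where A: "open A" "v i \<in> A" "\<And>s. s \<in> A \<Longrightarrow> v(i := s) \<in> V"
    using open_jet_update[OF assms(1,2), of i] unfolding eventually_nhds by auto
  have "infinite A" using A(1,2) finite_imp_not_open by blast
  then have "\<not> A \<subseteq> S" using assms(3) finite_subset by blast
  then show ?thesis using that A(3) by blast
qed

lemma has_derivative_0_constant_interval:
  fixes f :: "real \<Rightarrow> real"
  assumes "\<And>x. \<bar>x - c\<bar> < e \<Longrightarrow> (f has_field_derivative 0) (at x)" "\<bar>a - c\<bar> < e" "\<bar>b - c\<bar> < e"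
  shows "f a = f b"
proof -
  have "\<exists>k. \<forall>x\<in>{c - e<..<c + e}. f x = k"
  proof (rule has_field_derivative_zero_constant)
    show "(f has_field_derivative 0) (at x within {c - e<..<c + e})" if "x \<in> {c - e<..<c + e}" for x
      by (rule has_field_derivative_at_within[OF assms(1)]) (use that in auto)
  qed simp
  then obtain k where "\<And>x. x \<in> {c - e<..<c + e} \<Longrightarrow> f x = k" by blast
  moreover have "a \<in> {c - e<..<c + e}" "b \<in> {c - e<..<c + e}" using assms(2,3) by auto
  ultimately show ?thesis by metis
qed

text \<open>In a box the segment between two values of z_(j+1) stays inside, so F is constant along
  it. On an arbitrary open set the slice could be disconnected and F only locally constant.\<close>

lemma depends_upto_reduce:
  assumes "depends_upto (Suc j) (jet_box N c e) F" "Suc j < N" "smooth_on (jet_box N c e) F"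
    "\<And>v. v \<in> jet_box N c e \<Longrightarrow> pd (Suc j) F v = 0"
  shows "depends_upto j (jet_box N c e) F"
proof (rule depends_uptoI)
  fix v w assume vw: "v \<in> jet_box N c e" "w \<in> jet_box N c e" "\<And>i. i \<le> j \<Longrightarrow> v i = w i"
  let ?v = "\<lambda>s. v(Suc j := s)"
  have in_box: "?v s \<in> jet_box N c e" if "\<bar>s - c (Suc j)\<bar> < e" for s
    using vw(1) that by (rule jet_box_update)
  have "F (?v (v (Suc j))) = F (?v (w (Suc j)))"
  proof (rule has_derivative_0_constant_interval[where f = "\<lambda>s. F (?v s)" and c = "c (Suc j)" and e = e])
    show "((\<lambda>s. F (?v s)) has_field_derivative 0) (at s)" if "\<bar>s - c (Suc j)\<bar> < e" for s
      using smooth_on_has_pd[OF assms(3) in_box[OF that], of "Suc j"]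
      unfolding assms(4)[OF in_box[OF that]] fun_upd_upd fun_upd_same .
  qed (use vw assms(2) in \<open>auto simp: jet_box_def\<close>)
  also have "\<dots> = F w"
    by (rule depends_upto_eq[OF assms(1)]) (use vw in_box assms(2) in \<open>auto simp: jet_box_def le_Suc_eq\<close>)
  finally show "F v = F w" by simp
qed

text \<open>If F has order j, then z_(j+1) enters Dx F linearly, with coefficient
  \<open>pd j F\<close>. When the right-hand side has order j as well, changing z_(j+1) alone shows
  that this coefficient is 0.\<close>

lemma pd_top_eq_0:
  assumes "open V" "depends_upto j V F" "depends_upto j V R" "\<And>v. v \<in> V \<Longrightarrow> Dx F v = R v" "v \<in> V"
  shows "pd j F v = 0"
proof -
  obtain s where s: "s \<notin> {v (Suc j)}" "v(Suc j := s) \<in> V"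
    using open_jet_avoid[OF assms(1,5), of "{v (Suc j)}"] by auto
  let ?w = "v(Suc j := s)"
  have pd: "pd i F ?w = pd i F v" for i
    by (rule depends_upto_eq[OF depends_upto_pd[OF assms(1,2)] s(2) assms(5)]) auto
  have "R ?w = R v" by (rule depends_upto_eq[OF assms(3) s(2) assms(5)]) auto
  then have "Dx F ?w = Dx F v" using assms(4)[OF s(2)] assms(4)[OF assms(5)] by simp
  then have "(\<Sum>i\<le>j. ?w (Suc i) * pd i F v) = (\<Sum>i\<le>j. v (Suc i) * pd i F v)"
    unfolding Dx_depends[OF assms(1,2) s(2)] Dx_depends[OF assms(1,2,5)] pd .
  moreover have "(\<Sum>i\<le>j. ?w (Suc i) * pd i F v) = (\<Sum>i<j. v (Suc i) * pd i F v) + s * pd j F v"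
    unfolding lessThan_Suc_atMost[symmetric] sum.lessThan_Suc by simp
  moreover have "(\<Sum>i\<le>j. v (Suc i) * pd i F v) = (\<Sum>i<j. v (Suc i) * pd i F v) + v (Suc j) * pd j F v"
    unfolding lessThan_Suc_atMost[symmetric] sum.lessThan_Suc ..
  ultimately show ?thesis using s(1) by auto
qed

section \<open>From solutions to jets\<close>

text \<open>The equivalence of the two equations with the jet v and the t-derivatives p as
  independent variables, no function z being involved. Nondegeneracy is kept apart so that it can be
  arranged by shrinking V.\<close>

definition pointwise_equivalent ::
  "real \<Rightarrow> jet set \<Rightarrow> (real \<Rightarrow> real \<Rightarrow> real \<Rightarrow> real) \<Rightarrow> (real \<Rightarrow> real \<Rightarrow> real \<Rightarrow> real)
   \<Rightarrow> (nat \<Rightarrow> nat \<Rightarrow> jet \<Rightarrow> real) \<Rightarrow> bool" where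
  "pointwise_equivalent \<delta> V A B f \<longleftrightarrow>
     (\<exists>k. \<forall>i\<in>{1,2,3}. \<forall>j\<in>{1,2}. depends_upto k V (f i j) \<and> smooth_on V (f i j)) \<and>
     (\<forall>v\<in>V. \<forall>p. evolution_eq A B v p \<longleftrightarrow> structure_eqs \<delta> f v p)"

lemma pointwise_equivalent_imp_describes:
  assumes "pointwise_equivalent \<delta> V A B f" "nondegenerate V f"
  shows "describes_surfaces \<delta> V A B f"
  using assms unfolding describes_surfaces_def pointwise_equivalent_def by blast

lemma pointwise_equivalent_subset:
  assumes "pointwise_equivalent \<delta> V A B f" "U \<subseteq> V"
  shows "pointwise_equivalent \<delta> U A B f"
proof -
  from assms(1) obtain k where
    "\<And>i j. i \<in> {1,2,3} \<Longrightarrow> j \<in> {1,2} \<Longrightarrow> depends_upto k V (f i j) \<and> smooth_on V (f i j)"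
    unfolding pointwise_equivalent_def by blast
  then have "\<forall>i\<in>{1,2,3}. \<forall>j\<in>{1,2}. depends_upto k U (f i j) \<and> smooth_on U (f i j)"
    using depends_upto_subset[OF _ assms(2)] smooth_on_subset[OF _ assms(2)] by blast
  then show ?thesis using assms unfolding pointwise_equivalent_def by blast
qed

text \<open>With the factorials as denominators, differentiation is a shift of the coefficients, so
  the derivatives at 0 of such a polynomial are the prescribed numbers.\<close>

lemma deriv_taylor_sum:
  fixes c :: "nat \<Rightarrow> real"
  shows "deriv (\<lambda>x. \<Sum>j<Suc n. c j * x ^ j / fact j) = (\<lambda>x. \<Sum>j<n. c (Suc j) * x ^ j / fact j)"
proof (rule ext, rule DERIV_imp_deriv)
  fix x :: real
  have "((\<lambda>x. c j * x ^ j / fact j) has_field_derivative c j * (real j * x ^ (j - 1)) / fact j) (at x)" for j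
    by (auto intro!: derivative_eq_intros)
  then have "((\<lambda>x. \<Sum>j<Suc n. c j * x ^ j / fact j) has_field_derivative
      (\<Sum>j<Suc n. c j * (real j * x ^ (j - 1)) / fact j)) (at x)"
    by (intro DERIV_sum)
  moreover have "c (Suc j) * (real (Suc j) * x ^ j) / fact (Suc j) = c (Suc j) * x ^ j / fact j" for j
    unfolding fact_Suc of_nat_mult by (simp add: divide_simps del: of_nat_Suc)
  then have "(\<Sum>j<Suc n. c j * (real j * x ^ (j - 1)) / fact j) = (\<Sum>j<n. c (Suc j) * x ^ j / fact j)"
    unfolding sum.lessThan_Suc_shift by simp
  ultimately show "((\<lambda>x. \<Sum>j<Suc n. c j * x ^ j / fact j) has_field_derivative
      (\<Sum>j<n. c (Suc j) * x ^ j / fact j)) (at x)" by simp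
qed

lemma higher_deriv_taylor_sum:
  fixes c :: "nat \<Rightarrow> real"
  shows "(deriv ^^ i) (\<lambda>x. \<Sum>j<n. c j * x ^ j / fact j) = (\<lambda>x. \<Sum>j<n - i. c (j + i) * x ^ j / fact j)"
proof (induction i)
  case (Suc i)
  show ?case
  proof (cases "i < n")
    case True
    then have "n - i = Suc (n - Suc i)" by simp
    then show ?thesis using Suc deriv_taylor_sum[of "\<lambda>j. c (j + i)" "n - Suc i"] by simp
  next
    case False
    then show ?thesis using Suc by simp
  qed
qed simp

lemma taylor_jet:
  fixes c :: "nat \<Rightarrow> real"
  shows "(deriv ^^ i) (\<lambda>x. \<Sum>j<n. c j * x ^ j / fact j) 0 = (if i < n then c i else 0)"
proof (cases "i < n")
  case True
  then have "n - i = Suc (n - Suc i)" by simp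
  then have "(\<Sum>j<n - i. c (j + i) * 0 ^ j / fact j) = c i"
    by (simp only: sum.lessThan_Suc_shift) simp
  then show ?thesis using True by (simp add: higher_deriv_taylor_sum)
qed (simp add: higher_deriv_taylor_sum)

text \<open>The structure equations see the jet to order k + 1, one order being added by Dx of f_12,
  f_22, f_32, and see the t-derivatives to order k.\<close>

lemma structure_eqs_cong:
  assumes "open U" "\<And>i j. i \<in> {1,2,3} \<Longrightarrow> j \<in> {1,2} \<Longrightarrow> depends_upto k U (f i j)"
    "v \<in> U" "w \<in> U" "\<And>i. i \<le> Suc k \<Longrightarrow> v i = w i" "\<And>i. i \<le> k \<Longrightarrow> p i = q i"
  shows "structure_eqs \<delta> f v p \<longleftrightarrow> structure_eqs \<delta> f w q"
proof -
  have f: "f i j v = f i j w" if "i \<in> {1,2,3}" "j \<in> {1,2}" for i j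
    by (rule depends_upto_eq[OF assms(2)[OF that] assms(3,4)]) (use assms(5) in auto)
  have dx: "Dx (f i 2) v = Dx (f i 2) w" if "i \<in> {1,2,3}" for i
    by (rule depends_upto_eq[OF depends_upto_Dx[OF assms(1) assms(2)] assms(3,4)]) (use that assms(5) in auto)
  have dt: "Dt (f i 1) v p = Dt (f i 1) w q" if "i \<in> {1,2,3}" for i
  proof -
    have dep: "depends_upto k U (f i 1)" using assms(2) that by simp
    have "pd j (f i 1) v = pd j (f i 1) w" for j
      by (rule depends_upto_eq[OF depends_upto_pd[OF assms(1) dep] assms(3,4)]) (use assms(5) in auto)
    moreover have "Dt (f i 1) v p = (\<Sum>j\<le>k. p j * pd j (f i 1) v)"
      by (rule Dt_eq_sum) (use pd_eq_0_beyond[OF assms(1) dep assms(3)] in auto)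
    moreover have "Dt (f i 1) w q = (\<Sum>j\<le>k. q j * pd j (f i 1) w)"
      by (rule Dt_eq_sum) (use pd_eq_0_beyond[OF assms(1) dep assms(4)] in auto)
    ultimately show ?thesis using assms(6) by simp
  qed
  have f': "f 1 1 v = f 1 1 w" "f 1 2 v = f 1 2 w" "f 2 1 v = f 2 1 w" "f 2 2 v = f 2 2 w"
    "f 3 1 v = f 3 1 w" "f 3 2 v = f 3 2 w" by (simp_all add: f)
  have "dform f i v p = dform f i w q" if "i \<in> {1,2,3}" for i
    using dx[OF that] dt[OF that] by (simp add: dform_def)
  moreover have "wedge f 3 2 v = wedge f 3 2 w" "wedge f 1 3 v = wedge f 1 3 w" "wedge f 1 2 v = wedge f 1 2 w"
    unfolding wedge_def using f' by simp_all
  ultimately show ?thesis by (simp add: structure_eqs_def)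
qed

text \<open>Every pair of truncated jets is realised at the origin by a polynomial \<open>z(x,t)\<close> that is
  affine in \<open>t\<close>.\<close>

lemma describes_imp_pointwise_equivalent:
  assumes "describes_surfaces \<delta> V A B f" "jet_box N c e \<subseteq> V"
    "\<And>i j. i \<in> {1,2,3} \<Longrightarrow> j \<in> {1,2} \<Longrightarrow> depends_upto k V (f i j)" "Suc k < N" "3 < N"
  shows "pointwise_equivalent \<delta> (jet_box N c e) A B f"
proof -
  let ?U = "jet_box N c e"
  have dep: "depends_upto k ?U (f i j)" if "i \<in> {1,2,3}" "j \<in> {1,2}" for i j
    using depends_upto_subset[OF assms(3)[OF that] assms(2)] .
  from assms(1) have "\<forall>i\<in>{1,2,3}. \<forall>j\<in>{1,2}. smooth_on V (f i j)"
    unfolding describes_surfaces_def by blast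
  then have smooth: "smooth_on ?U (f i j)" if "i \<in> {1,2,3}" "j \<in> {1,2}" for i j
    using smooth_on_subset[OF _ assms(2)] that by blast
  have eqv: "evolution_eq A B v p \<longleftrightarrow> structure_eqs \<delta> f v p" if v: "v \<in> ?U" for v p
  proof -
    define z where "z = (\<lambda>x t. \<Sum>j<N. (v j + t * p j) * x ^ j / fact j)"
    \<comment> \<open>All x-derivatives of z of order N or more vanish, so its jets are the
      truncations v' and p'. The box does not restrict these components, hence v' lies in it, and
      neither equation sees them.\<close>
    define v' p' where "v' = (\<lambda>i. if i < N then v i else 0)" and "p' = (\<lambda>i. if i < N then p i else 0)"
    have jet: "jet_of z 0 s = (\<lambda>i. if i < N then v i + s * p i else 0)" for s
      unfolding jet_of_def z_def using taylor_jet[of _ "\<lambda>j. v j + s * p j" N] by auto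
    have v': "jet_of z 0 0 = v'" by (auto simp: jet v'_def)
    have p': "tjet_of z 0 0 = p'"
    proof
      fix i
      have "((\<lambda>s. v i + s * p i) has_field_derivative p i) (at 0)"
        by (auto intro!: derivative_eq_intros)
      then show "tjet_of z 0 0 i = p' i"
        by (cases "i < N") (simp_all add: tjet_of_def jet p'_def DERIV_imp_deriv)
    qed
    have z: "smooth_on {w. (w 0, w 1) \<in> UNIV} (lift2 z)"
    proof -
      have "smooth_on UNIV (\<lambda>w::jet. \<Sum>j<N. (v j + w 1 * p j) * w 0 ^ j / fact j)"
        by (intro smooth_on_sum smooth_on_divide_const smooth_on_mult smooth_on_add smooth_on_const
            smooth_on_coord smooth_on_power) simp_all
      then show ?thesis by (simp add: lift2_def[abs_def] z_def)
    qed
    have v'U: "v' \<in> ?U" using v by (simp add: jet_box_def v'_def)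
    have "evolution_eq A B v' p' \<longleftrightarrow> structure_eqs \<delta> f v' p'"
    proof -
      have "\<forall>(x, t)\<in>UNIV. jet_of z x t \<in> V \<longrightarrow> (evolution_eq A B (jet_of z x t) (tjet_of z x t) \<longleftrightarrow>
            structure_eqs \<delta> f (jet_of z x t) (tjet_of z x t))"
        using assms(1) z unfolding describes_surfaces_def by blast
      then have "jet_of z 0 0 \<in> V \<longrightarrow> (evolution_eq A B (jet_of z 0 0) (tjet_of z 0 0) \<longleftrightarrow>
            structure_eqs \<delta> f (jet_of z 0 0) (tjet_of z 0 0))" by blast
      then show ?thesis using v'U assms(2) unfolding v' p' by blast
    qed
    moreover have "structure_eqs \<delta> f v' p' \<longleftrightarrow> structure_eqs \<delta> f v p"
      by (rule structure_eqs_cong[OF open_jet_box dep v'U v]) (use assms(4) in \<open>auto simp: v'_def p'_def\<close>)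
    moreover have "evolution_eq A B v' p' \<longleftrightarrow> evolution_eq A B v p"
      using assms(5) by (simp add: evolution_eq_def v'_def p'_def)
    ultimately show ?thesis by simp
  qed
  show ?thesis unfolding pointwise_equivalent_def
  proof (intro conjI)
    show "\<exists>k. \<forall>i\<in>{1,2,3}. \<forall>j\<in>{1,2}. depends_upto k ?U (f i j) \<and> smooth_on ?U (f i j)"
      using dep smooth by blast
  qed (use eqv in blast)
qed

section \<open>Linear coordinate transformations\<close>

context
  fixes a b c c0 :: real
  assumes nz: "a \<noteq> 0" "b \<noteq> 0" "c \<noteq> 0"
begin

abbreviation (input) "tr \<equiv> tr_jet a c c0"
abbreviation (input) "tr_inv \<equiv> tr_jet (1 / a) (1 / c) (- c0 / c)"

lemma tr_inv_tr: "tr_inv (tr v) = v"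
  using nz by (auto simp: tr_jet_def field_simps)

lemma tr_tr_inv: "tr (tr_inv v) = v"
  using nz by (auto simp: tr_jet_def field_simps)

lemma tr_image: "tr ` V = tr_inv -` V"
  using tr_inv_tr tr_tr_inv by (auto simp: image_iff) (metis tr_tr_inv)

lemma tr_inv_diagonal: "tr_inv w = (\<lambda>i. (a ^ i / c) * w i + (if i = 0 then - c0 / c else 0))"
  using nz by (auto simp: tr_jet_def field_simps)

lemma open_tr_image: "open V \<Longrightarrow> open (tr ` V)"
proof -
  have "continuous_on UNIV tr_inv"
    unfolding tr_inv_diagonal[abs_def]
    by (intro continuous_on_coordinatewise_then_product) (intro continuous_intros continuous_on_jet_coord)
  then show "open V \<Longrightarrow> open (tr ` V)" unfolding tr_image by (rule open_vimage[rotated])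
qed

text \<open>The factor a^i / c is the inverse of the factor in Z_i = c z_i / a^i. The number d
  stands for a or b, by which the coefficients of dx and dt are divided.\<close>

lemma pd_tr:
  assumes "smooth_on V F" "v \<in> V"
  shows "pd i (\<lambda>w. F (tr_inv w) / d) (tr v) = a ^ i / (c * d) * pd i F v"
proof (rule pd_eqI)
  have upd: "tr_inv ((tr v)(i := s)) = v(i := a ^ i / c * s + (if i = 0 then - c0 / c else 0))" for s
  proof
    fix j
    have "tr_inv (tr v) j = v j" by (simp only: tr_inv_tr)
    then show "tr_inv ((tr v)(i := s)) j = (v(i := a ^ i / c * s + (if i = 0 then - c0 / c else 0))) j"
      unfolding tr_inv_diagonal by simp
  qed
  have vi: "a ^ i / c * tr v i + (if i = 0 then - c0 / c else 0) = v i"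
    using fun_cong[OF tr_inv_tr, of v i] unfolding tr_inv_diagonal .
  have "((\<lambda>s. F (v(i := s))) has_field_derivative pd i F v)
      (at (a ^ i / c * tr v i + (if i = 0 then - c0 / c else 0)))"
    unfolding vi by (rule smooth_on_has_pd[OF assms])
  then have "((\<lambda>s. F (v(i := a ^ i / c * s + (if i = 0 then - c0 / c else 0))))
      has_field_derivative pd i F v * (a ^ i / c)) (at (tr v i))"
    by (rule DERIV_chain2) (use nz in \<open>auto intro!: derivative_eq_intros\<close>)
  then have "((\<lambda>s. F (v(i := a ^ i / c * s + (if i = 0 then - c0 / c else 0))) / d)
      has_field_derivative pd i F v * (a ^ i / c) / d) (at (tr v i))"
    by (rule DERIV_cdivide)
  then show "((\<lambda>s. F (tr_inv ((tr v)(i := s))) / d) has_field_derivative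
      a ^ i / (c * d) * pd i F v) (at (tr v i))"
    unfolding upd by (simp add: mult.commute)
qed

text \<open>The scaling c / a^(i+1) of z_(i+1) and the scaling a^i / (c b) of the derivative
  multiply to 1 / (a b) for every i. All terms of the structure equations acquire this same
  factor.\<close>

lemma Dx_tr:
  assumes "smooth_on V F" "v \<in> V"
  shows "Dx (\<lambda>w. F (tr_inv w) / b) (tr v) = Dx F v / (a * b)"
proof -
  have "tr v (Suc i) * (a ^ i / (c * b) * pd i F v) = v (Suc i) * pd i F v / (a * b)" for i
    using nz by (simp add: tr_jet_def field_simps)
  moreover have "{i. a ^ i / (c * b) * pd i F v \<noteq> 0} = {i. pd i F v \<noteq> 0}"
    using nz by auto
  ultimately show ?thesis
    unfolding Dx_def pd_tr[OF assms] by (simp only: sum_divide_distrib)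
qed

text \<open>The argument c p_i / (a^i b) is the T-derivative of Z_i when p_i is the t-derivative of
  z_i.\<close>

lemma Dt_tr:
  assumes "smooth_on V F" "v \<in> V"
  shows "Dt (\<lambda>w. F (tr_inv w) / a) (tr v) (\<lambda>i. c * p i / (a ^ i * b)) = Dt F v p / (a * b)"
proof -
  have "c * p i / (a ^ i * b) * (a ^ i / (c * a) * pd i F v) = p i * pd i F v / (a * b)" for i
    using nz by (simp add: field_simps)
  moreover have "{i. a ^ i / (c * a) * pd i F v \<noteq> 0} = {i. pd i F v \<noteq> 0}"
    using nz by auto
  ultimately show ?thesis
    unfolding Dt_def pd_tr[OF assms] by (simp only: sum_divide_distrib)
qed

lemma tr_f_1: "tr_f a b c c0 f i 1 = (\<lambda>w. f i 1 (tr_inv w) / a)"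
  and tr_f_2: "tr_f a b c c0 f i 2 = (\<lambda>w. f i 2 (tr_inv w) / b)"
  by (auto simp: tr_f_def)

lemma tr_f_tr: "tr_f a b c c0 f i 1 (tr v) = f i 1 v / a" "tr_f a b c c0 f i 2 (tr v) = f i 2 v / b"
  unfolding tr_f_1 tr_f_2 tr_inv_tr by (rule refl)+

lemma wedge_tr: "wedge (tr_f a b c c0 f) i j (tr v) = wedge f i j v / (a * b)"
  unfolding wedge_def tr_f_tr using nz by (simp add: field_simps)

lemma structure_eqs_tr:
  assumes "\<And>i j. i \<in> {1,2,3} \<Longrightarrow> j \<in> {1,2} \<Longrightarrow> smooth_on V (f i j)" "v \<in> V"
  shows "structure_eqs \<delta> (tr_f a b c c0 f) (tr v) (\<lambda>i. c * p i / (a ^ i * b)) \<longleftrightarrow> structure_eqs \<delta> f v p"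
proof -
  have "dform (tr_f a b c c0 f) i (tr v) (\<lambda>i. c * p i / (a ^ i * b)) = dform f i v p / (a * b)"
    if "i \<in> {1,2,3}" for i
    unfolding dform_def tr_f_1 tr_f_2
    using Dx_tr[OF assms(1)[OF that, of 2] assms(2)] Dt_tr[OF assms(1)[OF that, of 1] assms(2), of p]
    by (simp add: diff_divide_distrib)
  then show ?thesis using nz unfolding structure_eqs_def wedge_tr by simp
qed

lemma evolution_eq_tr:
  "evolution_eq (tr_A a b c c0 A) (tr_B a b c c0 B) (tr v) (\<lambda>i. c * p i / (a ^ i * b)) \<longleftrightarrow> evolution_eq A B v p"
proof -
  have "(tr v 0 - c0) / c = v 0" "a * tr v 1 / c = v 1" "a\<^sup>2 * tr v 2 / c = v 2" "tr v 3 = c * v 3 / a ^ 3"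
    using nz by (simp_all add: tr_jet_def power2_eq_square)
  moreover have "c * p 2 / (a ^ 2 * b) = a / b * x * (c * v 3 / a ^ 3) + c / (a\<^sup>2 * b) * y \<longleftrightarrow>
      p 2 = x * v 3 + y" for x y
  proof -
    have "a / b * x * (c * v 3 / a ^ 3) + c / (a\<^sup>2 * b) * y = c * (x * v 3 + y) / (a ^ 2 * b)"
      using nz by (simp add: field_simps power2_eq_square power3_eq_cube)
    then show ?thesis using nz by simp
  qed
  ultimately show ?thesis unfolding evolution_eq_def tr_A_def tr_B_def by presburger
qed

lemma lift3_tr:
  "lift3 (tr_A a b c c0 A) (tr v) = a / b * lift3 A v"
  "lift3 (tr_B a b c c0 B) (tr v) = c / (a\<^sup>2 * b) * lift3 B v"
proof -
  have "(tr v 0 - c0) / c = v 0" "a * tr v 1 / c = v 1" "a\<^sup>2 * tr v 2 / c = v 2"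
    using nz by (simp_all add: tr_jet_def power2_eq_square)
  then show "lift3 (tr_A a b c c0 A) (tr v) = a / b * lift3 A v"
    "lift3 (tr_B a b c c0 B) (tr v) = c / (a\<^sup>2 * b) * lift3 B v"
    unfolding lift3_def tr_A_def tr_B_def by simp_all
qed

lemma pointwise_equivalent_tr:
  assumes "open V" "pointwise_equivalent \<delta> V A B f"
  shows "pointwise_equivalent \<delta> (tr ` V) (tr_A a b c c0 A) (tr_B a b c c0 B) (tr_f a b c c0 f)"
proof -
  from assms(2) obtain k where k: "\<And>i j. i \<in> {1,2,3} \<Longrightarrow> j \<in> {1,2} \<Longrightarrow> depends_upto k V (f i j)"
    and sm: "\<And>i j. i \<in> {1,2,3} \<Longrightarrow> j \<in> {1,2} \<Longrightarrow> smooth_on V (f i j)"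
    and eqv: "\<And>v p. v \<in> V \<Longrightarrow> evolution_eq A B v p \<longleftrightarrow> structure_eqs \<delta> f v p"
    unfolding pointwise_equivalent_def by blast
  have dep: "depends_upto k (tr ` V) (tr_f a b c c0 f i j)" if ij: "i \<in> {1,2,3}" "j \<in> {1,2}" for i j
  proof (rule depends_uptoI)
    fix v w assume vw: "v \<in> tr ` V" "w \<in> tr ` V" "\<And>i. i \<le> k \<Longrightarrow> v i = w i"
    have "f i j (tr_inv v) = f i j (tr_inv w)"
    proof (rule depends_upto_eq[OF k[OF ij]])
      show "tr_inv v \<in> V" "tr_inv w \<in> V" using vw(1,2) unfolding tr_image by auto
      show "tr_inv v i = tr_inv w i" if "i \<le> k" for i
        unfolding tr_inv_diagonal vw(3)[OF that] ..
    qed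
    then show "tr_f a b c c0 f i j v = tr_f a b c c0 f i j w" by (simp add: tr_f_def)
  qed
  have smooth: "smooth_on (tr ` V) (tr_f a b c c0 f i j)" if ij: "i \<in> {1,2,3}" "j \<in> {1,2}" for i j
  proof -
    have "smooth_on (tr ` V) (\<lambda>w. f i j (tr_inv w))"
      unfolding tr_inv_diagonal
    proof (rule smooth_on_diagonal[OF open_tr_image[OF assms(1)] sm[OF ij]])
      show "(\<lambda>i. (a ^ i / c) * v i + (if i = 0 then - c0 / c else 0)) \<in> V" if "v \<in> tr ` V" for v
        using that unfolding tr_image vimage_def tr_inv_diagonal by simp
    qed
    then show ?thesis
      unfolding tr_f_def by (rule smooth_on_divide_const[OF open_tr_image[OF assms(1)]])
  qed
  have ev: "evolution_eq (tr_A a b c c0 A) (tr_B a b c c0 B) v' p' \<longleftrightarrow> structure_eqs \<delta> (tr_f a b c c0 f) v' p'"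
    if "v' \<in> tr ` V" for v' p'
  proof -
    obtain v where v: "v \<in> V" "v' = tr v" using \<open>v' \<in> tr ` V\<close> by blast
    define p where "p = (\<lambda>i. p' i * (a ^ i * b) / c)"
    have p: "p' = (\<lambda>i. c * p i / (a ^ i * b))" using nz by (simp add: p_def)
    have "structure_eqs \<delta> (tr_f a b c c0 f) (tr v) p' \<longleftrightarrow> structure_eqs \<delta> f v p"
      by (subst p, rule structure_eqs_tr[OF sm v(1)])
    moreover have "evolution_eq (tr_A a b c c0 A) (tr_B a b c c0 B) (tr v) p' \<longleftrightarrow> evolution_eq A B v p"
      by (subst p, rule evolution_eq_tr)
    ultimately show ?thesis unfolding v(2) by (simp only: eqv[OF v(1)])
  qed
  show ?thesis unfolding pointwise_equivalent_def
    by (intro conjI exI[of _ k] ballI allI) (rule dep smooth ev; assumption)+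
qed

lemma admissible_forms_tr:
  assumes "admissible_forms 0 \<delta> V f"
    "\<And>i j. i \<in> {1,2,3} \<Longrightarrow> j \<in> {1,2} \<Longrightarrow> smooth_on V (f i j)"
  shows "admissible_forms 0 \<delta> (tr ` V) (tr_f a b c c0 f)"
  unfolding admissible_forms_def
proof (intro conjI ballI)
  fix v' assume "v' \<in> tr ` V"
  then obtain v where v: "v \<in> V" "v' = tr v" by auto
  show "tr_f a b c c0 f 1 1 v' = 0"
    using assms(1) v unfolding v(2) tr_f_tr admissible_forms_def by simp
  have "pd 2 (tr_f a b c c0 f i 1) v' = a / c * pd 2 (f i 1) v" if "i \<in> {1,2,3}" for i
  proof -
    have "pd 2 (tr_f a b c c0 f i 1) v' = a ^ 2 / (c * a) * pd 2 (f i 1) v"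
      unfolding v(2) tr_f_1 by (rule pd_tr[OF assms(2)[OF that] v(1)]) simp
    then show ?thesis using nz by (simp add: power2_eq_square)
  qed
  then have "(pd 2 (tr_f a b c c0 f 3 1) v')\<^sup>2 - \<delta> * (pd 2 (tr_f a b c c0 f 2 1) v')\<^sup>2
      = (a / c)\<^sup>2 * ((pd 2 (f 3 1) v)\<^sup>2 - \<delta> * (pd 2 (f 2 1) v)\<^sup>2)"
    by (simp add: power_mult_distrib power_divide algebra_simps)
  then show "(pd 2 (tr_f a b c c0 f 3 1) v')\<^sup>2 - \<delta> * (pd 2 (tr_f a b c c0 f 2 1) v')\<^sup>2 \<noteq> 0"
    using assms(1) v(1) nz unfolding admissible_forms_def by simp
next
  fix i :: nat assume "i \<in> {2, 3}"
  then obtain \<alpha> \<beta> \<kappa> where *: "\<And>v. v \<in> V \<Longrightarrow> f i 1 v = \<alpha> * v 0 + \<beta> * v 2 + \<kappa>"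
    using assms(1) unfolding admissible_forms_def by blast
  show "\<exists>\<alpha> \<beta> \<kappa>. \<forall>v\<in>tr ` V. tr_f a b c c0 f i 1 v = \<alpha> * v 0 + \<beta> * v 2 + \<kappa>"
  proof (intro exI ballI)
    fix v' assume "v' \<in> tr ` V"
    then obtain v where v: "v \<in> V" "v' = tr v" by auto
    show "tr_f a b c c0 f i 1 v' = \<alpha> / (a * c) * v' 0 + (\<beta> * a / c) * v' 2 + (\<kappa> - \<alpha> * c0 / c) / a"
      unfolding v(2) tr_f_tr *[OF v(1)] using nz by (simp add: tr_jet_def field_simps power2_eq_square)
  qed
qed

lemma nondegenerate_tr: "nondegenerate (tr ` V) (tr_f a b c c0 f) \<longleftrightarrow> nondegenerate V f"
  unfolding nondegenerate_def using nz by (simp add: wedge_tr)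

lemma tr_inverse:
  "tr_jet (1 / a) (1 / c) (- c0 / c) ` (tr ` V) = V"
  "tr_A (1 / a) (1 / b) (1 / c) (- c0 / c) (tr_A a b c c0 A) = A"
  "tr_B (1 / a) (1 / b) (1 / c) (- c0 / c) (tr_B a b c c0 B) = B"
  "tr_f (1 / a) (1 / b) (1 / c) (- c0 / c) (tr_f a b c c0 f) = f"
proof -
  show "tr_jet (1 / a) (1 / c) (- c0 / c) ` (tr ` V) = V"
    unfolding image_image tr_inv_tr by simp
  have Z: "((Z - - c0 / c) / (1 / c) - c0) / c = Z" for Z
    using nz by (simp add: field_simps)
  have Z1: "a * (1 / a * Z / (1 / c)) / c = Z" "a\<^sup>2 * ((1 / a)\<^sup>2 * Z / (1 / c)) / c = Z" for Z
    using nz by (simp_all add: field_simps)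
  have AB: "1 / a / (1 / b) * (a / b * Y) = Y" "1 / c / ((1 / a)\<^sup>2 * (1 / b)) * (c / (a\<^sup>2 * b) * Y) = Y" for Y
    using nz by (simp_all add: field_simps)
  show "tr_A (1 / a) (1 / b) (1 / c) (- c0 / c) (tr_A a b c c0 A) = A"
    by (intro ext) (simp only: tr_A_def Z Z1 AB)
  show "tr_B (1 / a) (1 / b) (1 / c) (- c0 / c) (tr_B a b c c0 B) = B"
    by (intro ext) (simp only: tr_B_def Z Z1 AB)
  show "tr_f (1 / a) (1 / b) (1 / c) (- c0 / c) (tr_f a b c c0 f) = f"
  proof (intro ext)
    fix i j w
    have "tr_inv (tr_jet (1 / (1 / a)) (1 / (1 / c)) (- (- c0 / c) / (1 / c)) w) = w"
      using tr_inv_tr[of w] nz by simp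
    then show "tr_f (1 / a) (1 / b) (1 / c) (- c0 / c) (tr_f a b c c0 f) i j w = f i j w"
      using nz by (simp add: tr_f_def)
  qed
qed

end

text \<open>The inverse of a linear transformation is again one, so the transport results applied to
  the inverse bring the properties back to the original coordinates.\<close>

lemma tr_back:
  assumes "a * b * c \<noteq> 0" "open V"
    "pointwise_equivalent \<delta> (tr_jet a c c0 ` V) (tr_A a b c c0 A) (tr_B a b c c0 B) (tr_f a b c c0 f)"
    "admissible_forms 0 \<delta> (tr_jet a c c0 ` V) (tr_f a b c c0 f)"
  shows "pointwise_equivalent \<delta> V A B f" "admissible_forms 0 \<delta> V f"
proof -
  have nz: "a \<noteq> 0" "b \<noteq> 0" "c \<noteq> 0" using assms(1) by auto
  then have nz': "1 / a \<noteq> 0" "1 / b \<noteq> 0" "1 / c \<noteq> 0" by auto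
  note inv = tr_inverse[OF nz]
  show "pointwise_equivalent \<delta> V A B f"
    using pointwise_equivalent_tr[OF nz' open_tr_image[OF nz assms(2)] assms(3), of "- c0 / c"]
    unfolding inv .
  show "admissible_forms 0 \<delta> V f"
    using admissible_forms_tr[OF nz' assms(4), of "- c0 / c"] assms(3)
    unfolding inv pointwise_equivalent_def by blast
qed

section \<open>The two forms describe surfaces\<close>

lemma pd_affine:
  "pd i (\<lambda>u. \<alpha> * u 0 + \<beta> * u 2 + \<kappa>) v = (if i = 0 then \<alpha> else if i = 2 then \<beta> else 0)"
  by (rule pd_eqI) (auto intro!: derivative_eq_intros)

lemma Dt_affine: "Dt (\<lambda>u. \<alpha> * u 0 + \<beta> * u 2 + \<kappa>) v p = \<alpha> * p 0 + \<beta> * p 2"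
  by (subst Dt_eq_sum[of "{0, 2}"]) (auto simp: pd_affine)

lemma Dx_fun_z1:
  assumes "(g has_field_derivative g') (at (v 1))"
  shows "Dx (\<lambda>u. g (u 1)) v = v 2 * g'"
proof -
  have "pd i (\<lambda>u. g (u 1)) v = (if i = 1 then g' else 0)" for i
    by (rule pd_eqI) (use assms in auto)
  then show ?thesis by (subst Dx_eq_sum[of "{1}"]) (auto simp: numeral_2_eq_2)
qed

lemma Dx_linear3:
  assumes "open V" "v \<in> V" "smooth_on V F" "smooth_on V G" "smooth_on V H"
    "depends_upto k V F" "depends_upto k V G" "depends_upto k V H"
  shows "Dx (\<lambda>u. a * F u + b * G u + c * H u) v = a * Dx F v + b * Dx G v + c * Dx H v"
proof -
  have "depends_upto k V (\<lambda>u. a * F u + b * G u)"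
  proof (rule depends_uptoI)
    fix v w assume vw: "v \<in> V" "w \<in> V" "\<And>i. i \<le> k \<Longrightarrow> v i = w i"
    have "F v = F w" "G v = G w"
      by (rule depends_upto_eq[OF assms(6) vw] depends_upto_eq[OF assms(7) vw], assumption)+
    then show "a * F v + b * G v = a * F w + b * G w" by simp
  qed
  then have "Dx (\<lambda>u. 1 * (a * F u + b * G u) + c * H u) v = 1 * Dx (\<lambda>u. a * F u + b * G u) v + c * Dx H v"
    by (intro Dx_linear[OF assms(1,2) _ assms(5) _ assms(8)])
       (intro smooth_on_add smooth_on_cmult assms)
  then show ?thesis by (simp add: Dx_linear[OF assms(1-4,6,7)])
qed

section \<open>The function phi of form (I) and the 1-forms built from it\<close>

definition oscillation :: "real \<Rightarrow> real \<Rightarrow> real \<Rightarrow> real \<Rightarrow> real" where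
  "oscillation k a b s =
     (if k > 0 then a * cos (sqrt k * s) + b * sin (sqrt k * s)
      else a * cosh (sqrt (- k) * s) + b * sinh (sqrt (- k) * s))"

definition oscillation' :: "real \<Rightarrow> real \<Rightarrow> real \<Rightarrow> real \<Rightarrow> real" where
  "oscillation' k a b s =
     (if k > 0 then sqrt k * (b * cos (sqrt k * s) - a * sin (sqrt k * s))
      else sqrt (- k) * (b * cosh (sqrt (- k) * s) + a * sinh (sqrt (- k) * s)))"

text \<open>For k = 0 the second branch is the constant a and its derivative is 0, so the rule holds
  for every k.\<close>

lemma oscillation_deriv: "(oscillation k a b has_field_derivative oscillation' k a b s) (at s)"
proof (cases "k > 0")
  case True
  then show ?thesis
    unfolding oscillation_def[abs_def] oscillation'_def
    by (auto intro!: derivative_eq_intros simp: algebra_simps)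
next
  case False
  then show ?thesis
    unfolding oscillation_def[abs_def] oscillation'_def
    by (auto intro!: derivative_eq_intros simp: algebra_simps)
qed

lemma oscillation'_deriv: "(oscillation' k a b has_field_derivative - k * oscillation k a b s) (at s)"
proof (cases "k > 0")
  case True
  have "((\<lambda>s. q * (b * cos (q * s) - a * sin (q * s))) has_field_derivative
     - (q * q) * (a * cos (q * s) + b * sin (q * s))) (at s)" for q
    by (auto intro!: derivative_eq_intros simp: algebra_simps)
  from this[of "sqrt k"] show ?thesis using True
    unfolding oscillation_def oscillation'_def[abs_def] by simp
next
  case False
  have "((\<lambda>s. q * (b * cosh (q * s) + a * sinh (q * s))) has_field_derivative
     (q * q) * (a * cosh (q * s) + b * sinh (q * s))) (at s)" for q
    by (auto intro!: derivative_eq_intros simp: algebra_simps)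
  from this[of "sqrt (- k)"] show ?thesis using False
    unfolding oscillation_def oscillation'_def[abs_def] by simp
qed

lemma deriv_oscillation: "deriv (oscillation k a b) = oscillation' k a b"
  using oscillation_deriv DERIV_imp_deriv by blast

lemma smooth_oscillation:
  "smooth_on UNIV (lift1 (oscillation k a b))" "smooth_on UNIV (lift1 (oscillation' k a b))"
  using smooth_lift1_oscillator[OF oscillation_deriv oscillation'_deriv] by blast+

text \<open>The pair (a, b) is recovered from the function and its derivative divided by sqrt |k|
  through a circular or hyperbolic rotation, of determinant C^2 + S^2 = 1 or C^2 - S^2 = 1.\<close>

lemma oscillation_not_both_0:
  assumes "k \<noteq> 0" "a\<^sup>2 + b\<^sup>2 \<noteq> 0"
  shows "oscillation k a b s \<noteq> 0 \<or> oscillation' k a b s \<noteq> 0"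
proof (rule ccontr)
  assume "\<not> ?thesis"
  then have 0: "oscillation k a b s = 0" "oscillation' k a b s = 0" by auto
  have "a = 0 \<and> b = 0"
  proof (cases "k > 0")
    case True
    define C S where "C = cos (sqrt k * s)" and "S = sin (sqrt k * s)"
    have eq: "a * C + b * S = 0" "b * C - a * S = 0"
      using 0 True by (auto simp: oscillation_def oscillation'_def C_def S_def)
    have CS: "C * C + S * S = 1"
      using sin_cos_squared_add[of "sqrt k * s"] by (simp add: C_def S_def power2_eq_square)
    have "a * (C * C + S * S) = C * (a * C + b * S) - S * (b * C - a * S)"
      "b * (C * C + S * S) = S * (a * C + b * S) + C * (b * C - a * S)" by (simp_all add: algebra_simps)
    then show ?thesis unfolding eq CS by simp
  next
    case False
    define C S where "C = cosh (sqrt (- k) * s)" and "S = sinh (sqrt (- k) * s)"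
    have eq: "a * C + b * S = 0" "b * C + a * S = 0"
      using 0 False assms(1) by (auto simp: oscillation_def oscillation'_def C_def S_def)
    have CS: "C * C - S * S = 1"
      using hyperbolic_pythagoras[of "sqrt (- k) * s"] by (simp add: C_def S_def power2_eq_square)
    have "a * (C * C - S * S) = C * (a * C + b * S) - S * (b * C + a * S)"
      "b * (C * C - S * S) = C * (b * C + a * S) - S * (a * C + b * S)" by (simp_all add: algebra_simps)
    then show ?thesis unfolding eq CS by simp
  qed
  then show False using assms(2) by simp
qed

text \<open>Puts the explicit function in place of the variable phi, so that phi' is
  \<open>oscillation'\<close> and the differential equation of phi comes from
  \<open>oscillation'_deriv\<close>.\<close>

lemma form_I_iff:
  "form_I \<delta> V A B f \<longleftrightarrow>
     (\<exists>\<epsilon> r \<psi> a b. \<epsilon> \<in> {1, -1} \<and> r\<^sup>2 \<noteq> \<delta> \<and>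
        smooth_on V (lift3 \<psi>) \<and> \<not> lift3 \<psi> constant_on V \<and> a\<^sup>2 + b\<^sup>2 \<noteq> 0 \<and>
        (\<forall>v\<in>V.
           lift3 A v * v 3 + lift3 B v = Dx (lift3 \<psi>) v \<and>
           f 1 1 v = 0 \<and>
           f 1 2 v = - oscillation' (r\<^sup>2 - \<delta>) a b (v 1) \<and>
           f 2 1 v = v 2 \<and>
           f 2 2 v = lift3 \<psi> v + \<epsilon> * r * oscillation (r\<^sup>2 - \<delta>) a b (v 1) \<and>
           f 3 1 v = \<epsilon> * r * v 2 \<and>
           f 3 2 v = \<epsilon> * r * lift3 \<psi> v + \<delta> * oscillation (r\<^sup>2 - \<delta>) a b (v 1)))" (is "_ \<longleftrightarrow> ?R")
proof -
  have osc: "(\<lambda>s. if r\<^sup>2 - \<delta> > 0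
            then a * cos (sqrt (r\<^sup>2 - \<delta>) * s) + b * sin (sqrt (r\<^sup>2 - \<delta>) * s)
            else a * cosh (sqrt (- r\<^sup>2 + \<delta>) * s) + b * sinh (sqrt (- r\<^sup>2 + \<delta>) * s))
      = oscillation (r\<^sup>2 - \<delta>) a b" for r a b
    by (auto simp: oscillation_def)
  have dd: "deriv (oscillation' k a b) s = - k * oscillation k a b s" for k a b s
    by (rule DERIV_imp_deriv[OF oscillation'_deriv])
  show ?thesis
    unfolding form_I_def osc
  proof (intro iffI; elim exE conjE)
    fix \<epsilon> r \<psi> \<phi> a b
    assume "\<phi> = oscillation (r\<^sup>2 - \<delta>) a b" "\<epsilon> \<in> {1, -1}" "r\<^sup>2 \<noteq> \<delta>" "smooth_on V (lift3 \<psi>)"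
      "\<not> lift3 \<psi> constant_on V" "a\<^sup>2 + b\<^sup>2 \<noteq> 0"
      "\<forall>v\<in>V.
           lift3 A v * v 3 + lift3 B v = Dx (lift3 \<psi>) v \<and>
           f 1 1 v = 0 \<and>
           f 1 2 v = - deriv \<phi> (v 1) \<and>
           f 2 1 v = v 2 \<and>
           f 2 2 v = lift3 \<psi> v + \<epsilon> * r * \<phi> (v 1) \<and>
           f 3 1 v = \<epsilon> * r * v 2 \<and>
           f 3 2 v = \<epsilon> * r * lift3 \<psi> v + \<delta> * \<phi> (v 1)"
    then show ?R
      by - (rule exI[of _ \<epsilon>], rule exI[of _ r], rule exI[of _ \<psi>], rule exI[of _ a], rule exI[of _ b],
          simp add: deriv_oscillation)
  next
    fix \<epsilon> r \<psi> a b
    assume *: "\<epsilon> \<in> {1, -1}" "r\<^sup>2 \<noteq> \<delta>" "smooth_on V (lift3 \<psi>)"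
      "\<not> lift3 \<psi> constant_on V" "a\<^sup>2 + b\<^sup>2 \<noteq> 0"
      "\<forall>v\<in>V.
           lift3 A v * v 3 + lift3 B v = Dx (lift3 \<psi>) v \<and>
           f 1 1 v = 0 \<and>
           f 1 2 v = - oscillation' (r\<^sup>2 - \<delta>) a b (v 1) \<and>
           f 2 1 v = v 2 \<and>
           f 2 2 v = lift3 \<psi> v + \<epsilon> * r * oscillation (r\<^sup>2 - \<delta>) a b (v 1) \<and>
           f 3 1 v = \<epsilon> * r * v 2 \<and>
           f 3 2 v = \<epsilon> * r * lift3 \<psi> v + \<delta> * oscillation (r\<^sup>2 - \<delta>) a b (v 1)"
    have "\<exists>a' b'. a'\<^sup>2 + b'\<^sup>2 \<noteq> 0 \<and> oscillation (r\<^sup>2 - \<delta>) a b = oscillation (r\<^sup>2 - \<delta>) a' b'"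
      using *(5) by blast
    with * show "\<exists>\<epsilon> r \<psi> \<phi>. \<epsilon> \<in> {1, -1} \<and> r\<^sup>2 \<noteq> \<delta> \<and>
        smooth_on V (lift3 \<psi>) \<and> \<not> lift3 \<psi> constant_on V \<and>
        (\<forall>s. deriv (deriv \<phi>) s = - (r\<^sup>2 - \<delta>) * \<phi> s) \<and>
        (\<exists>a b. a\<^sup>2 + b\<^sup>2 \<noteq> 0 \<and> \<phi> = oscillation (r\<^sup>2 - \<delta>) a b) \<and>
        (\<forall>v\<in>V.
           lift3 A v * v 3 + lift3 B v = Dx (lift3 \<psi>) v \<and>
           f 1 1 v = 0 \<and>
           f 1 2 v = - deriv \<phi> (v 1) \<and>
           f 2 1 v = v 2 \<and>
           f 2 2 v = lift3 \<psi> v + \<epsilon> * r * \<phi> (v 1) \<and>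
           f 3 1 v = \<epsilon> * r * v 2 \<and>
           f 3 2 v = \<epsilon> * r * lift3 \<psi> v + \<delta> * \<phi> (v 1))"
      by - (rule exI[of _ \<epsilon>], rule exI[of _ r], rule exI[of _ \<psi>],
          rule exI[of _ "oscillation (r\<^sup>2 - \<delta>) a b"], simp only: deriv_oscillation dd simp_thms)
  qed
qed

lemma evolution_eq_lift3: "evolution_eq A B v p \<longleftrightarrow> p 2 = lift3 A v * v 3 + lift3 B v"
  by (simp add: evolution_eq_def lift3_def)

lemma depends_upto_lift3: "depends_upto 2 V (lift3 g)"
  by (rule depends_uptoI) (simp add: lift3_def)

text \<open>The coefficients f are known only on V and only for the relevant indices. Regularity and
  order are proved for explicit formulas g and carried over.\<close>

lemma pointwise_equivalentI:
  assumes V: "open V" and fg: "\<And>i j v. i \<in> {1,2,3} \<Longrightarrow> j \<in> {1,2} \<Longrightarrow> v \<in> V \<Longrightarrow> f i j v = g i j v"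
    and g: "\<And>i j. depends_upto k V (g i j)" "\<And>i j. smooth_on V (g i j)"
    and eqv: "\<And>v p. v \<in> V \<Longrightarrow> evolution_eq A B v p \<longleftrightarrow> structure_eqs \<delta> f v p"
  shows "pointwise_equivalent \<delta> V A B f"
proof -
  have fs: "depends_upto k V (f i j) \<and> smooth_on V (f i j)" if ij: "i \<in> {1,2,3}" "j \<in> {1,2}" for i j
  proof
    show "depends_upto k V (f i j)"
      by (rule depends_uptoI, simp only: fg[OF ij], rule depends_upto_eq[OF g(1)])
    show "smooth_on V (f i j)"
      by (rule smooth_on_cong[OF V g(2) fg[OF ij]])
  qed
  have "\<exists>k. \<forall>i\<in>{1,2,3}. \<forall>j\<in>{1,2}. depends_upto k V (f i j) \<and> smooth_on V (f i j)"
    by (intro exI[of _ k] ballI) (rule fs)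
  moreover have "\<forall>v\<in>V. \<forall>p. evolution_eq A B v p \<longleftrightarrow> structure_eqs \<delta> f v p"
    by (intro ballI allI) (rule eqv)
  ultimately show ?thesis unfolding pointwise_equivalent_def ..
qed

text \<open>As f_21 and f_31 are affine in z and z_2, the t-derivatives enter only through p_0 and
  p_2. Both directions of the theorem start from this shape.\<close>

lemma structure_eqs_affine:
  assumes "open V" "v \<in> V" "\<And>v. v \<in> V \<Longrightarrow> f 1 1 v = 0"
    "\<And>v. v \<in> V \<Longrightarrow> f 2 1 v = \<alpha> * v 0 + \<beta> * v 2 + \<kappa>"
    "\<And>v. v \<in> V \<Longrightarrow> f 3 1 v = \<alpha>' * v 0 + \<beta>' * v 2 + \<kappa>'"
  shows "structure_eqs \<delta> f v p \<longleftrightarrow>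
      Dx (f 1 2) v = f 3 1 v * f 2 2 v - f 3 2 v * f 2 1 v \<and>
      Dx (f 2 2) v - (\<alpha> * p 0 + \<beta> * p 2) = - (f 1 2 v * f 3 1 v) \<and>
      Dx (f 3 2) v - (\<alpha>' * p 0 + \<beta>' * p 2) = - (\<delta> * (f 1 2 v * f 2 1 v))"
proof -
  have "Dt (f 1 1) v p = Dt (\<lambda>u. 0 * u 0 + 0 * u 2 + 0) v p"
    by (rule Dt_cong_open[OF assms(1,2)]) (use assms(3) in simp)
  moreover have "Dt (f 2 1) v p = Dt (\<lambda>u. \<alpha> * u 0 + \<beta> * u 2 + \<kappa>) v p"
    by (rule Dt_cong_open[OF assms(1,2) assms(4)])
  moreover have "Dt (f 3 1) v p = Dt (\<lambda>u. \<alpha>' * u 0 + \<beta>' * u 2 + \<kappa>') v p"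
    by (rule Dt_cong_open[OF assms(1,2) assms(5)])
  ultimately show ?thesis
    unfolding structure_eqs_def dform_def wedge_def Dt_affine assms(3)[OF assms(2)] by simp
qed

lemma admissible_formsI:
  assumes "open V" "\<And>v. v \<in> V \<Longrightarrow> f 1 1 v = 0"
    "\<And>v. v \<in> V \<Longrightarrow> f 2 1 v = \<alpha> * v 0 + \<beta> * v 2 + \<kappa>"
    "\<And>v. v \<in> V \<Longrightarrow> f 3 1 v = \<alpha>' * v 0 + \<beta>' * v 2 + \<kappa>'"
    "\<beta>'\<^sup>2 - \<delta> * \<beta>\<^sup>2 \<noteq> 0"
  shows "admissible_forms 0 \<delta> V f"
  unfolding admissible_forms_def
proof (intro conjI ballI)
  fix p :: nat assume "p \<in> {2, 3}"
  then consider "p = 2" | "p = 3" by blast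
  then show "\<exists>\<alpha> \<beta> \<kappa>. \<forall>v\<in>V. f p 1 v = \<alpha> * v 0 + \<beta> * v 2 + \<kappa>"
    using assms(3,4) by cases blast+
next
  fix v assume v: "v \<in> V"
  have "pd 2 (f 2 1) v = \<beta>" "pd 2 (f 3 1) v = \<beta>'"
    using pd_cong_open[OF assms(1) v assms(3)] pd_cong_open[OF assms(1) v assms(4)] by (simp_all add: pd_affine)
  then show "(pd 2 (f 3 1) v)\<^sup>2 - \<delta> * (pd 2 (f 2 1) v)\<^sup>2 \<noteq> 0" using assms(5) by simp
qed (rule assms(2))

text \<open>The first structure equation is an identity, expressing the oscillator equation of phi.
  The second and third reduce to the evolution equation and to \<epsilon> r times it, since the
  terms with phi' cancel.\<close>

lemma form_I_pointwise_equivalent: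
  assumes \<delta>: "\<delta> \<in> {1, -1}" and V: "open V" and "form_I \<delta> V A B f"
  shows "pointwise_equivalent \<delta> V A B f" "admissible_forms 0 \<delta> V f"
proof -
  from assms(3) obtain \<epsilon> r \<psi> a b where \<epsilon>: "\<epsilon> \<in> {1, -1}" and r: "r\<^sup>2 \<noteq> \<delta>"
    and \<psi>: "smooth_on V (lift3 \<psi>)" and
    f: "\<forall>v\<in>V.
           lift3 A v * v 3 + lift3 B v = Dx (lift3 \<psi>) v \<and>
           f 1 1 v = 0 \<and>
           f 1 2 v = - oscillation' (r\<^sup>2 - \<delta>) a b (v 1) \<and>
           f 2 1 v = v 2 \<and>
           f 2 2 v = lift3 \<psi> v + \<epsilon> * r * oscillation (r\<^sup>2 - \<delta>) a b (v 1) \<and>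
           f 3 1 v = \<epsilon> * r * v 2 \<and>
           f 3 2 v = \<epsilon> * r * lift3 \<psi> v + \<delta> * oscillation (r\<^sup>2 - \<delta>) a b (v 1)"
    unfolding form_I_iff by blast
  define u w where "u = oscillation (r\<^sup>2 - \<delta>) a b" and "w = oscillation' (r\<^sup>2 - \<delta>) a b"
  have f11: "f 1 1 v = 0" and f12: "f 1 2 v = - w (v 1)" and f21: "f 2 1 v = 0 * v 0 + 1 * v 2 + 0"
    and f22: "f 2 2 v = 1 * lift3 \<psi> v + \<epsilon> * r * u (v 1)" and f31: "f 3 1 v = 0 * v 0 + \<epsilon> * r * v 2 + 0"
    and f32: "f 3 2 v = \<epsilon> * r * lift3 \<psi> v + \<delta> * u (v 1)"
    and E: "lift3 A v * v 3 + lift3 B v = Dx (lift3 \<psi>) v" if "v \<in> V" for v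
    using f that by (simp_all add: u_def w_def)
  have u: "smooth_on V (\<lambda>v. u (v 1))" and w: "smooth_on V (\<lambda>v. w (v 1))"
    using smooth_on_compose1[OF V open_UNIV, of _ "\<lambda>v. v 1"] smooth_oscillation smooth_on_coord
    unfolding u_def w_def by simp_all
  have du: "depends_upto 2 V (\<lambda>v. u (v 1))" and dw: "depends_upto 2 V (\<lambda>v. w (v 1))"
    by (rule depends_uptoI, simp)+
  define g where "g = (\<lambda>i j. if i = (1::nat) then (if j = (1::nat) then (\<lambda>v. 0) else (\<lambda>v. - w (v 1)))
     else if i = 2 then (if j = 1 then (\<lambda>v. v 2) else (\<lambda>v. lift3 \<psi> v + \<epsilon> * r * u (v 1)))
     else (if j = 1 then (\<lambda>v. \<epsilon> * r * v 2) else (\<lambda>v. \<epsilon> * r * lift3 \<psi> v + \<delta> * u (v 1))))"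
  have "smooth_on V (\<lambda>v. - w (v 1))" "smooth_on V (\<lambda>v. lift3 \<psi> v + \<epsilon> * r * u (v 1))"
    "smooth_on V (\<lambda>v. \<epsilon> * r * v 2)" "smooth_on V (\<lambda>v. \<epsilon> * r * lift3 \<psi> v + \<delta> * u (v 1))"
    by (intro smooth_on_minus smooth_on_add smooth_on_cmult u w V \<psi> smooth_on_coord)+
  then have sg: "smooth_on V (g i j)" for i j
    by (simp add: g_def smooth_on_const smooth_on_coord)
  have dg: "depends_upto 2 V (g i j)" for i j
    by (rule depends_uptoI) (simp add: g_def lift3_def)
  have fg: "f i j v = g i j v" if "i \<in> {1,2,3}" "j \<in> {1,2}" "v \<in> V" for i j v
    using that f11[OF that(3)] f12[OF that(3)] f21[OF that(3)] f22[OF that(3)] f31[OF that(3)] f32[OF that(3)]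
    by (elim insertE emptyE; simp add: g_def)
  have eqv: "evolution_eq A B v p \<longleftrightarrow> structure_eqs \<delta> f v p" if v: "v \<in> V" for v p
  proof -
    have "Dx (f 1 2) v = Dx (\<lambda>v. - w (v 1)) v" by (rule Dx_cong_open[OF V v f12])
    also have "\<dots> = v 2 * ((r\<^sup>2 - \<delta>) * u (v 1))"
    proof (rule Dx_fun_z1)
      show "((\<lambda>s. - w s) has_field_derivative (r\<^sup>2 - \<delta>) * u (v 1)) (at (v 1))"
        using DERIV_minus[OF oscillation'_deriv[of "r\<^sup>2 - \<delta>" a b "v 1"]] unfolding u_def w_def
        by (simp only: minus_mult_minus minus_mult_left minus_minus)
    qed
    finally have D1: "Dx (f 1 2) v = v 2 * ((r\<^sup>2 - \<delta>) * u (v 1))" .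
    have Du: "Dx (\<lambda>v. u (v 1)) v = v 2 * w (v 1)"
      by (rule Dx_fun_z1) (simp add: u_def w_def oscillation_deriv)
    have "Dx (f 2 2) v = Dx (\<lambda>v. 1 * lift3 \<psi> v + \<epsilon> * r * u (v 1)) v" by (rule Dx_cong_open[OF V v f22])
    then have D2: "Dx (f 2 2) v = Dx (lift3 \<psi>) v + \<epsilon> * r * (v 2 * w (v 1))"
      using Dx_linear[OF V v \<psi> u depends_upto_lift3 du, of 1 "\<epsilon> * r"] unfolding Du by simp
    have "Dx (f 3 2) v = Dx (\<lambda>v. \<epsilon> * r * lift3 \<psi> v + \<delta> * u (v 1)) v" by (rule Dx_cong_open[OF V v f32])
    then have D3: "Dx (f 3 2) v = \<epsilon> * r * Dx (lift3 \<psi>) v + \<delta> * (v 2 * w (v 1))"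
      by (simp only: Dx_linear[OF V v \<psi> u depends_upto_lift3 du] Du)
    have \<epsilon>2: "\<epsilon> * \<epsilon> = 1" using \<epsilon> by auto
    \<comment> \<open>The flux drops out of f_31 f_22 - f_32 f_21; what remains is z_2 times
      -phi''.\<close>
    have e1: "v 2 * ((r\<^sup>2 - \<delta>) * u (v 1)) = \<epsilon> * r * v 2 * (lift3 \<psi> v + \<epsilon> * r * u (v 1)) -
        (\<epsilon> * r * lift3 \<psi> v + \<delta> * u (v 1)) * v 2"
    proof -
      have "\<epsilon> * r * v 2 * (lift3 \<psi> v + \<epsilon> * r * u (v 1)) - (\<epsilon> * r * lift3 \<psi> v + \<delta> * u (v 1)) * v 2
        = v 2 * (((\<epsilon> * \<epsilon>) * r * r - \<delta>) * u (v 1))" by (simp add: algebra_simps)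
      then show ?thesis unfolding \<epsilon>2 by (simp add: power2_eq_square)
    qed
    have SE: "structure_eqs \<delta> f v p \<longleftrightarrow>
      Dx (f 1 2) v = f 3 1 v * f 2 2 v - f 3 2 v * f 2 1 v \<and>
      Dx (f 2 2) v - (0 * p 0 + 1 * p 2) = - (f 1 2 v * f 3 1 v) \<and>
      Dx (f 3 2) v - (0 * p 0 + \<epsilon> * r * p 2) = - (\<delta> * (f 1 2 v * f 2 1 v))"
      by (rule structure_eqs_affine[OF V v]) (rule f11 f21 f31, assumption)+
    show ?thesis
      unfolding SE D1 D2 D3 evolution_eq_lift3 E[OF v] f12[OF v] f21[OF v] f22[OF v] f31[OF v] f32[OF v]
      using e1 by (auto simp: algebra_simps)
  qed
  show "pointwise_equivalent \<delta> V A B f"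
    by (rule pointwise_equivalentI[OF V fg dg sg eqv])
  have "(\<epsilon> * r)\<^sup>2 - \<delta> * 1\<^sup>2 \<noteq> 0" using r \<epsilon> by auto
  then show "admissible_forms 0 \<delta> V f"
    by (intro admissible_formsI[of V f 0 1 0 0 "\<epsilon> * r" 0, OF V]) (rule f11 f21 f31, assumption)+
qed

text \<open>The wedge is z_2 phi'(z_1). If phi' vanished at all points of V, it would vanish on an
  interval of z_1, then so would phi'' and hence phi, which is impossible for (a, b) nonzero.
  Afterwards z_2 is moved away from 0.\<close>

lemma form_I_somewhere_nondegenerate:
  assumes V: "open V" "V \<noteq> {}" and "form_I \<delta> V A B f"
  obtains v where "v \<in> V" "wedge f 1 2 v \<noteq> 0"
proof -
  from assms(3) obtain r a b where r: "r\<^sup>2 \<noteq> \<delta>" and ab: "a\<^sup>2 + b\<^sup>2 \<noteq> 0" and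
    f: "\<And>v. v \<in> V \<Longrightarrow> f 1 1 v = 0 \<and> f 1 2 v = - oscillation' (r\<^sup>2 - \<delta>) a b (v 1) \<and> f 2 1 v = v 2"
    unfolding form_I_iff by blast
  let ?u = "oscillation (r\<^sup>2 - \<delta>) a b" and ?w = "oscillation' (r\<^sup>2 - \<delta>) a b"
  have "\<exists>v\<in>V. ?w (v 1) \<noteq> 0"
  proof (rule ccontr)
    assume "\<not> ?thesis"
    then have w0: "\<And>v. v \<in> V \<Longrightarrow> ?w (v 1) = 0" by blast
    obtain v where v: "v \<in> V" using V(2) by blast
    have "\<forall>\<^sub>F s in nhds (v 1). ?w s = 0"
      using open_jet_update[OF V(1) v, of 1] by (rule eventually_mono) (use w0 in fastforce)
    then have "deriv ?w (v 1) = deriv (\<lambda>_. 0) (v 1)" by (rule deriv_cong_ev[OF _ refl])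
    then have "?u (v 1) = 0" using DERIV_imp_deriv[OF oscillation'_deriv, of "r\<^sup>2 - \<delta>" a b "v 1"] r by simp
    then show False using oscillation_not_both_0[OF _ ab, of "r\<^sup>2 - \<delta>" "v 1"] w0[OF v] r by simp
  qed
  then obtain v where v: "v \<in> V" "?w (v 1) \<noteq> 0" by blast
  obtain s where s: "s \<notin> {0}" "v(2 := s) \<in> V" using open_jet_avoid[OF V(1) v(1), of "{0}" 2] by auto
  have "wedge f 1 2 (v(2 := s)) = ?w (v 1) * s"
    unfolding wedge_def using f[OF s(2)] by simp
  then show ?thesis using that[OF s(2)] v(2) s(1) by simp
qed

section \<open>The 1-forms of form (II)\<close>

definition phi_arg :: "real \<Rightarrow> (real \<Rightarrow> real) \<Rightarrow> jet \<Rightarrow> real" where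
  "phi_arg m \<phi> v = \<phi> (2 * m * v 0 + (v 1)\<^sup>2)"

text \<open>For differentiable phi this is the z_1-derivative of \<open>phi_arg m \<phi>\<close>,
  and m times it is z_1 times the z-derivative. Therefore Dx of \<open>phi_arg\<close> factors as
  \<open>phi_flux\<close> times z_2 + m.\<close>

definition phi_flux :: "real \<Rightarrow> (real \<Rightarrow> real) \<Rightarrow> jet \<Rightarrow> real" where
  "phi_flux m \<phi> v = 2 * v 1 * phi_arg m (deriv \<phi>) v"

definition phi_transport :: "real \<Rightarrow> (real \<Rightarrow> real) \<Rightarrow> jet \<Rightarrow> real" where
  "phi_transport m \<phi> v = (v 2 + m) * phi_arg m \<phi> v"

lemma depends_upto_phi:
  "depends_upto 1 V (phi_arg m \<phi>)" "depends_upto 1 V (phi_flux m \<phi>)" "depends_upto 2 V (phi_transport m \<phi>)"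
  by (rule depends_uptoI, simp add: phi_arg_def phi_flux_def phi_transport_def)+

lemma depends_upto_Dx_phi_flux: "depends_upto 2 V (Dx (phi_flux m \<phi>))"
  using depends_upto_subset[OF depends_upto_Dx[OF open_UNIV depends_upto_phi(2)] subset_UNIV]
  by (simp add: numeral_2_eq_2)

context
  fixes V :: "jet set" and I m \<phi>
  assumes V: "open V" and I: "open I" and arg: "\<And>v. v \<in> V \<Longrightarrow> 2 * m * v 0 + (v 1)\<^sup>2 \<in> I"
    and \<phi>: "smooth_on {w. w 0 \<in> I} (lift1 \<phi>)"
begin

lemma smooth_phi_arg:
  assumes "smooth_on {w. w 0 \<in> I} (lift1 g)"
  shows "smooth_on V (phi_arg m g)"
  unfolding phi_arg_def[abs_def]
proof (rule smooth_on_compose1[OF V I assms, where F = "\<lambda>v. 2 * m * v 0 + (v 1)\<^sup>2"])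
  show "smooth_on V (\<lambda>v. 2 * m * v 0 + (v 1)\<^sup>2)"
    by (intro smooth_on_add smooth_on_cmult smooth_on_power smooth_on_coord V)
qed (use arg in auto)

lemma smooth_phi:
  "smooth_on V (phi_arg m \<phi>)" "smooth_on V (phi_flux m \<phi>)" "smooth_on V (phi_transport m \<phi>)"
proof -
  show 1: "smooth_on V (phi_arg m \<phi>)" by (rule smooth_phi_arg[OF \<phi>])
  have 2: "smooth_on V (phi_arg m (deriv \<phi>))" by (rule smooth_phi_arg[OF smooth_lift1_deriv[OF \<phi>]])
  show "smooth_on V (phi_flux m \<phi>)" unfolding phi_flux_def[abs_def]
    by (intro smooth_on_mult smooth_on_const smooth_on_coord V 2)
  show "smooth_on V (phi_transport m \<phi>)" unfolding phi_transport_def[abs_def]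
    by (intro smooth_on_mult smooth_on_add smooth_on_const smooth_on_coord V 1)
qed

lemma smooth_Dx_phi_flux: "smooth_on V (Dx (phi_flux m \<phi>))"
  by (rule smooth_on_Dx[OF V smooth_phi(2) depends_upto_phi(2)])

lemma pd_phi_arg:
  assumes "v \<in> V"
  shows "pd i (phi_arg m \<phi>) v =
    phi_arg m (deriv \<phi>) v * (if i = 0 then 2 * m else if i = 1 then 2 * v 1 else 0)"
proof (rule pd_eqI)
  have d: "(\<phi> has_field_derivative deriv \<phi> (2 * m * v 0 + (v 1)\<^sup>2)) (at (2 * m * v 0 + (v 1)\<^sup>2))"
    by (rule smooth_lift1_has_deriv[OF \<phi> arg[OF assms]])
  have "((\<lambda>s. 2 * m * (v(i := s)) 0 + ((v(i := s)) 1)\<^sup>2) has_field_derivative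
     (if i = 0 then 2 * m else if i = 1 then 2 * v 1 else 0)) (at (v i))"
    by (auto intro!: derivative_eq_intros)
  from DERIV_chain2[OF _ this, of \<phi>] d
  show "((\<lambda>s. phi_arg m \<phi> (v(i := s))) has_field_derivative
    phi_arg m (deriv \<phi>) v * (if i = 0 then 2 * m else if i = 1 then 2 * v 1 else 0)) (at (v i))"
    unfolding phi_arg_def fun_upd_triv by blast
qed

lemma Dx_phi_arg:
  assumes "v \<in> V"
  shows "Dx (phi_arg m \<phi>) v = phi_flux m \<phi> v * (v 2 + m)"
proof -
  have "Dx (phi_arg m \<phi>) v = (\<Sum>i\<in>{0, 1}. v (Suc i) * pd i (phi_arg m \<phi>) v)"
    by (rule Dx_eq_sum) (auto simp: pd_phi_arg[OF assms])
  then show ?thesis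
    by (simp add: pd_phi_arg[OF assms] phi_flux_def algebra_simps numeral_2_eq_2)
qed

lemma Dx_Dx_cmult_phi_flux:
  assumes "v \<in> V"
  shows "Dx (Dx (\<lambda>u. \<gamma> * phi_flux m \<phi> u)) v = \<gamma> * Dx (Dx (phi_flux m \<phi>)) v"
proof -
  have "Dx (Dx (\<lambda>u. \<gamma> * phi_flux m \<phi> u)) v = Dx (\<lambda>u. \<gamma> * Dx (phi_flux m \<phi>) u) v"
    by (rule Dx_cong_open[OF V assms]) (rule Dx_cmult[OF V _ smooth_phi(2) depends_upto_phi(2)])
  also have "\<dots> = \<gamma> * Dx (Dx (phi_flux m \<phi>)) v"
    by (rule Dx_cmult[OF V assms smooth_Dx_phi_flux depends_upto_Dx_phi_flux])
  finally show ?thesis .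
qed

end

lemma form_II_iff:
  "form_II \<delta> V A B f \<longleftrightarrow>
     (\<exists>\<epsilon> m r \<gamma> \<mu> \<phi> I q. q = sqrt (\<gamma> + \<delta> * \<mu>\<^sup>2) \<and> \<epsilon> \<in> {1, -1} \<and> \<gamma> \<noteq> 0 \<and> \<gamma> + \<delta> * \<mu>\<^sup>2 \<ge> 0 \<and>
           open I \<and> (\<forall>v\<in>V. 2 * m * v 0 + (v 1)\<^sup>2 \<in> I) \<and> smooth_on {w. w 0 \<in> I} (lift1 \<phi>) \<and>
           (\<forall>v\<in>V.
         phi_arg m (deriv \<phi>) v \<noteq> 0 \<and>
         lift3 A v * v 3 + lift3 B v =
           - Dx (Dx (\<lambda>u. \<gamma> * phi_flux m \<phi> u)) v - Dx (phi_transport m \<phi>) v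
           + \<delta> * r\<^sup>2 * phi_flux m \<phi> v \<and>
         f 1 1 v = 0 \<and>
         f 1 2 v = - r * phi_flux m \<phi> v \<and>
         f 2 1 v = \<mu> / \<gamma> * (v 2 + m) - \<epsilon> * r * q / \<gamma> \<and>
         f 2 2 v = - \<mu> * Dx (phi_flux m \<phi>) v
               + (- \<mu> / \<gamma> * (v 2 + m) + \<epsilon> * r * q / \<gamma>) * phi_arg m \<phi> v \<and>
         f 3 1 v = \<epsilon> * q / \<gamma> * (v 2 + m) - \<delta> * r * \<mu> / \<gamma> \<and>
         f 3 2 v = - \<epsilon> * q * Dx (phi_flux m \<phi>) v
               + (- \<epsilon> * q / \<gamma> * (v 2 + m) + \<delta> * r * \<mu> / \<gamma>) * phi_arg m \<phi> v))"
  unfolding form_II_def Let_def image_subset_iff phi_flux_def[abs_def] phi_transport_def[abs_def] phi_arg_def[abs_def]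
  by (simp add: mult_ac)

text \<open>The second and third structure equations are \<alpha> and \<alpha>' times the evolution
  equation, where \<alpha> and \<alpha>' are the coefficients of z_2 in f_21 and f_31; the first is
  an identity. The relation q^2 - \<delta> \<mu>^2 = \<gamma> is what makes the constants
  fit.\<close>

lemma form_II_pointwise_equivalent:
  assumes V: "open V" and "form_II \<delta> V A B f"
  shows "pointwise_equivalent \<delta> V A B f" "admissible_forms 0 \<delta> V f"
proof -
  from assms(2) obtain \<epsilon> m r \<gamma> \<mu> \<phi> I q where q: "q = sqrt (\<gamma> + \<delta> * \<mu>\<^sup>2)" and \<epsilon>: "\<epsilon> \<in> {1, -1}"
    and \<gamma>: "\<gamma> \<noteq> 0" "\<gamma> + \<delta> * \<mu>\<^sup>2 \<ge> 0" and I: "open I"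
    and arg': "\<forall>v\<in>V. 2 * m * v 0 + (v 1)\<^sup>2 \<in> I"
    and \<phi>: "smooth_on {w. w 0 \<in> I} (lift1 \<phi>)"
    and f: "\<forall>v\<in>V.
         phi_arg m (deriv \<phi>) v \<noteq> 0 \<and>
         lift3 A v * v 3 + lift3 B v =
           - Dx (Dx (\<lambda>u. \<gamma> * phi_flux m \<phi> u)) v - Dx (phi_transport m \<phi>) v
           + \<delta> * r\<^sup>2 * phi_flux m \<phi> v \<and>
         f 1 1 v = 0 \<and>
         f 1 2 v = - r * phi_flux m \<phi> v \<and>
         f 2 1 v = \<mu> / \<gamma> * (v 2 + m) - \<epsilon> * r * q / \<gamma> \<and>
         f 2 2 v = - \<mu> * Dx (phi_flux m \<phi>) v
               + (- \<mu> / \<gamma> * (v 2 + m) + \<epsilon> * r * q / \<gamma>) * phi_arg m \<phi> v \<and>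
         f 3 1 v = \<epsilon> * q / \<gamma> * (v 2 + m) - \<delta> * r * \<mu> / \<gamma> \<and>
         f 3 2 v = - \<epsilon> * q * Dx (phi_flux m \<phi>) v
               + (- \<epsilon> * q / \<gamma> * (v 2 + m) + \<delta> * r * \<mu> / \<gamma>) * phi_arg m \<phi> v"
    unfolding form_II_iff by blast
  have arg: "2 * m * v 0 + (v 1)\<^sup>2 \<in> I" if "v \<in> V" for v using arg' that by blast
  let ?F = "phi_arg m \<phi>" and ?P = "phi_flux m \<phi>" and ?X = "phi_transport m \<phi>"
  note sm = smooth_phi[OF V I arg \<phi>] and smQ = smooth_Dx_phi_flux[OF V I arg \<phi>]
  have sF: "smooth_on V ?F" and sP: "smooth_on V ?P" and sX: "smooth_on V ?X" and sQ: "smooth_on V (Dx ?P)"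
    by (rule sm smQ, assumption)+
  have dF: "depends_upto 2 V ?F" by (rule depends_upto_mono[OF depends_upto_phi(1)]) simp
  define \<alpha> \<kappa> \<alpha>' \<kappa>' where "\<alpha> = \<mu> / \<gamma>" and "\<kappa> = \<alpha> * m - \<epsilon> * r * q / \<gamma>"
    and "\<alpha>' = \<epsilon> * q / \<gamma>" and "\<kappa>' = \<alpha>' * m - \<delta> * r * \<mu> / \<gamma>"
  define \<sigma> \<sigma>' where "\<sigma> = \<epsilon> * r * q / \<gamma>" and "\<sigma>' = \<delta> * r * \<mu> / \<gamma>"
  have f11: "f 1 1 v = 0" and f12: "f 1 2 v = (- r) * ?P v" and f21: "f 2 1 v = 0 * v 0 + \<alpha> * v 2 + \<kappa>"
    and f22: "f 2 2 v = (- \<mu>) * Dx ?P v + (- \<alpha>) * ?X v + \<sigma> * ?F v"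
    and f31: "f 3 1 v = 0 * v 0 + \<alpha>' * v 2 + \<kappa>'"
    and f32: "f 3 2 v = (- \<epsilon> * q) * Dx ?P v + (- \<alpha>') * ?X v + \<sigma>' * ?F v"
    if v: "v \<in> V" for v
    using bspec[OF f v] by (simp_all add: \<alpha>_def \<kappa>_def \<alpha>'_def \<kappa>'_def \<sigma>_def \<sigma>'_def phi_transport_def algebra_simps)
  have E: "lift3 A v * v 3 + lift3 B v = - \<gamma> * Dx (Dx ?P) v - Dx ?X v + \<delta> * r\<^sup>2 * ?P v" if v: "v \<in> V" for v
  proof -
    have DD: "Dx (Dx (\<lambda>u. \<gamma> * ?P u)) v = \<gamma> * Dx (Dx ?P) v"
      by (rule Dx_Dx_cmult_phi_flux[OF V I arg \<phi> v])
    then show ?thesis using bspec[OF f v] by simp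
  qed
  define g where "g = (\<lambda>i j. if i = (1::nat) then (if j = (1::nat) then (\<lambda>v. 0) else (\<lambda>v. (- r) * ?P v))
     else if i = 2 then (if j = 1 then (\<lambda>v. 0 * v 0 + \<alpha> * v 2 + \<kappa>) else (\<lambda>v. (- \<mu>) * Dx ?P v + (- \<alpha>) * ?X v + \<sigma> * ?F v))
     else (if j = 1 then (\<lambda>v. 0 * v 0 + \<alpha>' * v 2 + \<kappa>') else (\<lambda>v. (- \<epsilon> * q) * Dx ?P v + (- \<alpha>') * ?X v + \<sigma>' * ?F v)))"
  have sg: "smooth_on V (g i j)" for i j
  proof -
    have "smooth_on V (\<lambda>v. 0)" "smooth_on V (\<lambda>v. (- r) * ?P v)"
      "smooth_on V (\<lambda>v. 0 * v 0 + \<alpha> * v 2 + \<kappa>)" "smooth_on V (\<lambda>v. 0 * v 0 + \<alpha>' * v 2 + \<kappa>')"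
      "smooth_on V (\<lambda>v. (- \<mu>) * Dx ?P v + (- \<alpha>) * ?X v + \<sigma> * ?F v)"
      "smooth_on V (\<lambda>v. (- \<epsilon> * q) * Dx ?P v + (- \<alpha>') * ?X v + \<sigma>' * ?F v)"
      by (intro smooth_on_add smooth_on_cmult smooth_on_coord smooth_on_const sF sP sX sQ V)+
    then show ?thesis unfolding g_def by presburger
  qed
  have dg: "depends_upto 2 V (g i j)" for i j
  proof (rule depends_uptoI)
    fix v w assume vw: "v \<in> V" "w \<in> V" "\<And>i. i \<le> 2 \<Longrightarrow> v i = w i"
    have P: "?P v = ?P w" by (rule depends_upto_eq[OF depends_upto_phi(2) vw(1,2)]) (use vw(3) in simp)
    have F: "?F v = ?F w" by (rule depends_upto_eq[OF dF vw(1,2)]) (use vw(3) in simp)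
    have X: "?X v = ?X w" by (rule depends_upto_eq[OF depends_upto_phi(3) vw(1,2)]) (use vw(3) in simp)
    have Q: "Dx ?P v = Dx ?P w" by (rule depends_upto_eq[OF depends_upto_Dx_phi_flux vw(1,2)]) (use vw(3) in simp)
    show "g i j v = g i j w" by (simp add: g_def P F X Q vw(3))
  qed
  have fg: "f i j v = g i j v" if "i \<in> {1,2,3}" "j \<in> {1,2}" "v \<in> V" for i j v
    using that f11[OF that(3)] f12[OF that(3)] f21[OF that(3)] f22[OF that(3)] f31[OF that(3)] f32[OF that(3)]
    by (elim insertE emptyE; simp add: g_def)
  have q2: "q * q = \<gamma> + \<delta> * \<mu>\<^sup>2" using \<gamma>(2) by (simp add: q)
  have \<epsilon>2: "\<epsilon> * \<epsilon> = 1" using \<epsilon> by auto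
  \<comment> \<open>The value is 1 / \<gamma>. Besides admissibility it gives that \<alpha> and
    \<alpha>' are not both 0, so their multiples of the evolution equation determine p_2.\<close>
  have det: "\<alpha>'\<^sup>2 - \<delta> * \<alpha>\<^sup>2 \<noteq> 0"
  proof -
    have "\<alpha>'\<^sup>2 - \<delta> * \<alpha>\<^sup>2 = ((\<epsilon> * \<epsilon>) * (q * q) - \<delta> * \<mu>\<^sup>2) / \<gamma>\<^sup>2"
      by (simp add: \<alpha>_def \<alpha>'_def power_divide power_mult_distrib diff_divide_distrib power2_eq_square)
    also have "\<dots> = 1 / \<gamma>" unfolding \<epsilon>2 q2 using \<gamma>(1) by (simp add: power2_eq_square)
    finally show ?thesis using \<gamma>(1) by simp
  qed
  have eqv: "evolution_eq A B v p \<longleftrightarrow> structure_eqs \<delta> f v p" if v: "v \<in> V" for v p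
  proof -
    define e where "e = lift3 A v * v 3 + lift3 B v"
    have ev: "e = - \<gamma> * Dx (Dx ?P) v - Dx ?X v + \<delta> * r\<^sup>2 * ?P v" unfolding e_def by (rule E[OF v])
    have DF: "Dx ?F v = ?P v * (v 2 + m)" by (rule Dx_phi_arg[OF V I arg \<phi> v])
    have "Dx (f 1 2) v = Dx (\<lambda>v. (- r) * ?P v) v" by (rule Dx_cong_open[OF V v f12])
    also have "\<dots> = (- r) * Dx ?P v" by (rule Dx_cmult[OF V v sP depends_upto_phi(2)])
    finally have D1: "Dx (f 1 2) v = (- r) * Dx ?P v" .
    have "Dx (f 2 2) v = Dx (\<lambda>v. (- \<mu>) * Dx ?P v + (- \<alpha>) * ?X v + \<sigma> * ?F v) v"
      by (rule Dx_cong_open[OF V v f22])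
    also have "\<dots> = (- \<mu>) * Dx (Dx ?P) v + (- \<alpha>) * Dx ?X v + \<sigma> * Dx ?F v"
      by (rule Dx_linear3[OF V v sQ sX sF depends_upto_Dx_phi_flux depends_upto_phi(3) dF])
    also have "\<dots> = \<alpha> * e - (\<delta> * r\<^sup>2 * \<alpha>) * ?P v + \<sigma> * (?P v * (v 2 + m))"
      using \<gamma>(1) unfolding DF ev \<alpha>_def by (simp add: field_simps)
    finally have D2: "Dx (f 2 2) v = \<alpha> * e - (\<delta> * r\<^sup>2 * \<alpha>) * ?P v + \<sigma> * (?P v * (v 2 + m))" .
    have "Dx (f 3 2) v = Dx (\<lambda>v. (- \<epsilon> * q) * Dx ?P v + (- \<alpha>') * ?X v + \<sigma>' * ?F v) v"
      by (rule Dx_cong_open[OF V v f32])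
    also have "\<dots> = (- \<epsilon> * q) * Dx (Dx ?P) v + (- \<alpha>') * Dx ?X v + \<sigma>' * Dx ?F v"
      by (rule Dx_linear3[OF V v sQ sX sF depends_upto_Dx_phi_flux depends_upto_phi(3) dF])
    also have "\<dots> = \<alpha>' * e - (\<delta> * r\<^sup>2 * \<alpha>') * ?P v + \<sigma>' * (?P v * (v 2 + m))"
      using \<gamma>(1) unfolding DF ev \<alpha>'_def by (simp add: field_simps)
    finally have D3: "Dx (f 3 2) v = \<alpha>' * e - (\<delta> * r\<^sup>2 * \<alpha>') * ?P v + \<sigma>' * (?P v * (v 2 + m))" .
    have SE: "structure_eqs \<delta> f v p \<longleftrightarrow>
      Dx (f 1 2) v = f 3 1 v * f 2 2 v - f 3 2 v * f 2 1 v \<and>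
      Dx (f 2 2) v - (0 * p 0 + \<alpha> * p 2) = - (f 1 2 v * f 3 1 v) \<and>
      Dx (f 3 2) v - (0 * p 0 + \<alpha>' * p 2) = - (\<delta> * (f 1 2 v * f 2 1 v))"
      by (rule structure_eqs_affine[OF V v]) (rule f11 f21 f31, assumption)+
    have e1: "Dx (f 1 2) v = f 3 1 v * f 2 2 v - f 3 2 v * f 2 1 v"
    proof -
      have w: "f 2 1 v = \<alpha> * (v 2 + m) - \<sigma>" "f 3 1 v = \<alpha>' * (v 2 + m) - \<sigma>'"
        unfolding f21[OF v] f31[OF v] by (simp_all add: \<kappa>_def \<kappa>'_def \<sigma>_def \<sigma>'_def algebra_simps)
      \<comment> \<open>Apart from a multiple of \<open>Dx ?P\<close>, the pair (f_22, f_32) is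
        proportional to (f_21, f_31), and the proportional part cancels in the wedge.\<close>
      have w': "f 2 2 v = (- \<mu>) * Dx ?P v - f 2 1 v * ?F v" "f 3 2 v = (- \<epsilon> * q) * Dx ?P v - f 3 1 v * ?F v"
        unfolding f22[OF v] f32[OF v] w phi_transport_def by (simp_all add: algebra_simps)
      have "f 3 1 v * f 2 2 v - f 3 2 v * f 2 1 v = Dx ?P v * (\<epsilon> * q * f 2 1 v - \<mu> * f 3 1 v)"
        unfolding w' by (simp add: algebra_simps)
      \<comment> \<open>The terms with z_2 + m cancel, and q^2 - \<delta> \<mu>^2 = \<gamma>
        evaluates the rest.\<close>
      also have "\<epsilon> * q * f 2 1 v - \<mu> * f 3 1 v = - r"
      proof -
        have "\<epsilon> * q * f 2 1 v - \<mu> * f 3 1 v = - r * ((\<epsilon> * \<epsilon>) * (q * q) - \<delta> * \<mu>\<^sup>2) / \<gamma>"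
          unfolding w \<alpha>_def \<alpha>'_def \<sigma>_def \<sigma>'_def using \<gamma>(1)
          by (simp add: field_simps power2_eq_square)
        then show ?thesis unfolding \<epsilon>2 q2 using \<gamma>(1) by simp
      qed
      finally show ?thesis unfolding D1 by simp
    qed
    have e2: "Dx (f 2 2) v + f 1 2 v * f 3 1 v = \<alpha> * e"
      unfolding D2 f12[OF v] f31[OF v] \<kappa>'_def \<sigma>_def \<alpha>'_def \<alpha>_def using \<gamma>(1)
      by (simp add: field_simps power2_eq_square)
    have e3: "Dx (f 3 2) v + \<delta> * (f 1 2 v * f 2 1 v) = \<alpha>' * e"
      unfolding D3 f12[OF v] f21[OF v] \<kappa>_def \<sigma>'_def \<alpha>'_def \<alpha>_def using \<gamma>(1)
      by (simp add: field_simps power2_eq_square)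
    have "structure_eqs \<delta> f v p \<longleftrightarrow> \<alpha> * e = \<alpha> * p 2 \<and> \<alpha>' * e = \<alpha>' * p 2"
      unfolding SE e2[symmetric] e3[symmetric] using e1 by auto
    also have "\<dots> \<longleftrightarrow> p 2 = e" using det by auto
    finally show ?thesis unfolding evolution_eq_lift3 e_def by simp
  qed
  show "pointwise_equivalent \<delta> V A B f"
    by (rule pointwise_equivalentI[OF V fg dg sg eqv])
  from det show "admissible_forms 0 \<delta> V f"
    by (intro admissible_formsI[of V f 0 \<alpha> \<kappa> 0 \<alpha>' \<kappa>', OF V]) (rule f11 f21 f31, assumption)+
qed

text \<open>For \<open>r = 0\<close> the 1-forms of form (II) degenerate, but the equation is then a conservation
  law \<open>z\<^sub>2\<^sub>t = D\<^sub>x \<psi>\<close> and so carries the 1-forms of form (I).\<close>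

lemma form_II_nondegenerate_or_conservation_law:
  assumes V: "open V" "V \<noteq> {}" and "form_II \<delta> V A B f"
  shows "(\<exists>v\<in>V. wedge f 1 2 v \<noteq> 0) \<or>
    (\<exists>\<psi>. smooth_on V (lift3 \<psi>) \<and> (\<forall>v\<in>V. lift3 A v * v 3 + lift3 B v = Dx (lift3 \<psi>) v))"
proof -
  from assms(3) obtain \<epsilon> m r \<gamma> \<mu> \<phi> I q where q: "q = sqrt (\<gamma> + \<delta> * \<mu>\<^sup>2)" and \<epsilon>: "\<epsilon> \<in> {1, -1}"
    and \<gamma>: "\<gamma> \<noteq> 0" "\<gamma> + \<delta> * \<mu>\<^sup>2 \<ge> 0" and I: "open I"
    and arg': "\<forall>v\<in>V. 2 * m * v 0 + (v 1)\<^sup>2 \<in> I"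
    and \<phi>: "smooth_on {w. w 0 \<in> I} (lift1 \<phi>)"
    and f: "\<forall>v\<in>V.
         phi_arg m (deriv \<phi>) v \<noteq> 0 \<and>
         lift3 A v * v 3 + lift3 B v =
           - Dx (Dx (\<lambda>u. \<gamma> * phi_flux m \<phi> u)) v - Dx (phi_transport m \<phi>) v
           + \<delta> * r\<^sup>2 * phi_flux m \<phi> v \<and>
         f 1 1 v = 0 \<and>
         f 1 2 v = - r * phi_flux m \<phi> v \<and>
         f 2 1 v = \<mu> / \<gamma> * (v 2 + m) - \<epsilon> * r * q / \<gamma>"
    unfolding form_II_iff by blast
  have arg: "2 * m * v 0 + (v 1)\<^sup>2 \<in> I" if "v \<in> V" for v using arg' that by blast
  show ?thesis
  proof (cases "r = 0")
    case False
    obtain v where v: "v \<in> V" using V(2) by blast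
    obtain s where s: "s \<notin> {0}" "v(1 := s) \<in> V" using open_jet_avoid[OF V(1) v, of "{0}" 1] by auto
    \<comment> \<open>The excluded value is the zero of f_21 as a function of z_2. For \<mu> = 0 the
      division yields 0 and the harmless value -m is excluded; f_21 is then a nonzero
      constant.\<close>
    obtain t where t: "t \<notin> {\<epsilon> * r * q / \<mu> - m}" "v(1 := s, 2 := t) \<in> V"
      using open_jet_avoid[OF V(1) s(2), of "{\<epsilon> * r * q / \<mu> - m}" 2] by auto
    let ?v = "v(1 := s, 2 := t)"
    note fv = bspec[OF f t(2)]
    have "f 2 1 ?v \<noteq> 0"
    proof (cases "\<mu> = 0")
      case True
      then have "q \<noteq> 0" using \<gamma> by (simp add: q)
      then show ?thesis using fv True False \<gamma>(1) \<epsilon> by auto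
    next
      case \<mu>: False
      have "f 2 1 ?v = \<mu> / \<gamma> * (t + m) - \<epsilon> * r * q / \<gamma>" using fv by simp
      also have "\<dots> = (\<mu> * (t - (\<epsilon> * r * q / \<mu> - m))) / \<gamma>"
        using \<mu> \<gamma>(1) by (simp add: field_simps)
      finally have "f 2 1 ?v = (\<mu> * (t - (\<epsilon> * r * q / \<mu> - m))) / \<gamma>" .
      then show ?thesis using t(1) \<mu> \<gamma>(1) by auto
    qed
    moreover have "f 1 2 ?v \<noteq> 0"
    proof -
      have "phi_arg m (deriv \<phi>) ?v \<noteq> 0" "f 1 2 ?v = - r * (2 * s * phi_arg m (deriv \<phi>) ?v)"
        using fv unfolding phi_flux_def by auto
      then show ?thesis using s(1) False by simp
    qed
    ultimately have "wedge f 1 2 ?v \<noteq> 0" using fv by (simp add: wedge_def)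
    then show ?thesis using t(2) by blast
  next
    case r: True
    let ?P = "phi_flux m \<phi>" and ?X = "phi_transport m \<phi>"
    note sm = smooth_phi[OF V(1) I arg \<phi>] and smQ = smooth_Dx_phi_flux[OF V(1) I arg \<phi>]
    have sP: "smooth_on V ?P" and sX: "smooth_on V ?X" and sQ: "smooth_on V (Dx ?P)"
      by (rule sm smQ, assumption)+
    define \<Psi> where "\<Psi> = (\<lambda>v. - \<gamma> * Dx ?P v + (- 1) * ?X v)"
    \<comment> \<open>A function of three numbers is obtained by evaluating \<Psi> at a jet whose
      components from the second on all equal the third argument. Since \<Psi> has order 2, nothing
      is lost.\<close>
    define \<psi> where "\<psi> = (\<lambda>x y z. \<Psi> (\<lambda>i. if i = 0 then x else if i = 1 then y else z))"
    have \<psi>: "lift3 \<psi> = \<Psi>"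
    proof
      fix v :: jet
      let ?w = "\<lambda>i. if i = 0 then v 0 else if i = 1 then v 1 else v 2"
      have w: "?w i = v i" if "i \<le> 2" for i
      proof -
        from that have "i = 0 \<or> i = 1 \<or> i = 2" by auto
        then show ?thesis by auto
      qed
      have "Dx ?P ?w = Dx ?P v"
        by (rule depends_upto_eq[OF depends_upto_Dx_phi_flux[of UNIV] UNIV_I UNIV_I w])
      moreover have "?X ?w = ?X v"
        by (rule depends_upto_eq[OF depends_upto_phi(3)[of UNIV] UNIV_I UNIV_I w])
      ultimately show "lift3 \<psi> v = \<Psi> v" unfolding lift3_def \<psi>_def \<Psi>_def by simp
    qed
    have "smooth_on V \<Psi>" unfolding \<Psi>_def
      by (intro smooth_on_add smooth_on_cmult sQ sX V)
    moreover have "lift3 A v * v 3 + lift3 B v = Dx \<Psi> v" if v: "v \<in> V" for v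
    proof -
      have DD: "Dx (Dx (\<lambda>u. \<gamma> * ?P u)) v = \<gamma> * Dx (Dx ?P) v"
        by (rule Dx_Dx_cmult_phi_flux[OF V(1) I arg \<phi> v])
      then have "lift3 A v * v 3 + lift3 B v = - \<gamma> * Dx (Dx ?P) v + (- 1) * Dx ?X v"
        using bspec[OF f v] r by simp
      also have "\<dots> = Dx \<Psi> v" unfolding \<Psi>_def
        by (rule Dx_linear[OF V(1) v sQ sX depends_upto_Dx_phi_flux depends_upto_phi(3), symmetric])
      finally show ?thesis .
    qed
    ultimately show ?thesis using \<psi> by metis
  qed
qed

text \<open>A and B do not involve z_3, so two values of z_3 separate them.\<close>

lemma rhs_zero_imp_coefficients_zero:
  assumes "open V" "v \<in> V" "\<And>v. v \<in> V \<Longrightarrow> lift3 A v * v 3 + lift3 B v = 0"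
  shows "lift3 A v = 0 \<and> lift3 B v = 0"
proof -
  obtain s where s: "s \<notin> {v 3}" "v(3 := s) \<in> V"
    using open_jet_avoid[OF assms(1,2), of "{v 3}" 3] by auto
  have "lift3 A v * v 3 + lift3 B v = 0" "lift3 A v * s + lift3 B v = 0"
    using assms(3)[OF assms(2)] assms(3)[OF s(2)] by (simp_all add: lift3_def)
  then have "lift3 A v * (v 3 - s) = 0" unfolding right_diff_distrib by linarith
  then have "lift3 A v = 0" using s(1) by simp
  then show ?thesis using assms(3)[OF assms(2)] by simp
qed

text \<open>A constant flux would make A z_3 + B vanish identically, hence A = B = 0. Form (I) asks
  for a nonconstant flux, and this is where A^2 + B^2 \<noteq> 0 enters.\<close>

lemma flux_not_constant:
  assumes "open V" "V \<noteq> {}" "\<And>v. v \<in> V \<Longrightarrow> (lift3 A v)\<^sup>2 + (lift3 B v)\<^sup>2 \<noteq> 0"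
    "\<And>v. v \<in> V \<Longrightarrow> lift3 A v * v 3 + lift3 B v = Dx F v"
  shows "\<not> F constant_on V"
proof
  assume "F constant_on V"
  then obtain c where c: "\<And>v. v \<in> V \<Longrightarrow> F v = c" unfolding constant_on_def by blast
  have "Dx F v = 0" if "v \<in> V" for v
  proof -
    have "Dx F v = Dx (\<lambda>_. c) v" by (rule Dx_cong_open[OF assms(1) that c])
    also have "\<dots> = 0" by (simp add: Dx_def pd_def)
    finally show ?thesis .
  qed
  then have 0: "\<And>v. v \<in> V \<Longrightarrow> lift3 A v * v 3 + lift3 B v = 0" using assms(4) by simp
  obtain v where v: "v \<in> V" using assms(2) by blast
  then show False using rhs_zero_imp_coefficients_zero[OF assms(1) v 0] assms(3)[OF v] by simp
qed

text \<open>In form (I) the choice of phi is independent of the flux, so one admissible phi serves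
  all conservation laws: r = 0, with phi = cosh z_1 for \<delta> = 1 and phi = cos z_1 for \<delta>
  = -1.\<close>

lemma conservation_law_form_I:
  assumes \<delta>: "\<delta> \<in> {1, -1}" and V: "open V" "V \<noteq> {}"
    and AB: "\<And>v. v \<in> V \<Longrightarrow> (lift3 A v)\<^sup>2 + (lift3 B v)\<^sup>2 \<noteq> 0"
    and \<psi>: "smooth_on V (lift3 \<psi>)" "\<And>v. v \<in> V \<Longrightarrow> lift3 A v * v 3 + lift3 B v = Dx (lift3 \<psi>) v"
  obtains f where "form_I \<delta> V A B f"
proof -
  let ?u = "oscillation (0\<^sup>2 - \<delta>) 1 0" and ?w = "oscillation' (0\<^sup>2 - \<delta>) 1 0"
  define f :: "nat \<Rightarrow> nat \<Rightarrow> jet \<Rightarrow> real" where "f = (\<lambda>i j v. if j = 1 then (if i = 2 then v 2 else 0)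
    else (if i = 1 then - ?w (v 1) else if i = 2 then lift3 \<psi> v else \<delta> * ?u (v 1)))"
  have nc: "\<not> lift3 \<psi> constant_on V" by (rule flux_not_constant[OF V AB \<psi>(2)])
  have "form_I \<delta> V A B f"
    unfolding form_I_iff
  proof (rule exI[of _ 1], rule exI[of _ 0], rule exI[of _ \<psi>], rule exI[of _ 1], rule exI[of _ 0],
      intro conjI ballI \<psi> nc)
    show "0\<^sup>2 \<noteq> \<delta>" using \<delta> by auto
  qed (simp_all add: f_def)
  then show ?thesis using that by blast
qed

lemma admissible_forms_subset:
  assumes "admissible_forms \<eta> \<delta> V f" "U \<subseteq> V"
  shows "admissible_forms \<eta> \<delta> U f"
  unfolding admissible_forms_def
proof (intro conjI ballI)
  show "f 1 1 v = \<eta>" if "v \<in> U" for v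
    using assms that unfolding admissible_forms_def by blast
  show "(pd 2 (f 3 1) v)\<^sup>2 - \<delta> * (pd 2 (f 2 1) v)\<^sup>2 \<noteq> 0" if "v \<in> U" for v
    using assms that unfolding admissible_forms_def by blast
  fix p :: nat assume "p \<in> {2, 3}"
  then obtain \<alpha> \<beta> \<kappa> where "\<forall>v\<in>V. f p 1 v = \<alpha> * v 0 + \<beta> * v 2 + \<kappa>"
    using assms(1) unfolding admissible_forms_def by blast
  then have "\<forall>v\<in>U. f p 1 v = \<alpha> * v 0 + \<beta> * v 2 + \<kappa>" by (intro ballI) (use assms(2) in blast)
  then show "\<exists>\<alpha> \<beta> \<kappa>. \<forall>v\<in>U. f p 1 v = \<alpha> * v 0 + \<beta> * v 2 + \<kappa>" by (intro exI)
qed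

section \<open>From the forms back to surfaces on some open set\<close>

lemma generically_describesI:
  assumes V: "open V" "V \<subseteq> \<Omega>" and v: "v \<in> V" "wedge f 1 2 v \<noteq> 0"
    and f: "pointwise_equivalent \<delta> V A B f" "admissible_forms 0 \<delta> V f"
  shows "generically \<Omega> (\<lambda>V. describes_surfaces \<delta> V A B f \<and> admissible_forms 0 \<delta> V f)"
proof -
  \<comment> \<open>One point with nonzero wedge is given; by continuity the set of all such points
    of V is open.\<close>
  let ?U = "{w \<in> V. wedge f 1 2 w \<noteq> 0}"
  from f(1) have sm: "\<And>i j. i \<in> {1,2,3} \<Longrightarrow> j \<in> {1,2} \<Longrightarrow> smooth_on V (f i j)"
    unfolding pointwise_equivalent_def by blast
  have "continuous_on V (\<lambda>w. f 1 1 w * f 2 2 w - f 1 2 w * f 2 1 w)"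
    by (intro continuous_on_diff continuous_on_mult smooth_on_continuous sm) simp_all
  then have "continuous_on V (wedge f 1 2)" by (simp add: wedge_def[abs_def])
  then have "open (V \<inter> wedge f 1 2 -` (- {0}))"
    by (rule continuous_open_preimage[OF _ V(1)]) auto
  then have "open ?U" by (simp add: vimage_def Int_def)
  moreover have "?U \<subseteq> \<Omega>" "?U \<noteq> {}" using V v by auto
  moreover have "describes_surfaces \<delta> ?U A B f"
    by (rule pointwise_equivalent_imp_describes[OF pointwise_equivalent_subset[OF f(1)]])
       (auto simp: nondegenerate_def)
  moreover have "admissible_forms 0 \<delta> ?U f"
    by (rule admissible_forms_subset[OF f(2)]) auto
  ultimately show ?thesis unfolding generically_def by blast
qed

lemma form_I_or_II_pointwise_equivalent:
  assumes \<delta>: "\<delta> \<in> {1, -1}" and V: "open V" and f: "form_I_or_II \<delta> V A B f"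
  shows "pointwise_equivalent \<delta> V A B f" "admissible_forms 0 \<delta> V f"
proof -
  from f obtain a b c c0 where abc: "a * b * c \<noteq> 0" and
    f': "form_I \<delta> (tr_jet a c c0 ` V) (tr_A a b c c0 A) (tr_B a b c c0 B) (tr_f a b c c0 f) \<or>
      form_II \<delta> (tr_jet a c c0 ` V) (tr_A a b c c0 A) (tr_B a b c c0 B) (tr_f a b c c0 f)"
    unfolding form_I_or_II_def Let_def by blast
  have V': "open (tr_jet a c c0 ` V)" using abc V by (intro open_tr_image) auto
  have "pointwise_equivalent \<delta> (tr_jet a c c0 ` V) (tr_A a b c c0 A) (tr_B a b c c0 B) (tr_f a b c c0 f) \<and>
    admissible_forms 0 \<delta> (tr_jet a c c0 ` V) (tr_f a b c c0 f)"
    by (rule disjE[OF f'])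
       (intro conjI form_I_pointwise_equivalent[OF \<delta> V'] form_II_pointwise_equivalent[OF V'], assumption+)+
  then show "pointwise_equivalent \<delta> V A B f" "admissible_forms 0 \<delta> V f"
    by (rule tr_back[OF abc V conjunct1 conjunct2], assumption)+
qed

text \<open>The given f may be degenerate, so only the existence of suitable 1-forms is claimed.
  They are found in the transformed coordinates, where the equation has its normal form, and then
  pulled back.\<close>

lemma form_I_or_II_imp_describes:
  assumes \<delta>: "\<delta> \<in> {1, -1}" and V: "open V" "V \<noteq> {}" "V \<subseteq> \<Omega>"
    and AB: "\<And>v. v \<in> V \<Longrightarrow> (lift3 A v)\<^sup>2 + (lift3 B v)\<^sup>2 \<noteq> 0"
    and f: "form_I_or_II \<delta> V A B f"
  shows "\<exists>f. generically \<Omega> (\<lambda>V. describes_surfaces \<delta> V A B f \<and> admissible_forms 0 \<delta> V f)"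
proof -
  from f obtain a b c c0 where abc: "a * b * c \<noteq> 0" and
    f': "form_I \<delta> (tr_jet a c c0 ` V) (tr_A a b c c0 A) (tr_B a b c c0 B) (tr_f a b c c0 f) \<or>
      form_II \<delta> (tr_jet a c c0 ` V) (tr_A a b c c0 A) (tr_B a b c c0 B) (tr_f a b c c0 f)"
    unfolding form_I_or_II_def Let_def by blast
  have nz: "a \<noteq> 0" "b \<noteq> 0" "c \<noteq> 0" using abc by auto
  let ?V = "tr_jet a c c0 ` V" and ?A = "tr_A a b c c0 A" and ?B = "tr_B a b c c0 B"
  have V': "open ?V" "?V \<noteq> {}" using open_tr_image[OF nz V(1)] V(2) by auto
  have AB': "(lift3 ?A v)\<^sup>2 + (lift3 ?B v)\<^sup>2 \<noteq> 0" if "v \<in> ?V" for v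
  proof -
    obtain w where w: "w \<in> V" "v = tr_jet a c c0 w" using \<open>v \<in> ?V\<close> by blast
    have "lift3 A w \<noteq> 0 \<or> lift3 B w \<noteq> 0" using AB[OF w(1)] by auto
    then have "lift3 ?A v \<noteq> 0 \<or> lift3 ?B v \<noteq> 0" unfolding w(2) lift3_tr[OF nz] using nz by auto
    then show ?thesis by simp
  qed
  have "\<exists>g. (\<exists>v\<in>?V. wedge g 1 2 v \<noteq> 0) \<and> (form_I \<delta> ?V ?A ?B g \<or> form_II \<delta> ?V ?A ?B g)"
  proof -
    have I: ?thesis if g: "form_I \<delta> ?V ?A ?B g" for g
    proof -
      obtain v where "v \<in> ?V" "wedge g 1 2 v \<noteq> 0" by (rule form_I_somewhere_nondegenerate[OF V' g])
      then show ?thesis using g by (intro exI[of _ g] conjI bexI[of _ v] disjI1)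
    qed
    show ?thesis
    proof (rule disjE[OF f' I])
      assume f'': "form_II \<delta> ?V ?A ?B (tr_f a b c c0 f)"
      show ?thesis
      proof (rule disjE[OF form_II_nondegenerate_or_conservation_law[OF V' f'']])
        assume "\<exists>v\<in>?V. wedge (tr_f a b c c0 f) 1 2 v \<noteq> 0"
        then show ?thesis using f'' by (intro exI[of _ "tr_f a b c c0 f"] conjI disjI2)
      next
        assume "\<exists>\<psi>. smooth_on ?V (lift3 \<psi>) \<and> (\<forall>v\<in>?V. lift3 ?A v * v 3 + lift3 ?B v = Dx (lift3 \<psi>) v)"
        then obtain \<psi> where \<psi>: "smooth_on ?V (lift3 \<psi>)" "\<forall>v\<in>?V. lift3 ?A v * v 3 + lift3 ?B v = Dx (lift3 \<psi>) v"
          by (elim exE conjE)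
        obtain g where "form_I \<delta> ?V ?A ?B g"
          by (rule conservation_law_form_I[OF \<delta> V' AB' \<psi>(1) bspec[OF \<psi>(2)]])
        then show ?thesis by (rule I)
      qed
    qed
  qed
  then obtain g v where v: "v \<in> ?V" "wedge g 1 2 v \<noteq> 0"
    and form: "form_I \<delta> ?V ?A ?B g \<or> form_II \<delta> ?V ?A ?B g" by (elim exE conjE bexE)
  have g1: "pointwise_equivalent \<delta> ?V ?A ?B g"
    by (rule disjE[OF form]) (erule form_I_pointwise_equivalent[OF \<delta> V'(1)] form_II_pointwise_equivalent[OF V'(1)])+
  have g2: "admissible_forms 0 \<delta> ?V g"
    by (rule disjE[OF form]) (erule form_I_pointwise_equivalent[OF \<delta> V'(1)] form_II_pointwise_equivalent[OF V'(1)])+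
  \<comment> \<open>The 1-forms whose transforms are g.\<close>
  define h where "h = (\<lambda>i j v. g i j (tr_jet a c c0 v) * (if j = 1 then a else b))"
  have h: "tr_f a b c c0 h = g"
    using nz by (intro ext) (simp add: tr_f_def h_def tr_tr_inv[OF nz, simplified])
  have h': "pointwise_equivalent \<delta> V A B h" "admissible_forms 0 \<delta> V h"
    by (rule tr_back[OF abc V(1), of \<delta> c0 A B h, unfolded h, OF g1 g2])+
  obtain w where w: "w \<in> V" "v = tr_jet a c c0 w" using v(1) by blast
  have "wedge h 1 2 w \<noteq> 0"
    using v(2) wedge_tr[OF nz, of c0 h 1 2 w] unfolding h w(2) by auto
  show ?thesis by (rule exI, rule generically_describesI[OF V(1,3) w(1) \<open>wedge h 1 2 w \<noteq> 0\<close> h'])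
qed

section \<open>Symmetry of second derivatives and a chain rule\<close>

text \<open>The mean value theorem is applied in direction i to a difference in direction j, and
  then in direction j. The left-hand side is symmetric in i and j, the right-hand side is
  not.\<close>

lemma second_difference_mvt:
  fixes F :: "jet \<Rightarrow> real"
  assumes F: "smooth_on V F" and h: "h > 0" and ij: "i \<noteq> j"
    and box: "\<And>x y. v i \<le> x \<Longrightarrow> x \<le> v i + h \<Longrightarrow> v j \<le> y \<Longrightarrow> y \<le> v j + h \<Longrightarrow> v(i := x, j := y) \<in> V"
  obtains x y where "v i < x" "x < v i + h" "v j < y" "y < v j + h"
    "F (v(i := v i + h, j := v j + h)) - F (v(i := v i + h, j := v j))
      - (F (v(i := v i, j := v j + h)) - F (v(i := v i, j := v j)))
      = h * h * pd j (pd i F) (v(i := x, j := y))"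
proof -
  have di: "((\<lambda>x. G (v(i := x, j := y))) has_field_derivative pd i G (v(i := x, j := y))) (at x)"
    if "smooth_on V G" "v i \<le> x" "x \<le> v i + h" "v j \<le> y" "y \<le> v j + h" for G x y
  proof -
    have "(v(i := x, j := y))(i := s) = v(i := s, j := y)" for s using ij by (simp add: fun_upd_twist)
    then show ?thesis
      using smooth_on_has_pd[OF that(1) box[OF that(2-5)], of i] ij by simp
  qed
  have dj: "((\<lambda>y. G (v(i := x, j := y))) has_field_derivative pd j G (v(i := x, j := y))) (at y)"
    if "smooth_on V G" "v i \<le> x" "x \<le> v i + h" "v j \<le> y" "y \<le> v j + h" for G x y
    using smooth_on_has_pd[OF that(1) box[OF that(2-5)], of j] unfolding fun_upd_upd fun_upd_same .
  let ?p = "\<lambda>x. F (v(i := x, j := v j + h)) - F (v(i := x, j := v j))"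
  have "\<exists>x. v i < x \<and> x < v i + h \<and> ?p (v i + h) - ?p (v i) = (v i + h - v i) *
      (pd i F (v(i := x, j := v j + h)) - pd i F (v(i := x, j := v j)))"
  proof (rule MVT2)
    show "(?p has_field_derivative pd i F (v(i := x, j := v j + h)) - pd i F (v(i := x, j := v j))) (at x)"
      if "v i \<le> x" "x \<le> v i + h" for x
      by (intro DERIV_diff di[OF F that]) (use h in auto)
  qed (use h in simp)
  then obtain x where x: "v i < x" "x < v i + h"
    "?p (v i + h) - ?p (v i) = h * (pd i F (v(i := x, j := v j + h)) - pd i F (v(i := x, j := v j)))" by auto
  have "\<exists>y. v j < y \<and> y < v j + h \<and> pd i F (v(i := x, j := v j + h)) - pd i F (v(i := x, j := v j))
      = (v j + h - v j) * pd j (pd i F) (v(i := x, j := y))"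
  proof (rule MVT2)
    show "((\<lambda>y. pd i F (v(i := x, j := y))) has_field_derivative pd j (pd i F) (v(i := x, j := y))) (at y)"
      if "v j \<le> y" "y \<le> v j + h" for y
      by (rule dj[OF smooth_on_pd[OF F] _ _ that]) (use x in auto)
  qed (use h in simp)
  then obtain y where y: "v j < y" "y < v j + h"
    "pd i F (v(i := x, j := v j + h)) - pd i F (v(i := x, j := v j)) = h * pd j (pd i F) (v(i := x, j := y))"
    by auto
  show ?thesis using that[OF x(1,2) y(1,2)] x(3) y(3) by simp
qed

text \<open>The same second difference over a small square equals both mixed derivatives, each taken
  at some point of the square. Since these are continuous at v, they cannot differ there.\<close>

lemma pd_commute:
  assumes V: "open V" and F: "smooth_on V F" and v: "v \<in> V"
  shows "pd i (pd j F) v = pd j (pd i F) v"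
proof (cases "i = j")
  case ij: False
  show ?thesis
  proof (rule ccontr)
    assume ne: "pd i (pd j F) v \<noteq> pd j (pd i F) v"
    \<comment> \<open>Half the supposed gap: two numbers closer than d to the respective mixed
      derivatives at v cannot coincide.\<close>
    define d where "d = \<bar>pd i (pd j F) v - pd j (pd i F) v\<bar> / 2"
    have d: "d > 0" using ne by (simp add: d_def)
    have near: "open (V \<inter> {w. \<bar>G w - G v\<bar> < d})" if "smooth_on V G" for G
    proof -
      have "continuous_on V (\<lambda>w. \<bar>G w - G v\<bar>)"
        by (intro continuous_on_rabs continuous_on_diff smooth_on_continuous[OF that] continuous_on_const)
      from continuous_open_preimage[OF this V open_lessThan[of d]] show ?thesis
        by (simp add: vimage_def)
    qed
    let ?U = "(V \<inter> {w. \<bar>pd i (pd j F) w - pd i (pd j F) v\<bar> < d}) \<inter>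
      (V \<inter> {w. \<bar>pd j (pd i F) w - pd j (pd i F) v\<bar> < d})"
    have "open ?U" by (intro open_Int near smooth_on_pd F)
    moreover have "v \<in> ?U" using v d by simp
    ultimately obtain N e where e: "e > 0" "jet_box N v e \<subseteq> ?U"
      by - (erule (1) open_contains_jet_box[OF _ _ zero_less_one, where M = 0], rule that)
    define h where "h = e / 2"
    have h: "h > 0" "h < e" using e(1) by (auto simp: h_def)
    have box: "v(i := x, j := y) \<in> ?U"
      if "v i \<le> x" "x \<le> v i + h" "v j \<le> y" "y \<le> v j + h" for x y
      by (rule subsetD[OF e(2)]) (use that h in \<open>auto simp: jet_box_def\<close>)
    obtain x y where xy: "v i < x" "x < v i + h" "v j < y" "y < v j + h"
      "F (v(i := v i + h, j := v j + h)) - F (v(i := v i + h, j := v j))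
      - (F (v(i := v i, j := v j + h)) - F (v(i := v i, j := v j)))
      = h * h * pd j (pd i F) (v(i := x, j := y))"
      by (rule second_difference_mvt[OF F h(1) ij, of v]) (use box in blast)+
    obtain y' x' where xy': "v j < y'" "y' < v j + h" "v i < x'" "x' < v i + h"
      "F (v(j := v j + h, i := v i + h)) - F (v(j := v j + h, i := v i))
      - (F (v(j := v j, i := v i + h)) - F (v(j := v j, i := v i)))
      = h * h * pd i (pd j F) (v(j := y', i := x'))"
      by (rule second_difference_mvt[OF F h(1), of j i v]) (use box ij in \<open>auto simp: fun_upd_twist[of j i]\<close>)
    have twist: "v(j := y, i := x) = v(i := x, j := y)" for x y
      by (rule fun_upd_twist[OF ij[symmetric]])
    have red: "v(i := x, j := v j) = v(i := x)" for x
      by (rule fun_upd_idem) (use ij in simp)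
    have swap: "p - q - (r - s) = p - r - (q - s)" for p q r s :: real by simp
    have "h * h * pd i (pd j F) (v(i := x', j := y')) = h * h * pd j (pd i F) (v(i := x, j := y))"
      by (rule trans[OF xy'(5)[symmetric, unfolded twist fun_upd_triv] trans[OF swap xy(5)[unfolded red fun_upd_triv]]])
    then have eq: "pd i (pd j F) (v(i := x', j := y')) = pd j (pd i F) (v(i := x, j := y))"
      using h(1) by simp
    have "v(i := x', j := y') \<in> ?U" "v(i := x, j := y) \<in> ?U"
      using box xy(1-4) xy'(1-4) by (simp_all add: less_imp_le)
    then have "\<bar>pd i (pd j F) (v(i := x', j := y')) - pd i (pd j F) v\<bar> < d"
      "\<bar>pd j (pd i F) (v(i := x, j := y)) - pd j (pd i F) v\<bar> < d" by blast+
    then show False unfolding eq d_def by (auto simp: abs_if split: if_splits)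
  qed
qed simp

text \<open>The curve moves two coordinates at once, so partial derivatives alone do not suffice.
  Continuity of the partial derivative in direction j yields total differentiability in the two
  coordinates.\<close>

lemma chain_rule_two_coordinates:
  assumes F: "smooth_on V F" and ij: "i \<noteq> j"
    and X: "open X" and Y: "open Y" "convex Y"
    and V: "\<And>x y. x \<in> X \<Longrightarrow> y \<in> Y \<Longrightarrow> c(i := x, j := y) \<in> V"
    and t: "t \<in> X" "g t \<in> Y" and g: "(g has_field_derivative g') (at t)"
  shows "((\<lambda>s. F (c(i := s, j := g s))) has_field_derivative
     pd i F (c(i := t, j := g t)) + pd j F (c(i := t, j := g t)) * g') (at t)"
proof -
  let ?p = "\<lambda>x y. c(i := x, j := y)"
  have dj: "((\<lambda>y. F (?p x y)) has_field_derivative pd j F (?p x y)) (at y)" if "x \<in> X" "y \<in> Y" for x y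
    using smooth_on_has_pd[OF F V[OF that], of j] unfolding fun_upd_upd fun_upd_same .
  have di: "((\<lambda>x. F (?p x y)) has_field_derivative pd i F (?p x y)) (at x)" if "x \<in> X" "y \<in> Y" for x y
  proof -
    have "(?p x y)(i := s) = ?p s y" for s using ij by (simp add: fun_upd_twist)
    then show ?thesis using smooth_on_has_pd[OF F V[OF that], of i] ij by simp
  qed
  have cont: "continuous_on (X \<times> Y) (\<lambda>z. pd j F (?p (fst z) (snd z)))"
  proof (rule continuous_on_compose2[OF smooth_on_continuous[OF smooth_on_pd[OF F]]])
    show "continuous_on (X \<times> Y) (\<lambda>z. ?p (fst z) (snd z))"
    proof (rule continuous_on_coordinatewise_then_product)
      show "continuous_on (X \<times> Y) (\<lambda>z. (?p (fst z) (snd z)) k)" for k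
        by (cases "k = j"; cases "k = i") (auto intro!: continuous_intros)
    qed
  qed (use V in auto)
  have "((\<lambda>(x, y). F (?p x y)) has_derivative
      (\<lambda>(tx, ty). pd i F (?p t (g t)) * tx + blinfun_apply (blinfun_mult_right (pd j F (?p t (g t)))) ty))
      (at (t, g t) within X \<times> Y)"
  proof (rule has_derivative_partialsI[where fy = "\<lambda>x y. blinfun_mult_right (pd j F (?p x y))"])
    show "((\<lambda>x. F (?p x (g t))) has_derivative (\<lambda>tx. pd i F (?p t (g t)) * tx)) (at t within X)"
      using has_field_derivative_at_within[OF di[OF t]] by (simp add: has_field_derivative_def)
    show "((\<lambda>y. F (?p x y)) has_derivative blinfun_apply (blinfun_mult_right (pd j F (?p x y)))) (at y within Y)"
      if "x \<in> X" "y \<in> Y" for x y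
      using has_field_derivative_at_within[OF dj[OF that]] by (simp add: has_field_derivative_def)
    have "continuous_on (X \<times> Y) (\<lambda>z. blinfun_mult_right (pd j F (?p (fst z) (snd z))))"
      by (rule bounded_linear.continuous_on[OF bounded_linear_blinfun_mult_right cont])
    then show "continuous (at (t, g t) within X \<times> Y) (\<lambda>(x, y). blinfun_mult_right (pd j F (?p x y)))"
      using t by (simp add: continuous_on_eq_continuous_within split_def)
  qed (use t Y in auto)
  moreover have "at (t, g t) within X \<times> Y = at (t, g t)"
    by (rule at_within_open) (use t X Y in \<open>auto intro: open_Times\<close>)
  ultimately have D: "((\<lambda>(x, y). F (?p x y)) has_derivative
      (\<lambda>(tx, ty). pd i F (?p t (g t)) * tx + pd j F (?p t (g t)) * ty)) (at (t, g t))"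
    by simp
  have G: "((\<lambda>s. (s, g s)) has_derivative (\<lambda>s. (s, g' * s))) (at t)"
    using g by (intro has_derivative_Pair has_derivative_ident) (simp add: has_field_derivative_def)
  have "((\<lambda>s. F (?p s (g s))) has_derivative
      (\<lambda>s. pd i F (?p t (g t)) * s + pd j F (?p t (g t)) * (g' * s))) (at t)"
    using has_derivative_compose[OF G D] by (simp add: split_def)
  then show ?thesis
    unfolding has_field_derivative_def by (rule has_derivative_eq_rhs) (auto simp: algebra_simps)
qed

section \<open>Solutions of the oscillator equation on an interval\<close>

lemma oscillation_add: "oscillation k a b s = a * oscillation k 1 0 s + b * oscillation k 0 1 s"
  "oscillation' k a b s = a * oscillation' k 1 0 s + b * oscillation' k 0 1 s"
  by (auto simp: oscillation_def oscillation'_def algebra_simps)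

text \<open>The derivative of the Wronskian is 0, and at 0 the fundamental solutions have values 1
  and 0 and derivatives 0 and sqrt |k|.\<close>

lemma oscillation_wronskian:
  "oscillation k 1 0 s * oscillation' k 0 1 s - oscillation k 0 1 s * oscillation' k 1 0 s = sqrt \<bar>k\<bar>"
proof -
  let ?W = "\<lambda>s. oscillation k 1 0 s * oscillation' k 0 1 s - oscillation k 0 1 s * oscillation' k 1 0 s"
  have "(?W has_field_derivative 0) (at s)" for s
    by (auto intro!: derivative_eq_intros DERIV_cong[OF DERIV_mult] oscillation_deriv oscillation'_deriv
        simp: algebra_simps)
  then have "?W s = ?W 0" using DERIV_isconst_all by blast
  then show ?thesis by (simp add: oscillation_def oscillation'_def)
qed

text \<open>The Wronskians of a solution with the two fundamental solutions are constant.\<close>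

lemma oscillator_solution:
  assumes k: "k \<noteq> 0" and e: "e > 0"
    and u: "\<And>s. \<bar>s - c\<bar> < e \<Longrightarrow> (u has_field_derivative w s) (at s)"
    and w: "\<And>s. \<bar>s - c\<bar> < e \<Longrightarrow> (w has_field_derivative - k * u s) (at s)"
  obtains a b where "\<And>s. \<bar>s - c\<bar> < e \<Longrightarrow> u s = oscillation k a b s \<and> w s = oscillation' k a b s"
proof -
  let ?C = "oscillation k 1 0" and ?S = "oscillation k 0 1"
  let ?C' = "oscillation' k 1 0" and ?S' = "oscillation' k 0 1"
  define \<omega> where "\<omega> = sqrt \<bar>k\<bar>"
  have \<omega>: "\<omega> \<noteq> 0" using k by (simp add: \<omega>_def)
  let ?p = "\<lambda>s. u s * ?S' s - w s * ?S s" and ?q = "\<lambda>s. w s * ?C s - u s * ?C' s"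
  have dp: "(?p has_field_derivative 0) (at s)" and dq: "(?q has_field_derivative 0) (at s)" if "\<bar>s - c\<bar> < e" for s
    by (rule DERIV_cong[OF DERIV_diff[OF DERIV_mult DERIV_mult]],
        (rule u w that oscillation_deriv oscillation'_deriv)+, simp add: algebra_simps)+
  have p: "?p s = ?p c" and q: "?q s = ?q c" if "\<bar>s - c\<bar> < e" for s
    by (rule has_derivative_0_constant_interval[where c = c and e = e, OF _ that];
        use dp dq e in simp)+
  show ?thesis
  proof (rule that)
    fix s assume s: "\<bar>s - c\<bar> < e"
    \<comment> \<open>Cramer's rule, whose determinant is the constant Wronskian \<omega> of the
      fundamental solutions.\<close>
    have "\<omega> * u s = ?p s * ?C s + ?q s * ?S s" "\<omega> * w s = ?p s * ?C' s + ?q s * ?S' s"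
      unfolding \<omega>_def oscillation_wronskian[of k s, symmetric] by (simp_all add: algebra_simps)
    moreover have "x = a / \<omega> * C + b / \<omega> * S" if "\<omega> * x = a * C + b * S" for x a b C S
      using \<omega> that by (simp add: field_simps)
    ultimately have "u s = ?p s / \<omega> * ?C s + ?q s / \<omega> * ?S s" "w s = ?p s / \<omega> * ?C' s + ?q s / \<omega> * ?S' s"
      by blast+
    then show "u s = oscillation k (?p c / \<omega>) (?q c / \<omega>) s \<and> w s = oscillation' k (?p c / \<omega>) (?q c / \<omega>) s"
      unfolding p[OF s] q[OF s] oscillation_add[of k "?p c / \<omega>"] by simp
  qed
qed

section \<open>Classification\<close>

text \<open>For F of order 1, Dx F is affine in z_2 with coefficients of order 1. So P v 2 + Q can
  be compared coefficientwise, by moving z_2 alone.\<close>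

lemma total_derivative_coefficients:
  assumes V: "open V" and F: "depends_upto 1 V F" and P: "depends_upto 1 V P" and Q: "depends_upto 1 V Q"
    and D: "\<And>v. v \<in> V \<Longrightarrow> Dx F v = P v * v 2 + Q v" and v: "v \<in> V"
  shows "pd 1 F v = P v" "v 1 * pd 0 F v = Q v"
proof -
  have Dx: "Dx F v = v 1 * pd 0 F v + v 2 * pd 1 F v" if "v \<in> V" for v
    unfolding Dx_depends[OF V F that] by (simp add: numeral_2_eq_2)
  obtain s where s: "s \<notin> {v 2}" "v(2 := s) \<in> V" using open_jet_avoid[OF V v, of "{v 2}" 2] by auto
  have eq: "G (v(2 := s)) = G v" if "depends_upto 1 V G" for G
    by (rule depends_upto_eq[OF that s(2) v]) auto
  have 1: "v 1 * pd 0 F v + v 2 * pd 1 F v = P v * v 2 + Q v"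
    using Dx[OF v] D[OF v] by simp
  have 2: "v 1 * pd 0 F v + s * pd 1 F v = P v * s + Q v"
    using Dx[OF s(2)] D[OF s(2)] eq[OF depends_upto_pd[OF V F]] eq[OF P] eq[OF Q] by simp
  have "(pd 1 F v - P v) * (v 2 - s) = 0" using 1 2 by (simp add: algebra_simps)
  then show 3: "pd 1 F v = P v" using s(1) by simp
  show "v 1 * pd 0 F v = Q v" using 1 unfolding 3 by simp
qed

lemma structure_identities:
  assumes V: "open V" "V \<noteq> {}" and f: "pointwise_equivalent \<delta> V A B f"
    and f11: "\<And>v. v \<in> V \<Longrightarrow> f 1 1 v = 0"
    and f21: "\<And>v. v \<in> V \<Longrightarrow> f 2 1 v = \<alpha> * v 0 + \<beta> * v 2 + \<kappa>"
    and f31: "\<And>v. v \<in> V \<Longrightarrow> f 3 1 v = \<alpha>' * v 0 + \<beta>' * v 2 + \<kappa>'"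
  shows "\<alpha> = 0" "\<alpha>' = 0"
    "\<And>v. v \<in> V \<Longrightarrow> Dx (f 1 2) v = f 3 1 v * f 2 2 v - f 3 2 v * f 2 1 v"
    "\<And>v. v \<in> V \<Longrightarrow> Dx (f 2 2) v = \<beta> * (lift3 A v * v 3 + lift3 B v) - f 1 2 v * f 3 1 v"
    "\<And>v. v \<in> V \<Longrightarrow> Dx (f 3 2) v = \<beta>' * (lift3 A v * v 3 + lift3 B v) - \<delta> * (f 1 2 v * f 2 1 v)"
proof -
  let ?E = "\<lambda>v. lift3 A v * v 3 + lift3 B v"
  have eqs: "Dx (f 1 2) v = f 3 1 v * f 2 2 v - f 3 2 v * f 2 1 v \<and>
      Dx (f 2 2) v - (\<alpha> * s + \<beta> * ?E v) = - (f 1 2 v * f 3 1 v) \<and>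
      Dx (f 3 2) v - (\<alpha>' * s + \<beta>' * ?E v) = - (\<delta> * (f 1 2 v * f 2 1 v))" if v: "v \<in> V" for v s
  proof -
    \<comment> \<open>These t-derivatives satisfy the evolution equation whatever s is, since only
      p_2 is prescribed. The structure equations must then hold for every s, and s = 0 and s = 1
      give \<alpha> = \<alpha>' = 0.\<close>
    define p :: jet where "p = (\<lambda>i. if i = 2 then ?E v else s)"
    have "structure_eqs \<delta> f v p \<longleftrightarrow>
      Dx (f 1 2) v = f 3 1 v * f 2 2 v - f 3 2 v * f 2 1 v \<and>
      Dx (f 2 2) v - (\<alpha> * p 0 + \<beta> * p 2) = - (f 1 2 v * f 3 1 v) \<and>
      Dx (f 3 2) v - (\<alpha>' * p 0 + \<beta>' * p 2) = - (\<delta> * (f 1 2 v * f 2 1 v))"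
      by (rule structure_eqs_affine[OF V(1) v]) (rule f11 f21 f31, assumption)+
    moreover have "evolution_eq A B v p \<longleftrightarrow> structure_eqs \<delta> f v p"
      using f v unfolding pointwise_equivalent_def by blast
    moreover have "evolution_eq A B v p" by (simp add: evolution_eq_lift3 p_def)
    ultimately show ?thesis by (simp add: p_def)
  qed
  obtain v where v: "v \<in> V" using V(2) by blast
  show 0: "\<alpha> = 0" "\<alpha>' = 0" using eqs[OF v, of 0] eqs[OF v, of 1] by auto
  show "Dx (f 1 2) v = f 3 1 v * f 2 2 v - f 3 2 v * f 2 1 v"
    "Dx (f 2 2) v = \<beta> * ?E v - f 1 2 v * f 3 1 v"
    "Dx (f 3 2) v = \<beta>' * ?E v - \<delta> * (f 1 2 v * f 2 1 v)" if "v \<in> V" for v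
    using eqs[OF that, of 0] unfolding 0 by simp_all
qed

text \<open>Descending induction on the common order: as long as it is n + 1 \<ge> 3, the right-hand
  sides have order n + 1 too, so the derivatives in z_(n+1) vanish. The descent ends at order 2
  because E contains z_3. The right-hand sides mix the three functions, which therefore descend
  together.\<close>

lemma coefficients_second_order:
  fixes c e N
  defines "U \<equiv> jet_box N c e"
  assumes k: "2 \<le> k" "k < N"
    and F: "smooth_on U F1" "smooth_on U F2" "smooth_on U F3"
    and dep: "depends_upto k U F1" "depends_upto k U F2" "depends_upto k U F3"
    and S: "depends_upto 2 U S2" "depends_upto 2 U S3" and E: "depends_upto 3 U E"
    and D1: "\<And>v. v \<in> U \<Longrightarrow> Dx F1 v = S3 v * F2 v - F3 v * S2 v"
    and D2: "\<And>v. v \<in> U \<Longrightarrow> Dx F2 v = \<beta> * E v - F1 v * S3 v"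
    and D3: "\<And>v. v \<in> U \<Longrightarrow> Dx F3 v = \<beta>' * E v - \<delta> * (F1 v * S2 v)"
  shows "depends_upto 2 U F1 \<and> depends_upto 2 U F2 \<and> depends_upto 2 U F3"
  using k(1)
proof (induction rule: inc_induct)
  case base
  show ?case using dep by blast
next
  case (step n)
  have U: "open U" unfolding U_def by (rule open_jet_box)
  have d: "depends_upto (Suc n) U F1" "depends_upto (Suc n) U F2" "depends_upto (Suc n) U F3"
    using step.IH by auto
  have s: "depends_upto (Suc n) U S2" "depends_upto (Suc n) U S3" "depends_upto (Suc n) U E"
    using depends_upto_mono[OF S(1)] depends_upto_mono[OF S(2)] depends_upto_mono[OF E] step.hyps by auto
  have R: "depends_upto (Suc n) U (\<lambda>v. H (F1 v) (F2 v) (F3 v) (S2 v) (S3 v) (E v))"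
    for H :: "real \<Rightarrow> real \<Rightarrow> real \<Rightarrow> real \<Rightarrow> real \<Rightarrow> real \<Rightarrow> real"
  proof (rule depends_uptoI)
    fix v w assume vw: "v \<in> U" "w \<in> U" "\<And>i. i \<le> Suc n \<Longrightarrow> v i = w i"
    have "F1 v = F1 w" "F2 v = F2 w" "F3 v = F3 w" "S2 v = S2 w" "S3 v = S3 w" "E v = E w"
      by (rule depends_upto_eq[OF d(1) vw] depends_upto_eq[OF d(2) vw] depends_upto_eq[OF d(3) vw]
          depends_upto_eq[OF s(1) vw] depends_upto_eq[OF s(2) vw] depends_upto_eq[OF s(3) vw], assumption)+
    then show "H (F1 v) (F2 v) (F3 v) (S2 v) (S3 v) (E v) = H (F1 w) (F2 w) (F3 w) (S2 w) (S3 w) (E w)"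
      by (simp only:)
  qed
  have red: "depends_upto n U F" if "depends_upto (Suc n) U F" "smooth_on U F" "depends_upto (Suc n) U R"
    "\<And>v. v \<in> U \<Longrightarrow> Dx F v = R v" for F R
  proof -
    have "pd (Suc n) F v = 0" if "v \<in> U" for v
      by (rule pd_top_eq_0[OF U \<open>depends_upto (Suc n) U F\<close> \<open>depends_upto (Suc n) U R\<close>]) (use that \<open>\<And>v. v \<in> U \<Longrightarrow> Dx F v = R v\<close> in auto)
    then show ?thesis
      using depends_upto_reduce[of n N c e F] that(1,2) step.hyps k(2) unfolding U_def by simp
  qed
  show ?case
    using red[OF d(1) F(1) R[of "\<lambda>a b c p q x. q * b - c * p"] D1]
      red[OF d(2) F(2) R[of "\<lambda>a b c p q x. \<beta> * x - a * q"] D2]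
      red[OF d(3) F(3) R[of "\<lambda>a b c p q x. \<beta>' * x - \<delta> * (a * p)"] D3] by (intro conjI)
qed

text \<open>The combination g eliminates E from the equations for f_22 and f_32, while in h its
  coefficient becomes D. The change from (f_22, f_32) to (g, h) has determinant \<pm>D and so can be
  inverted.\<close>

lemma decoupled_structure_equations:
  fixes c e N \<beta> \<beta>' \<kappa> \<kappa>' \<delta> f A B
  defines "U \<equiv> jet_box N c e" and "D \<equiv> \<beta>'\<^sup>2 - \<delta> * \<beta>\<^sup>2" and "W \<equiv> \<beta>' * \<kappa> - \<beta> * \<kappa>'"
    and "m \<equiv> (\<beta>' * \<kappa>' - \<delta> * \<beta> * \<kappa>) / (\<beta>'\<^sup>2 - \<delta> * \<beta>\<^sup>2)"
    and "E \<equiv> \<lambda>v. lift3 A v * v 3 + lift3 B v"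
  assumes D: "D \<noteq> 0" and N: "2 < N"
    and sm: "smooth_on U (f 1 2)" "smooth_on U (f 2 2)" "smooth_on U (f 3 2)"
    and dep: "depends_upto 2 U (f 1 2)" "depends_upto 2 U (f 2 2)" "depends_upto 2 U (f 3 2)"
    and f21: "\<And>v. v \<in> U \<Longrightarrow> f 2 1 v = \<beta> * v 2 + \<kappa>"
    and f31: "\<And>v. v \<in> U \<Longrightarrow> f 3 1 v = \<beta>' * v 2 + \<kappa>'"
    and D1: "\<And>v. v \<in> U \<Longrightarrow> Dx (f 1 2) v = f 3 1 v * f 2 2 v - f 3 2 v * f 2 1 v"
    and D2: "\<And>v. v \<in> U \<Longrightarrow> Dx (f 2 2) v = \<beta> * E v - f 1 2 v * f 3 1 v"
    and D3: "\<And>v. v \<in> U \<Longrightarrow> Dx (f 3 2) v = \<beta>' * E v - \<delta> * (f 1 2 v * f 2 1 v)"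
  obtains g h where "smooth_on U g" "smooth_on U h" "depends_upto 1 U (f 1 2)" "depends_upto 1 U g"
    "depends_upto 2 U h"
    "\<And>v. v \<in> U \<Longrightarrow> f 2 2 v = (\<beta>' * g v + \<beta> * h v) / D"
    "\<And>v. v \<in> U \<Longrightarrow> f 3 2 v = (\<delta> * \<beta> * g v + \<beta>' * h v) / D"
    "\<And>v. v \<in> U \<Longrightarrow> Dx (f 1 2) v = g v * (v 2 + m) - W / D * h v"
    "\<And>v. v \<in> U \<Longrightarrow> Dx g v = - D * f 1 2 v * (v 2 + m)"
    "\<And>v. v \<in> U \<Longrightarrow> Dx h v = D * E v - \<delta> * W * f 1 2 v"
proof -
  have U: "open U" unfolding U_def by (rule open_jet_box)
  define g h where "g = (\<lambda>v. \<beta>' * f 2 2 v + (- \<beta>) * f 3 2 v)"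
    and "h = (\<lambda>v. \<beta>' * f 3 2 v + (- \<delta> * \<beta>) * f 2 2 v)"
  have sg: "smooth_on U g" unfolding g_def by (intro smooth_on_add smooth_on_cmult sm U)
  have sh: "smooth_on U h" unfolding h_def by (intro smooth_on_add smooth_on_cmult sm U)
  have lin: "depends_upto 2 U (\<lambda>v. a * F v + b * G v)"
    if "depends_upto 2 U F" "depends_upto 2 U G" for F G a b
  proof (rule depends_uptoI)
    fix v w assume vw: "v \<in> U" "w \<in> U" "\<And>i. i \<le> 2 \<Longrightarrow> v i = w i"
    have "F v = F w" "G v = G w"
      by (rule depends_upto_eq[OF that(1) vw] depends_upto_eq[OF that(2) vw], assumption)+
    then show "a * F v + b * G v = a * F w + b * G w" by simp
  qed
  have dg: "depends_upto 2 U g" unfolding g_def by (rule lin[OF dep(2,3)])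
  have dh: "depends_upto 2 U h" unfolding h_def by (rule lin[OF dep(3,2)])
  \<comment> \<open>The same two combinations of f_31 and f_21: one is a multiple of z_2 + m, which
    is the reason for the choice of m, the other is the constant W.\<close>
  have S: "\<beta>' * f 3 1 v - \<delta> * \<beta> * f 2 1 v = D * (v 2 + m)" "\<beta>' * f 2 1 v - \<beta> * f 3 1 v = W" if "v \<in> U" for v
  proof -
    have "D * m = \<beta>' * \<kappa>' - \<delta> * \<beta> * \<kappa>" using D by (simp add: m_def D_def)
    then show "\<beta>' * f 3 1 v - \<delta> * \<beta> * f 2 1 v = D * (v 2 + m)"
      unfolding f21[OF that] f31[OF that] distrib_left by (simp add: D_def algebra_simps power2_eq_square)
    show "\<beta>' * f 2 1 v - \<beta> * f 3 1 v = W"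
      unfolding f21[OF that] f31[OF that] W_def by (simp add: algebra_simps)
  qed
  have f22: "f 2 2 v = (\<beta>' * g v + \<beta> * h v) / D" for v
  proof -
    have "\<beta>' * g v + \<beta> * h v = D * f 2 2 v" by (simp add: g_def h_def D_def algebra_simps power2_eq_square)
    then show ?thesis using D by simp
  qed
  have f32: "f 3 2 v = (\<delta> * \<beta> * g v + \<beta>' * h v) / D" for v
  proof -
    have "\<delta> * \<beta> * g v + \<beta>' * h v = D * f 3 2 v" by (simp add: g_def h_def D_def algebra_simps power2_eq_square)
    then show ?thesis using D by simp
  qed
  have Dl: "Dx (f 1 2) v = g v * (v 2 + m) - W / D * h v" if v: "v \<in> U" for v
  proof -
    have "D * (f 3 1 v * f 2 2 v - f 3 2 v * f 2 1 v) =
        f 3 1 v * (\<beta>' * g v + \<beta> * h v) - (\<delta> * \<beta> * g v + \<beta>' * h v) * f 2 1 v"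
      unfolding f22 f32 using D by (simp add: field_simps)
    also have "\<dots> = g v * (\<beta>' * f 3 1 v - \<delta> * \<beta> * f 2 1 v) - (\<beta>' * f 2 1 v - \<beta> * f 3 1 v) * h v"
      by (simp add: algebra_simps)
    also have "\<dots> = D * (g v * (v 2 + m) - W / D * h v)" unfolding S[OF v] using D by (simp add: field_simps)
    finally show ?thesis unfolding D1[OF v] using D by simp
  qed
  have Dg: "Dx g v = - D * f 1 2 v * (v 2 + m)" if v: "v \<in> U" for v
  proof -
    have "Dx g v = \<beta>' * Dx (f 2 2) v + (- \<beta>) * Dx (f 3 2) v"
      unfolding g_def by (rule Dx_linear[OF U v sm(2,3) dep(2,3)])
    also have "\<dots> = - f 1 2 v * (\<beta>' * f 3 1 v - \<delta> * \<beta> * f 2 1 v)"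
      unfolding D2[OF v] D3[OF v] by (simp add: algebra_simps)
    finally show ?thesis unfolding S[OF v] by simp
  qed
  have Dh: "Dx h v = D * E v - \<delta> * W * f 1 2 v" if v: "v \<in> U" for v
  proof -
    have "Dx h v = \<beta>' * Dx (f 3 2) v + (- \<delta> * \<beta>) * Dx (f 2 2) v"
      unfolding h_def by (rule Dx_linear[OF U v sm(3,2) dep(3,2)])
    also have "\<dots> = D * E v - \<delta> * (\<beta>' * f 2 1 v - \<beta> * f 3 1 v) * f 1 2 v"
      unfolding D2[OF v] D3[OF v] D_def by (simp add: algebra_simps power2_eq_square)
    finally show ?thesis unfolding S[OF v] .
  qed
  \<comment> \<open>The right-hand sides for f_12 and g contain no z_3, which lowers their order
    from 2 to 1. The equation for h contains z_3 through E, and h stays of order 2.\<close>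
  have first_order: "depends_upto 1 U F" if F: "smooth_on U F" "depends_upto 2 U F"
    and R: "depends_upto 2 U R" "\<And>v. v \<in> U \<Longrightarrow> Dx F v = R v" for F R
  proof -
    have "pd 2 F v = 0" if "v \<in> U" for v by (rule pd_top_eq_0[OF U F(2) R that])
    then show ?thesis
      using depends_upto_reduce[of 1 N c e F] F N unfolding U_def by (simp add: numeral_2_eq_2)
  qed
  have "depends_upto 2 U (\<lambda>v. g v * (v 2 + m) - W / D * h v)"
  proof (rule depends_uptoI)
    fix v w assume vw: "v \<in> U" "w \<in> U" "\<And>i. i \<le> 2 \<Longrightarrow> v i = w i"
    have "g v = g w" "h v = h w"
      by (rule depends_upto_eq[OF dg vw] depends_upto_eq[OF dh vw], assumption)+
    then show "g v * (v 2 + m) - W / D * h v = g w * (w 2 + m) - W / D * h w" using vw(3)[of 2] by simp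
  qed
  from first_order[OF sm(1) dep(1) this Dl] have l1: "depends_upto 1 U (f 1 2)" .
  have "depends_upto 2 U (\<lambda>v. - D * f 1 2 v * (v 2 + m))"
  proof (rule depends_uptoI)
    fix v w assume vw: "v \<in> U" "w \<in> U" "\<And>i. i \<le> 2 \<Longrightarrow> v i = w i"
    have "f 1 2 v = f 1 2 w"
      by (rule depends_upto_eq[OF dep(1) vw])
    then show "- D * f 1 2 v * (v 2 + m) = - D * f 1 2 w * (w 2 + m)" using vw(3)[of 2] by simp
  qed
  from first_order[OF sg dg this Dg] have g1: "depends_upto 1 U g" .
  show ?thesis by (rule that[OF sg sh l1 g1 dh f22 f32 Dl Dg Dh])
qed

section \<open>The case W = 0, leading to form (I)\<close>

lemma travelling_coefficient_zero:
  assumes V: "open V" "V \<noteq> {}" and l: "smooth_on V l" and g: "smooth_on V g" and D: "D \<noteq> 0"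
    and g1: "\<And>v. v \<in> V \<Longrightarrow> pd 1 g v = - D * l v" and g0: "\<And>v. v \<in> V \<Longrightarrow> v 1 * pd 0 g v = - D * l v * m"
    and l1: "\<And>v. v \<in> V \<Longrightarrow> pd 1 l v = g v" and l0: "\<And>v. v \<in> V \<Longrightarrow> v 1 * pd 0 l v = g v * m"
    and l_nz: "\<And>v. v \<in> V \<Longrightarrow> l v \<noteq> 0" and z1: "\<And>v. v \<in> V \<Longrightarrow> v 1 \<noteq> 0"
  shows "m = 0" "\<And>v. v \<in> V \<Longrightarrow> pd 0 g v = 0"
proof -
  have mg: "m * g v = 0" if v: "v \<in> V" for v
  proof -
    \<comment> \<open>Differentiating z_1 l_z = m g in z_1, with the mixed derivative of l replaced
      by g_z, gives l_z + z_1 g_z = m g_z1. Both z_1 g_z and m g_z1 equal -m D l. Hence l_z = 0, and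
      then m g = 0.\<close>
    have "((\<lambda>s. (v(1 := s)) 1 * pd 0 l (v(1 := s))) has_field_derivative
        1 * pd 0 l v + pd 1 (pd 0 l) v * v 1) (at (v 1))"
      using DERIV_mult[OF DERIV_ident[of "at (v 1)"] smooth_on_has_pd[OF smooth_on_pd[OF l, of 0] v, of 1]] by simp
    then have "pd 1 (\<lambda>u. u 1 * pd 0 l u) v = pd 0 l v + pd 1 (pd 0 l) v * v 1"
      by (intro pd_eqI) simp
    moreover have "pd 1 (\<lambda>u. u 1 * pd 0 l u) v = pd 1 (\<lambda>u. g u * m) v"
      by (rule pd_cong_open[OF V(1) v l0])
    moreover have "pd 1 (\<lambda>u. g u * m) v = pd 1 g v * m"
      by (rule pd_eqI[OF DERIV_cmult_right[OF smooth_on_has_pd[OF g v]]])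
    moreover have "pd 1 (pd 0 l) v = pd 0 g v"
      unfolding pd_commute[OF V(1) l v, of 1 0] by (rule pd_cong_open[OF V(1) v l1])
    ultimately have "pd 0 l v = 0" using g0[OF v] g1[OF v] by (simp add: mult.commute)
    then show ?thesis using l0[OF v] by (simp add: mult.commute)
  qed
  show m: "m = 0"
  proof (rule ccontr)
    assume "m \<noteq> 0"
    \<comment> \<open>With g identically 0, its z_1-derivative -D l would vanish too, although l has
      no zeros.\<close>
    then have g_0: "g v = 0" if "v \<in> V" for v using mg[OF that] by simp
    obtain v where v: "v \<in> V" using V(2) by blast
    have "pd 1 g v = pd 1 (\<lambda>_. 0) v" by (rule pd_cong_open[OF V(1) v g_0])
    then show False using g1[OF v] l_nz[OF v] D by (simp add: pd_def)
  qed
  show "pd 0 g v = 0" if "v \<in> V" for v using g0[OF that] z1[OF that] m by simp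
qed

text \<open>With u = g / D and w = -f_12 as functions of z_1, the equations read u' = w and w' = -D
  u, where D = r^2 - \<delta> for r = \<open>\<beta>'\<close>. So u is phi, h / D is the flux, and
  \<epsilon> = 1 because \<open>\<beta>'\<close> carries its own sign.\<close>

lemma classification_form_I:
  fixes c e N \<beta>' \<delta> f A B
  defines "U \<equiv> jet_box N c e" and "D \<equiv> \<beta>'\<^sup>2 - \<delta>"
  assumes e: "e > 0" and N: "2 < N" and D: "D \<noteq> 0"
    and AB: "\<And>v. v \<in> U \<Longrightarrow> (lift3 A v)\<^sup>2 + (lift3 B v)\<^sup>2 \<noteq> 0"
    and l: "smooth_on U l" "depends_upto 1 U l" and g: "smooth_on U g" "depends_upto 1 U g"
    and h: "smooth_on U h" "depends_upto 2 U h"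
    and f: "\<And>v. v \<in> U \<Longrightarrow> f 1 1 v = 0" "\<And>v. v \<in> U \<Longrightarrow> f 1 2 v = l v"
      "\<And>v. v \<in> U \<Longrightarrow> f 2 1 v = v 2" "\<And>v. v \<in> U \<Longrightarrow> f 2 2 v = (\<beta>' * g v + h v) / D"
      "\<And>v. v \<in> U \<Longrightarrow> f 3 1 v = \<beta>' * v 2" "\<And>v. v \<in> U \<Longrightarrow> f 3 2 v = (\<delta> * g v + \<beta>' * h v) / D"
    and g1: "\<And>v. v \<in> U \<Longrightarrow> pd 1 g v = - D * l v" and g0: "\<And>v. v \<in> U \<Longrightarrow> pd 0 g v = 0"
    and l1: "\<And>v. v \<in> U \<Longrightarrow> pd 1 l v = g v" and l_nz: "\<And>v. v \<in> U \<Longrightarrow> l v \<noteq> 0"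
    and Dh: "\<And>v. v \<in> U \<Longrightarrow> Dx h v = D * (lift3 A v * v 3 + lift3 B v)"
  shows "form_I \<delta> U A B f"
proof -
  have U: "open U" unfolding U_def by (rule open_jet_box)
  have cU: "c \<in> U" unfolding U_def by (rule centre_in_jet_box[OF e])
  have c1: "c(1 := y) \<in> U" if "\<bar>y - c 1\<bar> < e" for y
    unfolding U_def by (rule jet_box_update[OF centre_in_jet_box[OF e]]) (rule that)
  have y: "\<bar>v i - c i\<bar> < e" if "v \<in> U" "i < N" for v i using that by (simp add: U_def jet_box_def)
  have only_z1: "g v = g (c(1 := v 1))" if v: "v \<in> U" for v
  proof -
    have v0: "v(0 := x) \<in> U" if "\<bar>x - c 0\<bar> < e" for x
      using v unfolding U_def by (rule jet_box_update) (rule that)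
    have "g (v(0 := v 0)) = g (v(0 := c 0))"
    proof (rule has_derivative_0_constant_interval[where f = "\<lambda>s. g (v(0 := s))" and c = "c 0" and e = e])
      show "((\<lambda>s. g (v(0 := s))) has_field_derivative 0) (at s)" if "\<bar>s - c 0\<bar> < e" for s
        using smooth_on_has_pd[OF g(1) v0[OF that], of 0]
        unfolding g0[OF v0[OF that]] fun_upd_upd fun_upd_same .
    qed (use y[OF v, of 0] N e in auto)
    also have "\<dots> = g (c(1 := v 1))"
      by (rule depends_upto_eq[OF g(2) v0 c1]) (use y[OF v, of 1] N e in \<open>auto simp: le_Suc_eq\<close>)
    finally show ?thesis by simp
  qed
  define u where "u = (\<lambda>y. g (c(1 := y)) / D)"
  define w where "w = (\<lambda>y. - l (c(1 := y)))"
  have du: "(u has_field_derivative w s) (at s)" if "\<bar>s - c 1\<bar> < e" for s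
  proof -
    have "((\<lambda>y. g (c(1 := y))) has_field_derivative - D * l (c(1 := s))) (at s)"
      using smooth_on_has_pd[OF g(1) c1[OF that], of 1]
      unfolding g1[OF c1[OF that]] fun_upd_upd fun_upd_same .
    from DERIV_cdivide[OF this, of D] show ?thesis using D by (simp add: u_def w_def)
  qed
  have dw: "(w has_field_derivative - D * u s) (at s)" if "\<bar>s - c 1\<bar> < e" for s
  proof -
    have "((\<lambda>y. l (c(1 := y))) has_field_derivative g (c(1 := s))) (at s)"
      using smooth_on_has_pd[OF l(1) c1[OF that], of 1]
      unfolding l1[OF c1[OF that]] fun_upd_upd fun_upd_same .
    from DERIV_minus[OF this] show ?thesis using D by (simp add: u_def w_def)
  qed
  obtain a b where ab: "\<And>s. \<bar>s - c 1\<bar> < e \<Longrightarrow> u s = oscillation D a b s \<and> w s = oscillation' D a b s"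
    using oscillator_solution[OF D e du dw] by blast
  have gv: "g v = D * oscillation D a b (v 1)" if "v \<in> U" for v
  proof -
    have "u (v 1) = oscillation D a b (v 1)" using ab[OF y[OF that, of 1]] N by simp
    moreover have "g v = D * u (v 1)" unfolding u_def using only_z1[OF that] D by simp
    ultimately show ?thesis by simp
  qed
  \<comment> \<open>The oscillator lemma describes l only on the z_1-line through c. Off that line
    the formula follows by differentiating the one for g, which holds on all of U.\<close>
  have lv: "l v = - oscillation' D a b (v 1)" if v: "v \<in> U" for v
  proof -
    have "pd 1 g v = pd 1 (\<lambda>v. D * oscillation D a b (v 1)) v" by (rule pd_cong_open[OF U v gv])
    also have "\<dots> = D * oscillation' D a b (v 1)"
      by (rule pd_eqI) (simp add: DERIV_cmult[OF oscillation_deriv])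
    finally have "D * (l v + oscillation' D a b (v 1)) = 0" using g1[OF v] by (simp add: distrib_left)
    then show ?thesis using D by simp
  qed
  \<comment> \<open>The remaining components are taken from the centre c, so that the jet lies in
    the box.\<close>
  define \<psi> where "\<psi> = (\<lambda>x y z. h (c(0 := x, 1 := y, 2 := z)) / D)"
  have \<psi>: "lift3 \<psi> v = h v / D" if v: "v \<in> U" for v
  proof -
    have "h (c(0 := v 0, 1 := v 1, 2 := v 2)) = h v"
    proof (rule depends_upto_eq[OF h(2) _ v])
      show "c(0 := v 0, 1 := v 1, 2 := v 2) \<in> U"
        unfolding U_def
        by (intro jet_box_update centre_in_jet_box[OF e]) (use y[OF v] in auto)
      show "(c(0 := v 0, 1 := v 1, 2 := v 2)) i = v i" if "i \<le> 2" for i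
        using that by (auto simp: le_Suc_eq numeral_2_eq_2)
    qed
    then show ?thesis by (simp add: lift3_def \<psi>_def)
  qed
  have s\<psi>: "smooth_on U (lift3 \<psi>)"
    by (rule smooth_on_cong[OF U smooth_on_divide_const[OF U h(1)] \<psi>])
  have E: "lift3 A v * v 3 + lift3 B v = Dx (lift3 \<psi>) v" if v: "v \<in> U" for v
  proof -
    have "Dx (lift3 \<psi>) v = Dx (\<lambda>u. (1 / D) * h u) v"
      by (rule Dx_cong_open[OF U v]) (simp add: \<psi>)
    also have "\<dots> = (1 / D) * Dx h v" by (rule Dx_cmult[OF U v h])
    finally show ?thesis unfolding Dh[OF v] using D by simp
  qed
  have nc: "\<not> lift3 \<psi> constant_on U" by (rule flux_not_constant[OF U _ AB E]) (use cU in auto)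
  have "a\<^sup>2 + b\<^sup>2 \<noteq> 0"
  proof
    assume "a\<^sup>2 + b\<^sup>2 = 0"
    then have "a = 0" "b = 0" by (simp_all add: sum_power2_eq_zero_iff)
    then have "oscillation' D a b (c 1) = 0" by (cases "D > 0") (simp_all add: oscillation'_def)
    then show False using lv[OF cU] l_nz[OF cU] by simp
  qed
  have D': "\<beta>'\<^sup>2 - \<delta> = D" by (simp add: D_def)
  have f22: "f 2 2 v = lift3 \<psi> v + 1 * \<beta>' * oscillation D a b (v 1)" if "v \<in> U" for v
    unfolding f(4)[OF that] \<psi>[OF that] gv[OF that] using D by (simp add: add_divide_distrib)
  have f32: "f 3 2 v = 1 * \<beta>' * lift3 \<psi> v + \<delta> * oscillation D a b (v 1)" if "v \<in> U" for v
    unfolding f(6)[OF that] \<psi>[OF that] gv[OF that] using D by (simp add: add_divide_distrib)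
  show ?thesis
    unfolding form_I_iff
  proof (rule exI[of _ 1], rule exI[of _ \<beta>'], rule exI[of _ \<psi>], rule exI[of _ a], rule exI[of _ b],
      intro conjI ballI s\<psi> nc)
    show "\<beta>'\<^sup>2 \<noteq> \<delta>" using D by (simp add: D_def)
    show "a\<^sup>2 + b\<^sup>2 \<noteq> 0" by fact
    fix v assume v: "v \<in> U"
    show "lift3 A v * v 3 + lift3 B v = Dx (lift3 \<psi>) v" by (rule E[OF v])
    show "f 1 1 v = 0" "f 2 1 v = v 2" by (rule f v)+
    show "f 1 2 v = - oscillation' (\<beta>'\<^sup>2 - \<delta>) a b (v 1)" unfolding f(2)[OF v] D' by (rule lv[OF v])
    show "f 2 2 v = lift3 \<psi> v + 1 * \<beta>' * oscillation (\<beta>'\<^sup>2 - \<delta>) a b (v 1)" unfolding D' by (rule f22[OF v])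
    show "f 3 1 v = 1 * \<beta>' * v 2" unfolding f(5)[OF v] by simp
    show "f 3 2 v = 1 * \<beta>' * lift3 \<psi> v + \<delta> * oscillation (\<beta>'\<^sup>2 - \<delta>) a b (v 1)" unfolding D' by (rule f32[OF v])
  qed simp
qed

section \<open>The case of nonzero W, leading to form (II)\<close>

lemma sqrt_near:
  assumes "\<bar>x - y\<^sup>2\<bar> < \<bar>y\<bar> * r" "r \<le> \<bar>y\<bar>"
  shows "x > 0" "\<bar>sqrt x - \<bar>y\<bar>\<bar> < r"
proof -
  have "\<bar>y\<bar> * r \<le> \<bar>y\<bar> * \<bar>y\<bar>" using assms(2) by (rule mult_left_mono) simp
  then have "\<bar>y\<bar> * r \<le> y\<^sup>2" by (simp add: power2_eq_square)
  then show x: "x > 0" using assms(1) by (simp add: abs_if split: if_splits)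
  have y: "\<bar>y\<bar> > 0" using assms(1) by (cases "y = 0") auto
  \<comment> \<open>Factoring x - y^2 and dropping sqrt x from the second factor bounds the first
    factor by |x - y^2| / |y|.\<close>
  have "(sqrt x - \<bar>y\<bar>) * (sqrt x + \<bar>y\<bar>) = x - y\<^sup>2"
    using x by (simp add: algebra_simps power2_eq_square)
  then have "\<bar>sqrt x - \<bar>y\<bar>\<bar> * (sqrt x + \<bar>y\<bar>) = \<bar>x - y\<^sup>2\<bar>"
    using x by (metis abs_mult abs_of_nonneg abs_ge_zero add_nonneg_nonneg less_imp_le real_sqrt_ge_zero)
  moreover have "\<bar>sqrt x - \<bar>y\<bar>\<bar> * \<bar>y\<bar> \<le> \<bar>sqrt x - \<bar>y\<bar>\<bar> * (sqrt x + \<bar>y\<bar>)"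
    by (rule mult_left_mono) (use x in auto)
  ultimately have "\<bar>sqrt x - \<bar>y\<bar>\<bar> * \<bar>y\<bar> < r * \<bar>y\<bar>" using assms(1) by (simp add: mult.commute)
  then show "\<bar>sqrt x - \<bar>y\<bar>\<bar> < r" using y by simp
qed

text \<open>The equation for \<open>g\<close> says that \<open>g\<close> is constant along the curves \<open>2 m z + z\<^sub>1\<^sup>2 = const\<close>.\<close>

lemma function_of_phi_arg:
  fixes c e N
  defines "U \<equiv> jet_box N c e"
  assumes e: "e > 0" "e \<le> \<bar>c 1\<bar>" and N: "1 < N"
    and g: "smooth_on U g" "depends_upto 1 U g"
    and char: "\<And>v. v \<in> U \<Longrightarrow> v 1 * pd 0 g v = m * pd 1 g v"
  obtains V I G where "open V" "c \<in> V" "V \<subseteq> U" "open I" "smooth_on {w. w 0 \<in> I} (lift1 G)"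
    "\<And>v. v \<in> V \<Longrightarrow> 2 * m * v 0 + (v 1)\<^sup>2 \<in> I" "\<And>v. v \<in> V \<Longrightarrow> g v = phi_arg m G v"
proof -
  \<comment> \<open>The sign of z_1, which is constant on the box because e \<le> |c 1|; it selects
    the branch of the square root.\<close>
  define \<sigma> where "\<sigma> = sgn (c 1)"
  have c1: "c 1 = \<sigma> * \<bar>c 1\<bar>" by (simp add: \<sigma>_def sgn_mult_abs)
  have c1_nz: "c 1 \<noteq> 0" using e by auto
  have \<sigma>: "\<sigma> * \<sigma> = 1" "\<bar>\<sigma>\<bar> = 1" using c1_nz by (auto simp: \<sigma>_def sgn_if)
  define s0 where "s0 = 2 * m * c 0 + (c 1)\<^sup>2"
  \<comment> \<open>With |z - c 0| < d and |s - s0| < d, the number s - 2 m z differs from (c 1)^2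
    by less than d (1 + 2 |m|) \<le> |c 1| e, the bound that \<open>sqrt_near\<close> asks
    for.\<close>
  define d where "d = min e (\<bar>c 1\<bar> * e / (1 + 2 * \<bar>m\<bar>))"
  have d: "d > 0" "d \<le> e" using e c1_nz by (auto simp: d_def)
  have d': "d * (1 + 2 * \<bar>m\<bar>) \<le> \<bar>c 1\<bar> * e"
  proof -
    have "d \<le> \<bar>c 1\<bar> * e / (1 + 2 * \<bar>m\<bar>)" by (simp add: d_def)
    then show ?thesis by (subst (asm) pos_le_divide_eq) auto
  qed
  \<comment> \<open>The z_1-coordinate of the point with z = \<tau> on the curve with parameter
    s.\<close>
  define \<zeta> where "\<zeta> = (\<lambda>\<tau> s. \<sigma> * sqrt (s - 2 * m * \<tau>))"
  have \<zeta>: "s - 2 * m * \<tau> > 0" "\<bar>\<zeta> \<tau> s - c 1\<bar> < e" if "\<bar>\<tau> - c 0\<bar> < d" "\<bar>s - s0\<bar> < d" for \<tau> s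
  proof -
    have "\<bar>s - 2 * m * \<tau> - (c 1)\<^sup>2\<bar> = \<bar>(s - s0) - 2 * m * (\<tau> - c 0)\<bar>"
      by (simp add: s0_def algebra_simps)
    also have "\<dots> \<le> \<bar>s - s0\<bar> + 2 * \<bar>m\<bar> * \<bar>\<tau> - c 0\<bar>"
      using abs_triangle_ineq4[of "s - s0" "2 * m * (\<tau> - c 0)"] by (simp add: abs_mult)
    also have "\<dots> < d + 2 * \<bar>m\<bar> * d"
      by (rule add_less_le_mono[OF that(2)]) (use that(1) in \<open>auto intro: mult_left_mono\<close>)
    also have "\<dots> \<le> \<bar>c 1\<bar> * e" using d' by (simp add: algebra_simps)
    finally have *: "\<bar>s - 2 * m * \<tau> - (c 1)\<^sup>2\<bar> < \<bar>c 1\<bar> * e" .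
    show "s - 2 * m * \<tau> > 0" by (rule sqrt_near[OF * e(2)])
    have "\<zeta> \<tau> s - c 1 = \<sigma> * (sqrt (s - 2 * m * \<tau>) - \<bar>c 1\<bar>)"
      using c1 by (simp add: \<zeta>_def right_diff_distrib)
    then show "\<bar>\<zeta> \<tau> s - c 1\<bar> < e"
      using sqrt_near(2)[OF * e(2)] \<sigma>(2) by (simp add: abs_mult)
  qed
  \<comment> \<open>For a point of this set the whole arc of its curve between z = v 0 and z = c 0
    stays in U.\<close>
  define V where "V = {v \<in> U. \<bar>v 0 - c 0\<bar> < d \<and> \<bar>2 * m * v 0 + (v 1)\<^sup>2 - s0\<bar> < d}"
  define I where "I = {s. \<bar>s - s0\<bar> < d}"
  define J where "J = {y. \<bar>y - c 1\<bar> < e}"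
  have oI: "open I" "open J" unfolding I_def J_def by (intro open_Collect_less continuous_intros)+
  have "J = {c 1 - e<..<c 1 + e}" by (auto simp: J_def)
  then have J: "convex {y. \<bar>y - c 1\<bar> < e}" unfolding J_def by simp
  have U: "open U" unfolding U_def by (rule open_jet_box)
  have "open {v :: jet. \<bar>v 0 - c 0\<bar> < d}" "open {v :: jet. \<bar>2 * m * v 0 + (v 1)\<^sup>2 - s0\<bar> < d}"
    by (intro open_Collect_less continuous_intros continuous_on_jet_coord)+
  then have V: "open V" unfolding V_def using U
    by (simp add: Collect_conj_eq open_Int)
  have cV: "c \<in> V" using centre_in_jet_box[OF e(1)] d by (simp add: V_def U_def s0_def)
  \<comment> \<open>The value of g where the curve with parameter s meets the line z = c 0.\<close>
  define G where "G = (\<lambda>s. g (c(1 := \<zeta> (c 0) s)))"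
  have pU: "c(0 := \<tau>, 1 := y) \<in> U" if "\<bar>\<tau> - c 0\<bar> < e" "\<bar>y - c 1\<bar> < e" for \<tau> y
    unfolding U_def by (intro jet_box_update centre_in_jet_box e) (use that in auto)
  have smG: "smooth_on {w. w 0 \<in> I} (lift1 G)"
  proof -
    have oI': "open {w :: jet. w 0 \<in> I}" by (rule open_coord_vimage[OF oI(1)])
    have "smooth_on {w. w 0 \<in> I} (\<lambda>w. \<sigma> * (w 0 - 2 * m * c 0) powr (1 / 2))"
    proof (rule smooth_on_compose1[OF oI' open_greaterThan smooth_lift1_powr])
      show "smooth_on {w. w 0 \<in> I} (\<lambda>w. w 0 - 2 * m * c 0)"
        by (intro smooth_on_diff smooth_on_coord smooth_on_const oI')
      show "(\<lambda>w. w 0 - 2 * m * c 0) ` {w. w 0 \<in> I} \<subseteq> {0<..}"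
        using \<zeta>(1)[of "c 0"] d by (auto simp: I_def)
    qed
    then have s\<zeta>: "smooth_on {w. w 0 \<in> I} (\<lambda>w. \<zeta> (c 0) (w 0))"
      by (rule smooth_on_cong[OF oI']) (use \<zeta>(1)[of "c 0"] d in \<open>auto simp: \<zeta>_def I_def powr_half_sqrt less_imp_le\<close>)
    have "smooth_on {w. w 0 \<in> J} (lift1 (\<lambda>y. g (c(1 := y))))"
      by (rule smooth_lift1_slice[OF oI(2) g(1)])
         (use e in \<open>auto simp: U_def J_def intro!: jet_box_update centre_in_jet_box\<close>)
    from smooth_on_compose1[OF oI' oI(2) this s\<zeta>] show ?thesis
      using \<zeta>(2)[of "c 0"] d by (auto simp: lift1_def[abs_def] G_def J_def I_def)
  qed
  have gG: "g v = phi_arg m G v" if v: "v \<in> V" for v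
  proof -
    define s where "s = 2 * m * v 0 + (v 1)\<^sup>2"
    have s: "\<bar>s - s0\<bar> < d" and v0: "\<bar>v 0 - c 0\<bar> < d" and vU: "v \<in> U" using v by (auto simp: V_def s_def)
    have v1: "\<bar>v 1 - c 1\<bar> < e" using vU N by (simp add: U_def jet_box_def)
    have "\<zeta> (v 0) s = v 1"
    proof -
      have "v 1 = \<sigma> * \<bar>v 1\<bar>" using v1 e by (cases "c 1 > 0") (auto simp: \<sigma>_def)
      then show ?thesis by (simp add: \<zeta>_def s_def)
    qed
    let ?w = "\<lambda>\<tau>. c(0 := \<tau>, 1 := \<zeta> \<tau> s)"
    have "g (?w (v 0)) = g (?w (c 0))"
    proof (rule has_derivative_0_constant_interval[where f = "\<lambda>\<tau>. g (?w \<tau>)" and c = "c 0" and e = d])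
      fix \<tau> assume \<tau>: "\<bar>\<tau> - c 0\<bar> < d"
      note z = \<zeta>[OF \<tau> s]
      have \<zeta>_nz: "\<zeta> \<tau> s \<noteq> 0" using z(1) \<sigma> by (auto simp: \<zeta>_def)
      have "((\<lambda>\<tau>. \<zeta> \<tau> s) has_field_derivative - m / \<zeta> \<tau> s) (at \<tau>)"
      proof -
        have "((\<lambda>\<tau>. \<zeta> \<tau> s) has_field_derivative \<sigma> * (- (2 * m) * (inverse (sqrt (s - 2 * m * \<tau>)) / 2))) (at \<tau>)"
          unfolding \<zeta>_def using z(1) by (auto intro!: derivative_eq_intros)
        moreover have "\<sigma> * (- (2 * m) * (inverse (sqrt (s - 2 * m * \<tau>)) / 2)) = - m / \<zeta> \<tau> s"
          using z(1) \<sigma>(1) \<zeta>_nz unfolding \<zeta>_def by (auto simp: field_simps)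
        ultimately show ?thesis by simp
      qed
      \<comment> \<open>Along the curve z_1 has derivative -m / z_1 with respect to z, so the
        equation z_1 g_z = m g_z1 says precisely that the derivative of g is 0.\<close>
      then have "((\<lambda>\<tau>. g (?w \<tau>)) has_field_derivative
          pd 0 g (?w \<tau>) + pd 1 g (?w \<tau>) * (- m / \<zeta> \<tau> s)) (at \<tau>)"
        by (intro chain_rule_two_coordinates[OF g(1), where X = "{x. \<bar>x - c 0\<bar> < e}" and Y = "J"])
           (use pU \<tau> z d oI(2) J in \<open>auto simp: J_def intro!: open_Collect_less continuous_intros\<close>)
      moreover have "pd 0 g (?w \<tau>) + pd 1 g (?w \<tau>) * (- m / \<zeta> \<tau> s) = 0"
        using char[of "?w \<tau>"] pU[of \<tau> "\<zeta> \<tau> s"] \<tau> z d \<zeta>_nz by (simp add: field_simps)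
      ultimately show "((\<lambda>\<tau>. g (?w \<tau>)) has_field_derivative 0) (at \<tau>)" by simp
    qed (use v0 d in auto)
    moreover have "g (?w (v 0)) = g v"
      by (rule depends_upto_eq[OF g(2) pU vU]) (use v0 v1 d \<open>\<zeta> (v 0) s = v 1\<close> in \<open>auto simp: le_Suc_eq\<close>)
    ultimately show ?thesis unfolding phi_arg_def G_def s_def[symmetric] by simp
  qed
  show ?thesis
  proof (rule that[OF V cV _ oI(1) smG])
    show "V \<subseteq> U" by (auto simp: V_def)
    show "2 * m * v 0 + (v 1)\<^sup>2 \<in> I" if "v \<in> V" for v using that by (simp add: V_def I_def)
  qed (rule gG)
qed

text \<open>Comparing f_21 = \<beta> z_2 + \<kappa> and f_31 with their shape in form (II) gives the
  linear relations \<kappa> = \<beta> m - r \<open>\<beta>'\<close> and \<open>\<kappa>'\<close> =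
  \<open>\<beta>'\<close> m - \<delta> r \<beta>. Their determinant is D up to sign, and solving
  them yields m and r = -W / D.\<close>

lemma classification_form_II:
  fixes c e N \<beta> \<beta>' \<kappa> \<kappa>' \<delta> f A B
  defines "U \<equiv> jet_box N c e" and "D \<equiv> \<beta>'\<^sup>2 - \<delta> * \<beta>\<^sup>2" and "W \<equiv> \<beta>' * \<kappa> - \<beta> * \<kappa>'"
    and "m \<equiv> (\<beta>' * \<kappa>' - \<delta> * \<beta> * \<kappa>) / (\<beta>'\<^sup>2 - \<delta> * \<beta>\<^sup>2)"
    and "E \<equiv> \<lambda>v. lift3 A v * v 3 + lift3 B v"
  assumes e: "e > 0" "e \<le> \<bar>c 1\<bar>" and N: "2 < N" and D: "D \<noteq> 0" and W: "W \<noteq> 0"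
    and l: "smooth_on U l" "depends_upto 1 U l" and g: "smooth_on U g" "depends_upto 1 U g"
    and f11: "\<And>v. v \<in> U \<Longrightarrow> f 1 1 v = 0" and f12: "\<And>v. v \<in> U \<Longrightarrow> f 1 2 v = l v"
    and f21: "\<And>v. v \<in> U \<Longrightarrow> f 2 1 v = \<beta> * v 2 + \<kappa>"
    and f22: "\<And>v. v \<in> U \<Longrightarrow> f 2 2 v = (\<beta>' * g v + \<beta> * h v) / D"
    and f31: "\<And>v. v \<in> U \<Longrightarrow> f 3 1 v = \<beta>' * v 2 + \<kappa>'"
    and f32: "\<And>v. v \<in> U \<Longrightarrow> f 3 2 v = (\<delta> * \<beta> * g v + \<beta>' * h v) / D"
    and g1: "\<And>v. v \<in> U \<Longrightarrow> pd 1 g v = - D * l v" and g0: "\<And>v. v \<in> U \<Longrightarrow> v 1 * pd 0 g v = - D * l v * m"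
    and l_nz: "\<And>v. v \<in> U \<Longrightarrow> l v \<noteq> 0"
    and Dl: "\<And>v. v \<in> U \<Longrightarrow> Dx l v = g v * (v 2 + m) - W / D * h v"
    and Dh: "\<And>v. v \<in> U \<Longrightarrow> Dx h v = D * E v - \<delta> * W * l v"
  obtains V where "open V" "V \<noteq> {}" "V \<subseteq> U" "form_II \<delta> V A B f"
proof -
  obtain V I G where V: "open V" "c \<in> V" "V \<subseteq> U" and I: "open I"
    and G: "smooth_on {w. w 0 \<in> I} (lift1 G)"
    and arg: "\<And>v. v \<in> V \<Longrightarrow> 2 * m * v 0 + (v 1)\<^sup>2 \<in> I" and gG: "\<And>v. v \<in> V \<Longrightarrow> g v = phi_arg m G v"
  proof (rule function_of_phi_arg[of e c N g m, folded U_def])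
    show "0 < e" "e \<le> \<bar>c 1\<bar>" by (rule e)+
    show "1 < N" using N by simp
    show "smooth_on U g" "depends_upto 1 U g" by (rule g)+
    show "v 1 * pd 0 g v = m * pd 1 g v" if "v \<in> U" for v
      unfolding g0[OF that] g1[OF that] by simp
  qed (rule that)
  \<comment> \<open>Form (II) needs f_12 = -r times the z_1-derivative of \<phi>, that is W / D
    times it. Since g has z_1-derivative -D f_12, the choice g = -W \<phi> achieves this.\<close>
  define \<phi> where "\<phi> = (\<lambda>s. (- 1 / W) * G s)"
  have \<phi>: "smooth_on {w. w 0 \<in> I} (lift1 \<phi>)"
    using smooth_on_cmult[OF open_coord_vimage[OF I] G, of "- 1 / W"] by (simp add: lift1_def[abs_def] \<phi>_def)
  let ?F = "phi_arg m \<phi>" and ?P = "phi_flux m \<phi>" and ?X = "phi_transport m \<phi>"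
  note sm = smooth_phi[OF V(1) I arg \<phi>] and smQ = smooth_Dx_phi_flux[OF V(1) I arg \<phi>]
  have sP: "smooth_on V ?P" and sX: "smooth_on V ?X" and sQ: "smooth_on V (Dx ?P)"
    by (rule sm smQ, assumption)+
  have gF: "g v = - W * ?F v" if "v \<in> V" for v
    using gG[OF that] W by (simp add: phi_arg_def \<phi>_def)
  have lP: "l v = W / D * ?P v" if v: "v \<in> V" for v
  proof -
    have "pd 1 ?F v = pd 1 (\<lambda>u. (- 1 / W) * g u) v"
      by (rule pd_cong_open[OF V(1) v]) (use gF W in auto)
    also have "\<dots> = (- 1 / W) * pd 1 g v"
      by (rule pd_eqI[OF DERIV_cmult[OF smooth_on_has_pd[OF g(1)]]]) (use v V(3) in auto)
    also have "\<dots> = D / W * l v" using g1[OF subsetD[OF V(3) v]] by simp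
    finally have "pd 1 ?F v = D / W * l v" .
    moreover have "pd 1 ?F v = ?P v" by (simp add: pd_phi_arg[OF V(1) I arg \<phi> v] phi_flux_def)
    ultimately have "?P v = D / W * l v" by simp
    then show ?thesis using D W by simp
  qed
  have Dl': "Dx l v = W / D * Dx ?P v" if v: "v \<in> V" for v
  proof -
    have "Dx l v = Dx (\<lambda>u. W / D * ?P u) v" by (rule Dx_cong_open[OF V(1) v lP])
    also have "\<dots> = W / D * Dx ?P v" by (rule Dx_cmult[OF V(1) v sP depends_upto_phi(2)])
    finally show ?thesis .
  qed
  \<comment> \<open>The first structure equation solved for h; this is where W \<noteq> 0 is
    essential.\<close>
  have hX: "h v = (- D) * ?X v + (- 1) * Dx ?P v" if v: "v \<in> V" for v
  proof -
    have "W / D * h v = g v * (v 2 + m) - Dx l v" using Dl[of v] v V(3) by auto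
    also have "\<dots> = W / D * ((- D) * ?X v + (- 1) * Dx ?P v)"
      unfolding gF[OF v] Dl'[OF v] phi_transport_def using D by (simp add: field_simps)
    finally show ?thesis using D W by simp
  qed
  \<comment> \<open>The values are chosen so that \<mu> / \<gamma> = \<beta> and \<gamma> + \<delta>
    \<mu>^2 is the square of \<open>\<beta>' / D\<close>. As q is the nonnegative root, \<epsilon>
    carries the sign of \<open>\<beta>' / D\<close>.\<close>
  define \<gamma> \<mu> r q \<epsilon> where "\<gamma> = 1 / D" and "\<mu> = \<beta> / D" and "r = - W / D"
    and "q = sqrt (\<gamma> + \<delta> * \<mu>\<^sup>2)" and "\<epsilon> = (if \<beta>' / D \<ge> 0 then 1 else - 1 :: real)"
  have pos: "\<gamma> + \<delta> * \<mu>\<^sup>2 = (\<beta>' / D)\<^sup>2"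
  proof -
    have "\<gamma> = D / D\<^sup>2" using D by (simp add: \<gamma>_def power2_eq_square)
    then show ?thesis unfolding \<mu>_def by (simp add: power_divide D_def diff_divide_distrib)
  qed
  have "(if x \<ge> 0 then 1 else - 1) * \<bar>x\<bar> = x" for x :: real by simp
  then have \<epsilon>q: "\<epsilon> * q = \<beta>' / D" unfolding q_def pos \<epsilon>_def real_sqrt_abs .
  have \<gamma>: "\<gamma> \<noteq> 0" using D by (simp add: \<gamma>_def)
  have rec: "\<mu> / \<gamma> = \<beta>" "\<epsilon> * q / \<gamma> = \<beta>'" "\<epsilon> * r * q / \<gamma> = r * \<beta>'" "\<delta> * r * \<mu> / \<gamma> = \<delta> * r * \<beta>"
  proof -
    show "\<epsilon> * q / \<gamma> = \<beta>'" unfolding \<epsilon>q \<gamma>_def using D by simp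
    moreover have "\<epsilon> * r * q / \<gamma> = r * (\<epsilon> * q / \<gamma>)" by simp
    ultimately show "\<epsilon> * r * q / \<gamma> = r * \<beta>'" by simp
    show "\<mu> / \<gamma> = \<beta>" "\<delta> * r * \<mu> / \<gamma> = \<delta> * r * \<beta>" unfolding \<mu>_def \<gamma>_def using D by simp_all
  qed
  have Dm: "D * m = \<beta>' * \<kappa>' - \<delta> * \<beta> * \<kappa>" using D by (simp add: m_def D_def)
  have \<kappa>: "\<kappa> = \<beta> * m - r * \<beta>'" "\<kappa>' = \<beta>' * m - \<delta> * r * \<beta>"
  proof -
    have Dr: "D * r = - W" using D by (simp add: r_def)
    have "D * (\<beta> * m - r * \<beta>') = \<beta> * (D * m) - (D * r) * \<beta>'" by (simp add: algebra_simps)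
    also have "\<dots> = D * \<kappa>" unfolding Dm Dr unfolding W_def D_def by (simp add: algebra_simps power2_eq_square)
    finally show "\<kappa> = \<beta> * m - r * \<beta>'" using D by simp
    have "D * (\<beta>' * m - \<delta> * r * \<beta>) = \<beta>' * (D * m) - \<delta> * (D * r) * \<beta>" by (simp add: algebra_simps)
    also have "\<dots> = D * \<kappa>'" unfolding Dm Dr unfolding W_def D_def by (simp add: algebra_simps power2_eq_square)
    finally show "\<kappa>' = \<beta>' * m - \<delta> * r * \<beta>" using D by simp
  qed
  have "form_II \<delta> V A B f"
    unfolding form_II_iff
  proof (rule exI[of _ \<epsilon>], rule exI[of _ m], rule exI[of _ r], rule exI[of _ \<gamma>], rule exI[of _ \<mu>],
      rule exI[of _ \<phi>], rule exI[of _ I], rule exI[of _ q], intro conjI ballI)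
    show "q = sqrt (\<gamma> + \<delta> * \<mu>\<^sup>2)" by (rule q_def)
    show "\<epsilon> \<in> {1, -1}" by (simp add: \<epsilon>_def)
    show "\<gamma> \<noteq> 0" by (rule \<gamma>)
    show "\<gamma> + \<delta> * \<mu>\<^sup>2 \<ge> 0" unfolding pos by simp
    show "open I" by (rule I)
    show "smooth_on {w. w 0 \<in> I} (lift1 \<phi>)" by (rule \<phi>)
    fix v assume v: "v \<in> V"
    then have vU: "v \<in> U" using V(3) by blast
    show "2 * m * v 0 + (v 1)\<^sup>2 \<in> I" by (rule arg[OF v])
    show "phi_arg m (deriv \<phi>) v \<noteq> 0"
      using lP[OF v] l_nz[OF vU] unfolding phi_flux_def by auto
    show "f 1 1 v = 0" by (rule f11[OF vU])
    show "f 1 2 v = - r * ?P v" unfolding f12[OF vU] lP[OF v] r_def by simp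
    show "f 2 1 v = \<mu> / \<gamma> * (v 2 + m) - \<epsilon> * r * q / \<gamma>"
      unfolding f21[OF vU] rec by (simp add: \<kappa>(1) algebra_simps)
    show "f 3 1 v = \<epsilon> * q / \<gamma> * (v 2 + m) - \<delta> * r * \<mu> / \<gamma>"
      unfolding f31[OF vU] rec by (simp add: \<kappa>(2) algebra_simps)
    show "f 2 2 v = - \<mu> * Dx ?P v + (- \<mu> / \<gamma> * (v 2 + m) + \<epsilon> * r * q / \<gamma>) * ?F v"
    proof -
      have \<mu>: "- \<mu> / \<gamma> = - \<beta>" using rec(1) by simp
      show ?thesis
        unfolding f22[OF vU] gF[OF v] hX[OF v] \<mu> rec(3) unfolding \<mu>_def r_def phi_transport_def
        using D by (simp add: field_simps)
    qed
    show "f 3 2 v = - \<epsilon> * q * Dx ?P v + (- \<epsilon> * q / \<gamma> * (v 2 + m) + \<delta> * r * \<mu> / \<gamma>) * ?F v"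
    proof -
      have q: "- \<epsilon> * q / \<gamma> = - \<beta>'" "- \<epsilon> * q = - (\<beta>' / D)" using rec(2) \<epsilon>q by simp_all
      show ?thesis
        unfolding f32[OF vU] gF[OF v] hX[OF v] q(1) rec(4) unfolding q(2) r_def phi_transport_def
        using D by (simp add: field_simps)
    qed
    show "lift3 A v * v 3 + lift3 B v = - Dx (Dx (\<lambda>u. \<gamma> * ?P u)) v - Dx ?X v + \<delta> * r\<^sup>2 * ?P v"
    proof -
      have DD: "Dx (Dx (\<lambda>u. \<gamma> * ?P u)) v = \<gamma> * Dx (Dx ?P) v"
        by (rule Dx_Dx_cmult_phi_flux[OF V(1) I arg \<phi> v])
      have "Dx h v = Dx (\<lambda>u. (- D) * ?X u + (- 1) * Dx ?P u) v"
        by (rule Dx_cong_open[OF V(1) v hX])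
      also have "\<dots> = (- D) * Dx ?X v + (- 1) * Dx (Dx ?P) v"
        by (rule Dx_linear[OF V(1) v sX sQ depends_upto_phi(3) depends_upto_Dx_phi_flux])
      finally have "D * E v = (- D) * Dx ?X v + (- 1) * Dx (Dx ?P) v + \<delta> * W * (W / D * ?P v)"
        using Dh[OF vU] lP[OF v] by simp
      also have "\<dots> = D * (- \<gamma> * Dx (Dx ?P) v - Dx ?X v + \<delta> * r\<^sup>2 * ?P v)"
        unfolding \<gamma>_def r_def using D by (simp add: field_simps power2_eq_square)
      finally have "E v = - \<gamma> * Dx (Dx ?P) v - Dx ?X v + \<delta> * r\<^sup>2 * ?P v" using D by simp
      then show ?thesis unfolding DD E_def by simp
    qed
  qed
  then show ?thesis using that V by blast
qed

section \<open>The classification on a box\<close>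

lemma classification:
  fixes c e N f A B
  defines "U \<equiv> jet_box N c e"
  assumes e: "e > 0" "e \<le> \<bar>c 1\<bar>" and k: "2 \<le> k" "k < N"
    and f: "pointwise_equivalent \<delta> U A B f" and adm: "admissible_forms 0 \<delta> U f"
    and dep: "\<And>i j. i \<in> {1,2,3} \<Longrightarrow> j \<in> {1,2} \<Longrightarrow> depends_upto k U (f i j)"
    and nd: "nondegenerate U f"
    and AB: "\<And>v. v \<in> U \<Longrightarrow> (lift3 A v)\<^sup>2 + (lift3 B v)\<^sup>2 \<noteq> 0"
    and norm: "\<And>v. v \<in> U \<Longrightarrow> f 2 1 v = \<alpha> * v 0 + \<beta> * v 2 + \<kappa>" "\<beta> \<in> {0, 1}"
  obtains V where "open V" "V \<noteq> {}" "V \<subseteq> U" "form_I \<delta> V A B f \<or> form_II \<delta> V A B f"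
proof -
  have U: "open U" unfolding U_def by (rule open_jet_box)
  have cU: "c \<in> U" unfolding U_def by (rule centre_in_jet_box[OF e(1)])
  have f11: "f 1 1 v = 0" if "v \<in> U" for v using adm that unfolding admissible_forms_def by blast
  obtain \<alpha>' \<beta>' \<kappa>' where f31': "\<And>v. v \<in> U \<Longrightarrow> f 3 1 v = \<alpha>' * v 0 + \<beta>' * v 2 + \<kappa>'"
    using adm unfolding admissible_forms_def by blast
  define D where "D = \<beta>'\<^sup>2 - \<delta> * \<beta>\<^sup>2"
  have D: "D \<noteq> 0"
  proof -
    have "pd 2 (f 2 1) c = \<beta>" "pd 2 (f 3 1) c = \<beta>'"
      using pd_cong_open[OF U cU norm(1)] pd_cong_open[OF U cU f31'] by (simp_all add: pd_affine)
    then show ?thesis using adm cU unfolding admissible_forms_def D_def by auto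
  qed
  let ?E = "\<lambda>v. lift3 A v * v 3 + lift3 B v"
  have ne: "U \<noteq> {}" using cU by blast
  note ids = structure_identities[OF U ne f f11 norm(1) f31']
  have zero: "\<alpha> = 0" "\<alpha>' = 0"
    and D1: "\<And>v. v \<in> U \<Longrightarrow> Dx (f 1 2) v = f 3 1 v * f 2 2 v - f 3 2 v * f 2 1 v"
    and D2: "\<And>v. v \<in> U \<Longrightarrow> Dx (f 2 2) v = \<beta> * ?E v - f 1 2 v * f 3 1 v"
    and D3: "\<And>v. v \<in> U \<Longrightarrow> Dx (f 3 2) v = \<beta>' * ?E v - \<delta> * (f 1 2 v * f 2 1 v)"
    by (rule ids; assumption)+
  have f21: "f 2 1 v = \<beta> * v 2 + \<kappa>" and f31: "f 3 1 v = \<beta>' * v 2 + \<kappa>'" if "v \<in> U" for v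
    using norm(1)[OF that] f31'[OF that] zero by simp_all
  have "\<forall>i\<in>{1,2,3}. \<forall>j\<in>{1,2}. smooth_on U (f i j)"
    using f unfolding pointwise_equivalent_def by blast
  then have sm: "smooth_on U (f 1 2)" "smooth_on U (f 2 2)" "smooth_on U (f 3 2)" by simp_all
  have E3: "depends_upto 3 U ?E"
    by (rule depends_uptoI) (simp add: lift3_def)
  have S2: "depends_upto 2 U (f 2 1)" "depends_upto 2 U (f 3 1)"
    by (rule depends_uptoI, simp only: f21 f31 order_refl)+
  have dep2: "depends_upto 2 U (f 1 2) \<and> depends_upto 2 U (f 2 2) \<and> depends_upto 2 U (f 3 2)"
    unfolding U_def
    by (rule coefficients_second_order[OF k sm[unfolded U_def] dep[unfolded U_def] dep[unfolded U_def]
          dep[unfolded U_def] S2[unfolded U_def] E3[unfolded U_def] D1[unfolded U_def] D2[unfolded U_def]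
          D3[unfolded U_def]]) simp_all
  have N: "2 < N" using k by simp
  let ?W = "\<beta>' * \<kappa> - \<beta> * \<kappa>'" and ?m = "(\<beta>' * \<kappa>' - \<delta> * \<beta> * \<kappa>) / D"
  obtain g h where g: "smooth_on U g" "depends_upto 1 U g" and h: "smooth_on U h" "depends_upto 2 U h"
    and l1: "depends_upto 1 U (f 1 2)"
    and f22: "\<And>v. v \<in> U \<Longrightarrow> f 2 2 v = (\<beta>' * g v + \<beta> * h v) / D"
    and f32: "\<And>v. v \<in> U \<Longrightarrow> f 3 2 v = (\<delta> * \<beta> * g v + \<beta>' * h v) / D"
    and Dl: "\<And>v. v \<in> U \<Longrightarrow> Dx (f 1 2) v = g v * (v 2 + ?m) - ?W / D * h v"
    and Dg: "\<And>v. v \<in> U \<Longrightarrow> Dx g v = - D * f 1 2 v * (v 2 + ?m)"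
    and Dh: "\<And>v. v \<in> U \<Longrightarrow> Dx h v = D * ?E v - \<delta> * ?W * f 1 2 v"
  proof (rule decoupled_structure_equations[of \<beta>' \<delta> \<beta> N c e f \<kappa> \<kappa>' A B, folded U_def D_def])
    show "D \<noteq> 0" by (rule D)
    show "2 < N" by (rule N)
    show "smooth_on U (f 1 2)" "smooth_on U (f 2 2)" "smooth_on U (f 3 2)" by (rule sm)+
    show "depends_upto 2 U (f 1 2)" "depends_upto 2 U (f 2 2)" "depends_upto 2 U (f 3 2)" using dep2 by blast+
    fix v assume v: "v \<in> U"
    show "f 2 1 v = \<beta> * v 2 + \<kappa>" by (rule f21[OF v])
    show "f 3 1 v = \<beta>' * v 2 + \<kappa>'" by (rule f31[OF v])
    show "Dx (f 1 2) v = f 3 1 v * f 2 2 v - f 3 2 v * f 2 1 v" by (rule D1[OF v])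
    show "Dx (f 2 2) v = \<beta> * ?E v - f 1 2 v * f 3 1 v" by (rule D2[OF v])
    show "Dx (f 3 2) v = \<beta>' * ?E v - \<delta> * (f 1 2 v * f 2 1 v)" by (rule D3[OF v])
  qed (rule that)
  \<comment> \<open>Because f_11 = 0, the wedge is -f_12 f_21.\<close>
  have l_nz: "f 1 2 v \<noteq> 0" and f21_nz: "f 2 1 v \<noteq> 0" if "v \<in> U" for v
    using nd that f11[OF that] unfolding nondegenerate_def wedge_def by auto
  \<comment> \<open>An arbitrary H covers all coefficient functions to which the comparison of
    coefficients is applied.\<close>
  have const: "depends_upto 1 U (\<lambda>v. H (f 1 2 v) (g v))" for H :: "real \<Rightarrow> real \<Rightarrow> real"
  proof (rule depends_uptoI)
    fix v w assume vw: "v \<in> U" "w \<in> U" "\<And>i. i \<le> 1 \<Longrightarrow> v i = w i"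
    have "f 1 2 v = f 1 2 w" "g v = g w"
      by (rule depends_upto_eq[OF l1 vw] depends_upto_eq[OF g(2) vw], assumption)+
    then show "H (f 1 2 v) (g v) = H (f 1 2 w) (g w)" by (simp only:)
  qed
  have Dg': "Dx g v = (- D * f 1 2 v) * v 2 + (- D * f 1 2 v * ?m)" if "v \<in> U" for v
    unfolding Dg[OF that] by (simp only: distrib_left)
  note gc = total_derivative_coefficients[OF U g(2) const[of "\<lambda>x y. - D * x"] const[of "\<lambda>x y. - D * x * ?m"] Dg']
  have g1: "pd 1 g v = - D * f 1 2 v" and g0: "v 1 * pd 0 g v = - D * f 1 2 v * ?m" if "v \<in> U" for v
    by (rule gc[OF _ that], assumption)+
  show ?thesis
  proof (cases "?W = 0")
    case False
    obtain V where "open V" "V \<noteq> {}" "V \<subseteq> U" "form_II \<delta> V A B f"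
    proof (rule classification_form_II[of e c N \<beta>' \<delta> \<beta> \<kappa> \<kappa>' "f 1 2" g f h A B, folded U_def D_def])
      show "0 < e" "e \<le> \<bar>c 1\<bar>" by (rule e)+
      show "2 < N" by (rule N)
      show "D \<noteq> 0" by (rule D)
      show "?W \<noteq> 0" by (rule False)
      show "smooth_on U (f 1 2)" by (rule sm)
      show "depends_upto 1 U (f 1 2)" by (rule l1)
      show "smooth_on U g" "depends_upto 1 U g" by (rule g)+
      fix v assume v: "v \<in> U"
      show "f 1 1 v = 0" by (rule f11[OF v])
      show "f 1 2 v = f 1 2 v" ..
      show "f 2 1 v = \<beta> * v 2 + \<kappa>" by (rule f21[OF v])
      show "f 2 2 v = (\<beta>' * g v + \<beta> * h v) / D" by (rule f22[OF v])
      show "f 3 1 v = \<beta>' * v 2 + \<kappa>'" by (rule f31[OF v])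
      show "f 3 2 v = (\<delta> * \<beta> * g v + \<beta>' * h v) / D" by (rule f32[OF v])
      show "pd 1 g v = - D * f 1 2 v" by (rule g1[OF v])
      show "v 1 * pd 0 g v = - D * f 1 2 v * ?m" by (rule g0[OF v])
      show "f 1 2 v \<noteq> 0" by (rule l_nz[OF v])
      show "Dx (f 1 2) v = g v * (v 2 + ?m) - ?W / D * h v" by (rule Dl[OF v])
      show "Dx h v = D * ?E v - \<delta> * ?W * f 1 2 v" by (rule Dh[OF v])
    qed (rule that)
    then show ?thesis using that by blast
  next
    case W: True
    have Dl': "Dx (f 1 2) v = g v * v 2 + g v * ?m" if "v \<in> U" for v
      unfolding Dl[OF that] W by (simp add: distrib_left)
    note lc = total_derivative_coefficients[OF U l1 const[of "\<lambda>x y. y"] const[of "\<lambda>x y. y * ?m"] Dl']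
    have l1': "pd 1 (f 1 2) v = g v" and l0: "v 1 * pd 0 (f 1 2) v = g v * ?m" if "v \<in> U" for v
      by (rule lc[OF _ that], assumption)+
    have z1: "v 1 \<noteq> 0" if "v \<in> U" for v
    proof -
      have "\<bar>v 1 - c 1\<bar> < e" using that N by (simp add: U_def jet_box_def)
      then show ?thesis using e(2) by auto
    qed
    have m: "?m = 0"
      by (rule travelling_coefficient_zero(1)[OF U ne sm(1) g(1) D]) (rule g1 g0 l1' l0 l_nz z1, assumption)+
    have g0': "pd 0 g v = 0" if "v \<in> U" for v
      by (rule travelling_coefficient_zero(2)[OF U ne sm(1) g(1) D _ _ _ _ _ _ that, of ?m])
         (rule g1 g0 l1' l0 l_nz z1, assumption)+
    have "\<beta>' * \<kappa>' - \<delta> * \<beta> * \<kappa> = 0" using m D unfolding D_def by simp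
    \<comment> \<open>m = 0 and W = 0 are two homogeneous linear equations for \<kappa> and
      \<open>\<kappa>'\<close>, with determinant D up to sign; hence both constants vanish.\<close>
    then have K: "\<beta>' * \<kappa>' = \<delta> * \<beta> * \<kappa>" "\<beta>' * \<kappa> = \<beta> * \<kappa>'" using W by simp_all
    have "D * \<kappa> = \<beta>' * (\<beta>' * \<kappa>) - \<beta> * (\<delta> * \<beta> * \<kappa>)" by (simp add: D_def algebra_simps power2_eq_square)
    then have \<kappa>: "\<kappa> = 0" using D unfolding K(1)[symmetric] K(2) by simp
    have "D * \<kappa>' = \<beta>' * (\<beta>' * \<kappa>') - \<delta> * \<beta> * (\<beta> * \<kappa>')" by (simp add: D_def algebra_simps power2_eq_square)
    then have \<kappa>': "\<kappa>' = 0" using D unfolding K(1) K(2)[symmetric] \<kappa> by simp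
    \<comment> \<open>For \<beta> = 0 the coefficient f_21 would vanish, contrary to
      nondegeneracy.\<close>
    have \<beta>: "\<beta> = 1" using f21[OF cU] f21_nz[OF cU] norm(2) \<kappa> by auto
    have D': "\<beta>'\<^sup>2 - \<delta> = D" by (simp add: D_def \<beta>)
    have "form_I \<delta> U A B f"
    proof (rule classification_form_I[of e N \<beta>' \<delta> c A B "f 1 2" g h f, folded U_def, unfolded D'])
      show "0 < e" by (rule e)
      show "2 < N" by (rule N)
      show "D \<noteq> 0" by (rule D)
      show "smooth_on U (f 1 2)" by (rule sm)
      show "depends_upto 1 U (f 1 2)" by (rule l1)
      show "smooth_on U g" "depends_upto 1 U g" by (rule g)+
      show "smooth_on U h" "depends_upto 2 U h" by (rule h)+
      fix v assume v: "v \<in> U"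
      show "(lift3 A v)\<^sup>2 + (lift3 B v)\<^sup>2 \<noteq> 0" by (rule AB[OF v])
      show "f 1 1 v = 0" by (rule f11[OF v])
      show "f 1 2 v = f 1 2 v" ..
      show "f 2 1 v = v 2" using f21[OF v] \<beta> \<kappa> by simp
      show "f 2 2 v = (\<beta>' * g v + h v) / D" using f22[OF v] \<beta> by simp
      show "f 3 1 v = \<beta>' * v 2" using f31[OF v] \<kappa>' by simp
      show "f 3 2 v = (\<delta> * g v + \<beta>' * h v) / D" using f32[OF v] \<beta> by simp
      show "pd 1 g v = - D * f 1 2 v" by (rule g1[OF v])
      show "pd 0 g v = 0" by (rule g0'[OF v])
      show "pd 1 (f 1 2) v = g v" by (rule l1'[OF v])
      show "f 1 2 v \<noteq> 0" by (rule l_nz[OF v])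
      show "Dx h v = D * (lift3 A v * v 3 + lift3 B v)" using Dh[OF v] W by simp
    qed
    then show ?thesis using that U ne by blast
  qed
qed

text \<open>Prepares the hypotheses of \<open>classification\<close>: a box small enough to pass
  from solutions to jets, a scaling of z, and then a second box on which z_1 has no zero.\<close>

lemma describes_imp_form_I_or_II:
  assumes AB: "\<And>v. v \<in> \<Omega> \<Longrightarrow> (lift3 A v)\<^sup>2 + (lift3 B v)\<^sup>2 \<noteq> 0"
    and f: "generically \<Omega> (\<lambda>V. describes_surfaces \<delta> V A B f \<and> admissible_forms 0 \<delta> V f)"
  shows "generically \<Omega> (\<lambda>V. form_I_or_II \<delta> V A B f \<and> nondegenerate V f)"
proof -
  from f obtain V where V: "V \<subseteq> \<Omega>" "open V" "V \<noteq> {}"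
    and desc: "describes_surfaces \<delta> V A B f" and adm: "admissible_forms 0 \<delta> V f"
    unfolding generically_def by blast
  obtain k where k: "\<And>i j. i \<in> {1,2,3} \<Longrightarrow> j \<in> {1,2} \<Longrightarrow> depends_upto k V (f i j)"
    using conjunct1[OF desc[unfolded describes_surfaces_def]] by blast
  obtain v0 where "v0 \<in> V" using V(3) by blast
  from open_contains_jet_box[OF V(2) this zero_less_one, of "k + 4"] obtain N e where
    Ne: "e > 0" "k + 4 \<le> N" "jet_box N v0 e \<subseteq> V" by blast
  define U where "U = jet_box N v0 e"
  have U: "open U" "v0 \<in> U" "U \<subseteq> V"
    using open_jet_box centre_in_jet_box[OF Ne(1)] Ne(3) by (simp_all add: U_def)
  have pe: "pointwise_equivalent \<delta> U A B f"
    unfolding U_def by (rule describes_imp_pointwise_equivalent[OF desc Ne(3) k]) (use Ne(2) in auto)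
  obtain \<alpha> \<beta> \<kappa> where f21: "\<And>v. v \<in> V \<Longrightarrow> f 2 1 v = \<alpha> * v 0 + \<beta> * v 2 + \<kappa>"
    using adm unfolding admissible_forms_def by blast
  \<comment> \<open>Under Z = c z the coefficient \<beta> of z_2 in f_21 becomes \<beta> / c, so
    this choice makes it 0 or 1.\<close>
  define c where "c = (if \<beta> = 0 then 1 else \<beta>)"
  have nz: "(1::real) \<noteq> 0" "(1::real) \<noteq> 0" "c \<noteq> 0" by (simp_all add: c_def)
  let ?tr = "tr_jet 1 c 0" and ?A = "tr_A 1 1 c 0 A" and ?B = "tr_B 1 1 c 0 B" and ?f = "tr_f 1 1 c 0 f"
  let ?U = "?tr ` U"
  have oU: "open ?U" by (rule open_tr_image[OF nz U(1)])
  have pe': "pointwise_equivalent \<delta> ?U ?A ?B ?f" by (rule pointwise_equivalent_tr[OF nz U(1) pe])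
  have smU: "\<And>i j. i \<in> {1,2,3} \<Longrightarrow> j \<in> {1,2} \<Longrightarrow> smooth_on U (f i j)"
    using pe unfolding pointwise_equivalent_def by blast
  have adm': "admissible_forms 0 \<delta> ?U ?f"
    by (rule admissible_forms_tr[OF nz admissible_forms_subset[OF adm U(3)]]) (rule smU)
  have ndV: "nondegenerate V f" using conjunct1[OF conjunct2[OF desc[unfolded describes_surfaces_def]]] .
  then have "nondegenerate U f" using U(3) unfolding nondegenerate_def by blast
  then have nd': "nondegenerate ?U ?f" unfolding nondegenerate_tr[OF nz] .
  have AB': "(lift3 ?A v)\<^sup>2 + (lift3 ?B v)\<^sup>2 \<noteq> 0" if "v \<in> ?U" for v
  proof -
    obtain w where w: "w \<in> U" "v = ?tr w" using \<open>v \<in> ?U\<close> by blast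
    have "w \<in> \<Omega>" using w(1) U(3) V(1) by blast
    then have "lift3 A w \<noteq> 0 \<or> lift3 B w \<noteq> 0" using AB[of w] by auto
    then have "lift3 ?A v \<noteq> 0 \<or> lift3 ?B v \<noteq> 0" unfolding w(2) lift3_tr[OF nz] using nz by auto
    then show ?thesis by simp
  qed
  have f21': "?f 2 1 v = (\<alpha> / c) * v 0 + (if \<beta> = 0 then 0 else 1) * v 2 + \<kappa>" if "v \<in> ?U" for v
  proof -
    obtain w where w: "w \<in> U" "v = ?tr w" using \<open>v \<in> ?U\<close> by blast
    have "?f 2 1 v = \<alpha> * w 0 + \<beta> * w 2 + \<kappa>"
      unfolding w(2) tr_f_tr[OF nz] using f21[of w] w(1) U(3) by auto
    then show ?thesis using nz(3) unfolding w(2) by (simp add: tr_jet_def c_def)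
  qed
  obtain k' where k': "\<And>i j. i \<in> {1,2,3} \<Longrightarrow> j \<in> {1,2} \<Longrightarrow> depends_upto k' ?U (?f i j)"
    using pe' unfolding pointwise_equivalent_def by blast
  have "?tr v0 \<in> ?U" using U(2) by blast
  \<comment> \<open>The centre of the second box gets z_1 = s \<noteq> 0; a radius of at most |s|
    then keeps z_1 away from 0.\<close>
  from open_jet_avoid[OF oU this, of "{0}" 1] obtain s where s: "s \<noteq> 0" "(?tr v0)(1 := s) \<in> ?U" by auto
  let ?c = "(?tr v0)(1 := s)"
  have "0 < \<bar>s\<bar>" using s(1) by simp
  then obtain N' e' where N': "e' > 0" "k' + 3 \<le> N'" "e' \<le> \<bar>s\<bar>" "jet_box N' ?c e' \<subseteq> ?U"
    by (rule open_contains_jet_box[OF oU s(2), where M = "k' + 3"])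
  let ?U' = "jet_box N' ?c e'"
  \<comment> \<open>Enlarging the order to k' + 2 guarantees that it is at least 2, where the
    descent in the order ends.\<close>
  have dep': "depends_upto (k' + 2) ?U' (?f i j)" if "i \<in> {1,2,3}" "j \<in> {1,2}" for i j
    by (rule depends_upto_mono[OF depends_upto_subset[OF k'[OF that] N'(4)]]) simp
  obtain V' where V': "open V'" "V' \<noteq> {}" "V' \<subseteq> ?U'" and form: "form_I \<delta> V' ?A ?B ?f \<or> form_II \<delta> V' ?A ?B ?f"
  proof (rule classification[of e' ?c "k' + 2" N' \<delta> ?A ?B ?f "\<alpha> / c" "if \<beta> = 0 then 0 else 1" \<kappa>])
    show "e' > 0" "2 \<le> k' + 2" "k' + 2 < N'" using N' by auto
    show "e' \<le> \<bar>?c 1\<bar>" using N'(3) by simp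
    show "pointwise_equivalent \<delta> ?U' ?A ?B ?f" by (rule pointwise_equivalent_subset[OF pe' N'(4)])
    show "admissible_forms 0 \<delta> ?U' ?f" by (rule admissible_forms_subset[OF adm' N'(4)])
    show "nondegenerate ?U' ?f" using nd' N'(4) unfolding nondegenerate_def by blast
    show "(if \<beta> = 0 then 0 else 1) \<in> {0, 1 :: real}" by simp
    show "depends_upto (k' + 2) ?U' (?f i j)" if "i \<in> {1,2,3}" "j \<in> {1,2}" for i j by (rule dep'[OF that])
    show "(lift3 ?A v)\<^sup>2 + (lift3 ?B v)\<^sup>2 \<noteq> 0" if "v \<in> ?U'" for v by (rule AB'[OF subsetD[OF N'(4) that]])
    show "?f 2 1 v = (\<alpha> / c) * v 0 + (if \<beta> = 0 then 0 else 1) * v 2 + \<kappa>" if "v \<in> ?U'" for v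
      by (rule f21'[OF subsetD[OF N'(4) that]])
  qed
  \<comment> \<open>The preimage of V' under the scaling, so that the normal form holds on its
    image.\<close>
  define T where "T = {v \<in> U. ?tr v \<in> V'}"
  have T: "?tr ` T = V'"
  proof
    show "V' \<subseteq> ?tr ` T"
    proof
      fix w assume w: "w \<in> V'"
      then have "w \<in> ?U" using V'(3) N'(4) by blast
      then obtain v where "v \<in> U" "w = ?tr v" by blast
      then show "w \<in> ?tr ` T" using w unfolding T_def by blast
    qed
  qed (auto simp: T_def)
  have "open T"
  proof -
    have "T = tr_jet (1 / 1) (1 / c) (- 0 / c) ` (?tr ` T)" by (rule tr_inverse(1)[OF nz, symmetric])
    then have "T = tr_jet 1 (1 / c) 0 ` V'" unfolding T by simp
    moreover have "1 / c \<noteq> 0" using nz by simp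
    ultimately show ?thesis using open_tr_image[OF nz(1,2) _ V'(1), of "1 / c" 0] by simp
  qed
  moreover have "T \<noteq> {}" using T V'(2) by blast
  moreover have "T \<subseteq> \<Omega>" using U(3) V(1) unfolding T_def by blast
  moreover have "nondegenerate T f" using ndV U(3) unfolding nondegenerate_def T_def by blast
  moreover have "form_I_or_II \<delta> T A B f"
    unfolding form_I_or_II_def Let_def
  proof (rule exI[of _ 1], rule exI[of _ 1], rule exI[of _ c], rule exI[of _ 0], intro conjI)
    show "1 * 1 * c \<noteq> 0" using nz by simp
  qed (unfold T, rule form)
  ultimately show ?thesis
    unfolding generically_def by (intro exI[of _ T] conjI)
qed

theorem theorem3p5:
  fixes \<delta> :: real
    and A B :: "real \<Rightarrow> real \<Rightarrow> real \<Rightarrow> real"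
    and \<Omega> :: "jet set"
  assumes "\<delta> \<in> {1, -1}"
    and "open \<Omega>"
    and "smooth_on \<Omega> (lift3 A)" and "smooth_on \<Omega> (lift3 B)"
    and "\<forall>v\<in>\<Omega>. (lift3 A v)\<^sup>2 + (lift3 B v)\<^sup>2 \<noteq> 0"
  shows "((\<exists>f. generically \<Omega> (\<lambda>V. describes_surfaces \<delta> V A B f \<and> admissible_forms 0 \<delta> V f))
           \<longleftrightarrow> (\<exists>f. generically \<Omega> (\<lambda>V. form_I_or_II \<delta> V A B f)))
       \<and> (\<forall>f. generically \<Omega> (\<lambda>V. describes_surfaces \<delta> V A B f \<and> admissible_forms 0 \<delta> V f)
           \<longleftrightarrow> generically \<Omega> (\<lambda>V. form_I_or_II \<delta> V A B f \<and> nondegenerate V f))"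
proof (intro conjI allI iffI)
  have AB: "(lift3 A v)\<^sup>2 + (lift3 B v)\<^sup>2 \<noteq> 0" if "v \<in> \<Omega>" for v using assms(5) that by blast
  note classify = describes_imp_form_I_or_II[of \<Omega> A B \<delta>, OF AB]
  show "\<exists>f. generically \<Omega> (\<lambda>V. form_I_or_II \<delta> V A B f)"
    if "\<exists>f. generically \<Omega> (\<lambda>V. describes_surfaces \<delta> V A B f \<and> admissible_forms 0 \<delta> V f)"
  proof -
    from that obtain f where "generically \<Omega> (\<lambda>V. describes_surfaces \<delta> V A B f \<and> admissible_forms 0 \<delta> V f)" ..
    then have "generically \<Omega> (\<lambda>V. form_I_or_II \<delta> V A B f \<and> nondegenerate V f)" by (rule classify[rotated])
    then show ?thesis unfolding generically_def by blast
  qed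
  show "\<exists>f. generically \<Omega> (\<lambda>V. describes_surfaces \<delta> V A B f \<and> admissible_forms 0 \<delta> V f)"
    if "\<exists>f. generically \<Omega> (\<lambda>V. form_I_or_II \<delta> V A B f)"
  proof -
    from that obtain f V where V: "open V" "V \<noteq> {}" "V \<subseteq> \<Omega>" and f: "form_I_or_II \<delta> V A B f"
      unfolding generically_def by blast
    \<comment> \<open>The 1-forms obtained may differ from f, and they describe surfaces on a
      possibly smaller open set.\<close>
    show ?thesis by (rule form_I_or_II_imp_describes[OF assms(1) V _ f]) (use AB V(3) in blast)
  qed
  fix f
  show "generically \<Omega> (\<lambda>V. form_I_or_II \<delta> V A B f \<and> nondegenerate V f)"
    if "generically \<Omega> (\<lambda>V. describes_surfaces \<delta> V A B f \<and> admissible_forms 0 \<delta> V f)"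
    by (rule classify[OF _ that])
  show "generically \<Omega> (\<lambda>V. describes_surfaces \<delta> V A B f \<and> admissible_forms 0 \<delta> V f)"
    if form: "generically \<Omega> (\<lambda>V. form_I_or_II \<delta> V A B f \<and> nondegenerate V f)"
  proof -
    from form obtain V where V: "open V" "V \<noteq> {}" "V \<subseteq> \<Omega>" and f: "form_I_or_II \<delta> V A B f" and nd: "nondegenerate V f"
      unfolding generically_def by blast
    note pe = form_I_or_II_pointwise_equivalent[OF assms(1) V(1) f]
    \<comment> \<open>Here nondegeneracy is given, so the same f and the same V serve.\<close>
    have "describes_surfaces \<delta> V A B f \<and> admissible_forms 0 \<delta> V f"
      using pointwise_equivalent_imp_describes[OF pe(1) nd] pe(2) by blast
    then show ?thesis unfolding generically_def using V by blast
  qed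
qed

end
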